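(* Let $m\in\mathbb{N}$ and let $\mathscr{G}$ be a blow-up function of order $m$ (as defined in the context). Assume that the real-valued effective potential satisfies $V\in L^{\infty}_{\rm per}(\Omega)\cap H^{r}_{\rm per}(\Omega)$ for some $r>1-\frac{d}{4}$. Let $n\in\mathbb{N}^*$, and for each $\mathbf{k}\in\mathbb{R}^d$ let $$\mathrm{Y}_n^{\mathbf{k}}:=\mathrm{span}\{u_{j,\mathbf{k}} : j\in\{1,\ldots,n\}\}\subset H^2_{\rm per}(\Omega)$$ be the span of the first $n$ eigenfunctions of the exact fiber $\mathrm{H}_{\mathbf{k}}$. Then there exist $\mathrm{E}_c^*>0$ and a constant $\mathrm{C}>0$ such that for every $\mathrm{E}_c\ge \mathrm{E}_c^*$ and all $\mathbf{k}\in\mathbb{R}^d$, $$0\le \widetilde{\varepsilon}^{\,\mathrm{E}_c}_{n,\mathbf{k}}-\varepsilon_{n,\mathbf{k}}\le \left(\frac{\mathrm{C}}{\mathrm{E}_c}\right)^{r+1-\frac{d}{4}}\ \max_{\substack{\Phi\in \mathrm{Y}_n^{\mathbf{k}}\\ \|\Phi\|_{L^2_{\rm per}(\Omega)}=1}}\|\Phi\|^2_{H^{r+2}_{\rm per}(\Omega)} .$$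
   Context: Lattice. $d\in\mathbb{N}^*=\{1,2,\ldots\}$; $\mathbf{a}_1,\ldots,\mathbf{a}_d\in\mathbb{R}^d$ are linearly independent, $\mathbf{b}_1,\ldots,\mathbf{b}_d\in\mathbb{R}^d$ satisfy $\mathbf{a}_i\cdot\mathbf{b}_j=2\pi\delta_{ij}$; $\mathbb{L}=\mathbb{Z}\mathbf{a}_1+\cdots+\mathbb{Z}\mathbf{a}_d$ is the primitive lattice and $\mathbb{L}^*=\mathbb{Z}\mathbf{b}_1+\cdots+\mathbb{Z}\mathbf{b}_d$ the reciprocal lattice. $\Omega\subset\mathbb{R}^d$ is the first Wigner-Seitz cell of $\mathbb{L}$ (points closer to the origin than to any other point of $\mathbb{L}$). Function spaces. $L^2_{\rm per}(\Omega)$ is the space of complex-valued, $\mathbb{L}$-periodic, locally square-integrable functions on $\mathbb{R}^d$ with inner product $(f,g)=\int_\Omega\overline{f}g$; $L^\infty_{\rm per}(\Omega)$ is defined analogously. For $\mathbf{G}\in\mathbb{L}^*$ let $e_{\mathbf{G}}(\mathbf{x})=|\Omega|^{-1/2}e^{\imath\mathbf{G}\cdot\mathbf{x}}$ and $\widehat{f}_{\mathbf{G}}=\int_\Omega f\,\overline{e_{\mathbf{G}}}$. For $s>0$, $H^s_{\rm per}(\Omega)=\{f\in L^2_{\rm per}(\Omega):\sum_{\mathbf{G}\in\mathbb{L}^*}(1+|\mathbf{G}|^2)^s|\widehat{f}_{\mathbf{G}}|^2<\infty\}$ with norm $\|f\|_{H^s_{\rm per}(\Omega)}^2=\sum_{\mathbf{G}\in\mathbb{L}^*}(1+|\mathbf{G}|^2)^s|\widehat{f}_{\mathbf{G}}|^2$;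 $H^0_{\rm per}(\Omega)=L^2_{\rm per}(\Omega)$, and $H^{-s}_{\rm per}(\Omega)$ is the dual of $H^s_{\rm per}(\Omega)$ with the dual norm. Exact fibers. $V\in L^\infty_{\rm per}(\Omega)$ is a fixed real-valued potential. For $\mathbf{k}\in\mathbb{R}^d$, $\mathrm{H}_{\mathbf{k}}:=\frac12(-\imath\nabla+\mathbf{k})^2+V$ is the self-adjoint operator on $L^2_{\rm per}(\Omega)$ with domain $H^2_{\rm per}(\Omega)$; it is bounded below with compact resolvent. Its eigenvalues, counted with multiplicity and ordered nondecreasingly, are $\varepsilon_{1,\mathbf{k}}\le\varepsilon_{2,\mathbf{k}}\le\cdots$, and $(u_{j,\mathbf{k}})_{j\in\mathbb{N}^*}$ is a corresponding $L^2_{\rm per}(\Omega)$-orthonormal basis of eigenfunctions, $\mathrm{H}_{\mathbf{k}}u_{j,\mathbf{k}}=\varepsilon_{j,\mathbf{k}}u_{j,\mathbf{k}}$. Blow-up function. Let $m\in\mathbb{N}$ (including $m=0$). A blow-up function of order $m$ is a function $\mathscr{G}:\mathbb{R}\to\mathbb{R}$ of the form $\mathscr{G}(x)=x^2$ for $|x|\in[0,\frac12]\cup[1,\infty)$ and $\mathscr{G}(x)=h(|x|)$ for $|x|\in(\frac12,1)$, where $h:[\frac12,1)\to\mathbb{R}$ satisfies: (1) $h$ is of class $\mathscr{C}^m$ on $(\frac12,1)$; (2) $\lim_{x\to1^-}(1-x)^m h(x)=+\infty$; (3) $h(x)\ge x^2$ for all $x\in(\frac12,1)$; (4) for all $j\in\{0,\ldots,m\}$,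 $h^{(j)}(\frac12)=\frac{d^j}{dx^j}(x^2)\big|_{x=1/2}$ (one-sided derivatives from the right), so that $\mathscr{G}$ is of class $\mathscr{C}^m$ on $[0,1)$. Modified discretization. For $\mathrm{E}_c>0$ and $\mathbf{k}\in\mathbb{R}^d$, let $\mathrm{X}_{\mathbf{k}}^{\mathrm{E}_c}:=\mathrm{span}\{e_{\mathbf{G}}:\mathbf{G}\in\mathbb{L}^*,\ \frac12|\mathbf{k}+\mathbf{G}|^2<\mathrm{E}_c\}$, let $M_{\mathrm{E}_c}(\mathbf{k})$ be its dimension, and let $\Pi_{\mathbf{k},\mathrm{E}_c}$ be the $L^2_{\rm per}(\Omega)$-orthogonal projection onto it. The modified Hamiltonian $\widetilde{\mathrm{H}}_{\mathbf{k}}^{\mathscr{G},\mathrm{E}_c}:\mathrm{X}_{\mathbf{k}}^{\mathrm{E}_c}\to\mathrm{X}_{\mathbf{k}}^{\mathrm{E}_c}$ is $$\widetilde{\mathrm{H}}_{\mathbf{k}}^{\mathscr{G},\mathrm{E}_c}:=\Pi_{\mathbf{k},\mathrm{E}_c}\left(\mathrm{E}_c\,\mathscr{G}\left(\frac{|-\imath\nabla+\mathbf{k}|}{\sqrt{2\mathrm{E}_c}}\right)+V\right)\Pi_{\mathbf{k},\mathrm{E}_c},$$ i.e. $\widetilde{\mathrm{H}}_{\mathbf{k}}^{\mathscr{G},\mathrm{E}_c}\Phi=\sum_{\mathbf{G}}\mathrm{E}_c\,\mathscr{G}\big(\frac{|\mathbf{k}+\mathbf{G}|}{\sqrt{2\mathrm{E}_c}}\big)\widehat{\Phi}_{\mathbf{G}}e_{\mathbf{G}}+\Pi_{\mathbf{k},\mathrm{E}_c}(V\Phi)$,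 the sum being over $\mathbf{G}\in\mathbb{L}^*$ with $\frac12|\mathbf{k}+\mathbf{G}|^2<\mathrm{E}_c$. Its eigenvalues, counted with multiplicity and ordered nondecreasingly, are $\widetilde{\varepsilon}^{\,\mathrm{E}_c}_{1,\mathbf{k}}\le\cdots\le\widetilde{\varepsilon}^{\,\mathrm{E}_c}_{M_{\mathrm{E}_c}(\mathbf{k}),\mathbf{k}}$. (For fixed $n$, $\widetilde{\varepsilon}^{\,\mathrm{E}_c}_{n,\mathbf{k}}$ is defined for all $\mathbf{k}$ once $\mathrm{E}_c$ is large enough; $\mathrm{E}_c^*$ in the claim is understood to be at least that large.)
   Formalization: Stated for r ≥ −2 (automatic for d ≤ 12); for r < −2 the claim fails, e.g. V = cos(b_1·x): shifting k in L* sends the H^{r+2} norm to 0 but keeps the eigenvalue error. The maximum is a supremum in [0,∞]; its finiteness is not asserted. *)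

theory Defs
  imports "HOL-Analysis.Analysis" "HOL-Library.Function_Algebras"
begin

type_synonym 'd cfun = "real^'d \<Rightarrow> complex"

definition fscale :: "complex \<Rightarrow> ('d::finite) cfun \<Rightarrow> 'd cfun" where
  "fscale c f = (\<lambda>x. c * f x)"

global_interpretation cfun: vector_space "fscale :: complex \<Rightarrow> ('d::finite) cfun \<Rightarrow> 'd cfun"
  defines cspan = cfun.span and cdim = cfun.dim
  by unfold_locales (auto simp: fscale_def fun_eq_iff algebra_simps)


section \<open>Lattices\<close>

definition zspan :: "('d::finite \<Rightarrow> real^'d) \<Rightarrow> (real^'d) set" where
  "zspan a = range (\<lambda>z :: 'd \<Rightarrow> int. \<Sum>i\<in>UNIV. of_int (z i) *\<^sub>R a i)"

definition lattice_bases :: "('d::finite \<Rightarrow> real^'d) \<Rightarrow> ('d \<Rightarrow> real^'d) \<Rightarrow> bool" where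
  "lattice_bases a b \<longleftrightarrow>
     inj a \<and> independent (range a) \<and>
     (\<forall>i j. a i \<bullet> b j = (if i = j then 2 * pi else 0))"

definition wigner_seitz :: "('d::finite \<Rightarrow> real^'d) \<Rightarrow> (real^'d) set" where
  "wigner_seitz a = {x. \<forall>R \<in> zspan a - {0}. dist x 0 < dist x R}"


section \<open>Periodic function spaces\<close>

text \<open>Elements of the function spaces are represented by functions on the whole of
  \<open>\<real>\<^sup>d\<close>, not by equivalence classes; hence periodicity is only required almost everywhere,
  and equality in \<open>L\<^sup>2\<close> is expressed through the norm or the Fourier coefficients.\<close>

definition periodic :: "('d::finite \<Rightarrow> real^'d) \<Rightarrow> 'd cfun \<Rightarrow> bool" where
  "periodic a f \<longleftrightarrow> (\<forall>R \<in> zspan a. AE x in lebesgue. f (x + R) = f x)"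

definition L2per :: "('d::finite \<Rightarrow> real^'d) \<Rightarrow> 'd cfun set" where
  "L2per a = {f. f \<in> borel_measurable lebesgue \<and> periodic a f \<and>
     (\<forall>K. compact K \<longrightarrow> set_integrable lebesgue K (\<lambda>x. (norm (f x))\<^sup>2))}"

definition Linfper :: "('d::finite \<Rightarrow> real^'d) \<Rightarrow> 'd cfun set" where
  "Linfper a = {f. f \<in> borel_measurable lebesgue \<and> periodic a f \<and>
     (\<exists>B. AE x in lebesgue. norm (f x) \<le> B)}"

definition ip :: "('d::finite \<Rightarrow> real^'d) \<Rightarrow> 'd cfun \<Rightarrow> 'd cfun \<Rightarrow> complex" where
  "ip a f g = (LINT x:wigner_seitz a|lebesgue. cnj (f x) * g x)"

definition L2norm :: "('d::finite \<Rightarrow> real^'d) \<Rightarrow> 'd cfun \<Rightarrow> real" where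
  "L2norm a f = sqrt (LINT x:wigner_seitz a|lebesgue. (norm (f x))\<^sup>2)"

definition pw :: "('d::finite \<Rightarrow> real^'d) \<Rightarrow> real^'d \<Rightarrow> 'd cfun" where
  "pw a G = (\<lambda>x. of_real (1 / sqrt (measure lebesgue (wigner_seitz a))) * exp (\<i> * of_real (G \<bullet> x)))"

definition fourier :: "('d::finite \<Rightarrow> real^'d) \<Rightarrow> 'd cfun \<Rightarrow> real^'d \<Rightarrow> complex" where
  "fourier a f G = (LINT x:wigner_seitz a|lebesgue. f x * cnj (pw a G x))"

text \<open>Squared Sobolev norms, with values in \<open>[0,\<infinity>]\<close> and defined for every
  \<open>f \<in> L\<^sup>2\<close>, the value \<open>\<infinity>\<close> meaning that \<open>f\<close> does not belong to the space. For negative order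
  this is the dual norm of the functional \<open>g \<mapsto> (g, f)\<close>.\<close>

definition sobolev_sq_pos ::
  "('d::finite \<Rightarrow> real^'d) \<Rightarrow> ('d \<Rightarrow> real^'d) \<Rightarrow> real \<Rightarrow> 'd cfun \<Rightarrow> ennreal" where
  "sobolev_sq_pos a b s f =
     (\<Sum>\<^sub>\<infinity>G\<in>zspan b. ennreal ((1 + (norm G)\<^sup>2) powr s * (norm (fourier a f G))\<^sup>2))"

definition sobolev_sq ::
  "('d::finite \<Rightarrow> real^'d) \<Rightarrow> ('d \<Rightarrow> real^'d) \<Rightarrow> real \<Rightarrow> 'd cfun \<Rightarrow> ennreal" where
  "sobolev_sq a b s f =
     (if s > 0 then sobolev_sq_pos a b s f
      else if s = 0 then ennreal ((L2norm a f)\<^sup>2)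
      else (SUP g \<in> {g \<in> L2per a. sobolev_sq_pos a b (- s) g \<le> 1}. ennreal (norm (ip a g f)))\<^sup>2)"

definition Hper ::
  "('d::finite \<Rightarrow> real^'d) \<Rightarrow> ('d \<Rightarrow> real^'d) \<Rightarrow> real \<Rightarrow> 'd cfun set" where
  "Hper a b s = {f \<in> L2per a. sobolev_sq a b s f < \<infinity>}"


section \<open>The exact fibers\<close>

text \<open>\<open>fiber_op a b V k f g\<close> says that \<open>f\<close> is in the domain of
  \<open>1/2 (-\<i>\<nabla> + k)\<^sup>2 + V\<close> and that this operator maps \<open>f\<close> to \<open>g\<close>; the differential
  operator acts on the Fourier side, multiplying the coefficient of index \<open>G\<close> by
  \<open>|k + G|\<^sup>2\<close>.\<close>

definition fiber_op ::
  "('d::finite \<Rightarrow> real^'d) \<Rightarrow> ('d \<Rightarrow> real^'d) \<Rightarrow> (real^'d \<Rightarrow> real) \<Rightarrow> real^'d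
     \<Rightarrow> 'd cfun \<Rightarrow> 'd cfun \<Rightarrow> bool" where
  "fiber_op a b V k f g \<longleftrightarrow> f \<in> Hper a b 2 \<and> g \<in> L2per a \<and>
     (\<forall>G \<in> zspan b. fourier a g G =
        of_real ((norm (k + G))\<^sup>2 / 2) * fourier a f G + fourier a (\<lambda>x. of_real (V x) * f x) G)"

definition orthonormal_basis ::
  "('d::finite \<Rightarrow> real^'d) \<Rightarrow> (nat \<Rightarrow> 'd cfun) \<Rightarrow> bool" where
  "orthonormal_basis a u \<longleftrightarrow>
     (\<forall>j\<ge>1. u j \<in> L2per a) \<and>
     (\<forall>i\<ge>1. \<forall>j\<ge>1. ip a (u i) (u j) = (if i = j then 1 else 0)) \<and>
     (\<forall>f \<in> L2per a.
        (\<lambda>N. L2norm a (f - (\<Sum>j=1..N. fscale (ip a (u j) f) (u j)))) \<longlonglongrightarrow> 0)"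

definition fiber_eigenbasis ::
  "('d::finite \<Rightarrow> real^'d) \<Rightarrow> ('d \<Rightarrow> real^'d) \<Rightarrow> (real^'d \<Rightarrow> real) \<Rightarrow> real^'d
     \<Rightarrow> (nat \<Rightarrow> real) \<Rightarrow> (nat \<Rightarrow> 'd cfun) \<Rightarrow> bool" where
  "fiber_eigenbasis a b V k eps u \<longleftrightarrow>
     mono_on {1..} eps \<and> orthonormal_basis a u \<and>
     (\<forall>j\<ge>1. fiber_op a b V k (u j) (fscale (of_real (eps j)) (u j)))"


section \<open>Blow-up functions\<close>

text \<open>\<open>D j\<close> is the \<open>j\<close>-th derivative of \<open>h\<close> on \<open>S\<close>, one-sided at
  points of \<open>S\<close> that are end points.\<close>

definition Cm_with_derivs ::
  "nat \<Rightarrow> real set \<Rightarrow> (real \<Rightarrow> real) \<Rightarrow> (nat \<Rightarrow> real \<Rightarrow> real) \<Rightarrow> bool" where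
  "Cm_with_derivs m S h D \<longleftrightarrow>
     (\<forall>x\<in>S. D 0 x = h x) \<and>
     (\<forall>j<m. \<forall>x\<in>S. (D j has_real_derivative D (Suc j) x) (at x within S)) \<and>
     continuous_on S (D m)"

text \<open>The regularity of \<open>h\<close> is required up to and including \<open>1/2\<close>, which together with the
  matching of the one-sided derivatives is what makes the glued function
  \<open>\<C>\<^sup>m\<close> on \<open>[0,1)\<close>.\<close>

definition blow_up_function :: "nat \<Rightarrow> (real \<Rightarrow> real) \<Rightarrow> bool" where
  "blow_up_function m g \<longleftrightarrow> (\<exists>h D.
     (\<forall>x. \<bar>x\<bar> \<in> {0..1/2} \<union> {1..} \<longrightarrow> g x = x\<^sup>2) \<and>
     (\<forall>x. \<bar>x\<bar> \<in> {1/2<..<1} \<longrightarrow> g x = h \<bar>x\<bar>) \<and>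
     Cm_with_derivs m {1/2..<1} h D \<and>
     filterlim (\<lambda>x. (1 - x) ^ m * h x) at_top (at_left 1) \<and>
     (\<forall>x\<in>{1/2<..<1}. h x \<ge> x\<^sup>2) \<and>
     (\<forall>j\<le>m. D j (1/2) = (deriv ^^ j) (\<lambda>x. x\<^sup>2) (1/2)))"


section \<open>The modified discretization\<close>

definition cutoff :: "('d::finite \<Rightarrow> real^'d) \<Rightarrow> real \<Rightarrow> real^'d \<Rightarrow> (real^'d) set" where
  "cutoff b Ec k = {G \<in> zspan b. (norm (k + G))\<^sup>2 / 2 < Ec}"

definition Xspace ::
  "('d::finite \<Rightarrow> real^'d) \<Rightarrow> ('d \<Rightarrow> real^'d) \<Rightarrow> real \<Rightarrow> real^'d \<Rightarrow> 'd cfun set" where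
  "Xspace a b Ec k = cspan (pw a ` cutoff b Ec k)"

definition Mdim ::
  "('d::finite \<Rightarrow> real^'d) \<Rightarrow> ('d \<Rightarrow> real^'d) \<Rightarrow> real \<Rightarrow> real^'d \<Rightarrow> nat" where
  "Mdim a b Ec k = cdim (Xspace a b Ec k)"

definition Xproj ::
  "('d::finite \<Rightarrow> real^'d) \<Rightarrow> ('d \<Rightarrow> real^'d) \<Rightarrow> real \<Rightarrow> real^'d \<Rightarrow> 'd cfun \<Rightarrow> 'd cfun" where
  "Xproj a b Ec k f =
     (THE p. p \<in> Xspace a b Ec k \<and> (\<forall>q \<in> Xspace a b Ec k. ip a q (f - p) = 0))"

definition modified_op ::
  "('d::finite \<Rightarrow> real^'d) \<Rightarrow> ('d \<Rightarrow> real^'d) \<Rightarrow> (real^'d \<Rightarrow> real) \<Rightarrow> (real \<Rightarrow> real)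
     \<Rightarrow> real \<Rightarrow> real^'d \<Rightarrow> 'd cfun \<Rightarrow> 'd cfun" where
  "modified_op a b V g Ec k \<Phi> =
     (\<Sum>G\<in>cutoff b Ec k.
        fscale (of_real (Ec * g (norm (k + G) / sqrt (2 * Ec))) * fourier a \<Phi> G) (pw a G))
     + Xproj a b Ec k (\<lambda>x. of_real (V x) * \<Phi> x)"

text \<open>\<open>e 1 \<le> \<dots> \<le> e M\<close>, with \<open>M\<close> the dimension of the discretization space, are the
  eigenvalues counted with multiplicity: every \<open>\<mu>\<close> occurs as often as the dimension of its
  eigenspace.\<close>

definition modified_eigenvalues ::
  "('d::finite \<Rightarrow> real^'d) \<Rightarrow> ('d \<Rightarrow> real^'d) \<Rightarrow> (real^'d \<Rightarrow> real) \<Rightarrow> (real \<Rightarrow> real)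
     \<Rightarrow> real \<Rightarrow> real^'d \<Rightarrow> (nat \<Rightarrow> real) \<Rightarrow> bool" where
  "modified_eigenvalues a b V g Ec k e \<longleftrightarrow>
     mono_on {1..Mdim a b Ec k} e \<and>
     (\<forall>\<mu>. card {j \<in> {1..Mdim a b Ec k}. e j = \<mu>} =
        cdim {\<Phi> \<in> Xspace a b Ec k. modified_op a b V g Ec k \<Phi> = fscale (of_real \<mu>) \<Phi>})"

end

theory Submission
  imports Defs
begin

text \<open>
  The modified kinetic energy is nowhere smaller than the exact one, so
  the modified eigenvalues are those of a Galerkin approximation of a larger quadratic form and
  lie above the exact ones (\<open>modified_eigenvalue_lower\<close>).

  For the upper bound one needs test functions whose modified energy is under control although
  \<open>g\<close> may blow up arbitrarily fast. Both kinetic energies agree on the plane waves of kinetic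
  energy at most \<open>Ec / 4\<close>. Let \<open>P\<close> be the orthogonal projection onto these, \<open>Q = 1 - P\<close>, and let \<open>Y\<close> be
  the span of the first \<open>n\<close> exact eigenfunctions; the test space is \<open>P Y\<close>. For \<open>\<Phi>\<close> in \<open>Y\<close> the energy of
  \<open>P \<Phi>\<close> exceeds \<open>eps n\<close> times its squared norm only by terms quadratic in \<open>Q\<close>: the linear term is
  \<open>(Q \<Phi>, H \<Phi>) = (Q \<Phi>, Q H \<Phi>)\<close>, and \<open>H \<Phi>\<close> belongs to \<open>Y\<close> again (\<open>low_energy_difference\<close>). Hence the error is
  at most a constant times the largest kinetic energy that a normalised element of \<open>Y\<close> has at
  frequencies above \<open>Ec / 4\<close> (\<open>modified_eigenvalue_upper\<close>), and this is at most a constant times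
  \<open>Ec powr (- r - 1)\<close> times the largest squared norm of order \<open>r + 2\<close> (\<open>sobolev_tail_bound\<close>). For large \<open>Ec\<close>
  the constant is smaller than \<open>Ec powr (d / 4)\<close>, which is the room left by the exponent
  \<open>r + 1 - d / 4\<close>. If the largest norm is infinite, the inequality is trivial.

  All constants must be uniform in \<open>k\<close>. The first \<open>n\<close> eigenvalues are bounded
  independently of \<open>k\<close>, since every ball of
  a certain radius contains \<open>n\<close> points of the reciprocal lattice (\<open>plane_waves_near\<close>). The Sobolev
  weights are centred at the origin whereas the kinetic energy is centred at \<open>- k\<close>; but elements of \<open>Y\<close>
  have bounded kinetic energy, so most of their mass is close to \<open>- k\<close> and their Sobolev norm already
  dominates the power of the norm of \<open>k\<close> that a change of the centre costs.

  These arguments take place on Fourier coefficients and rest on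
  Parseval's identity for the Wigner-Seitz cell (\<open>parseval_ip\<close>). Plane waves are orthonormal because
  the translates of the cell tile the space (\<open>integral_translated_cell\<close>). They are complete because
  the map to the torus is injective on the cell, which reduces the approximation of indicator
  functions to the Stone-Weierstrass theorem (\<open>trig_polys_dense\<close>).
\<close>

section \<open>Square-integrable functions on the cell\<close>

abbreviation cell_measure :: "('d::finite \<Rightarrow> real^'d) \<Rightarrow> (real^'d) measure" where
  "cell_measure a \<equiv> lebesgue_on (wigner_seitz a)"

text \<open>Only the values on the cell enter the inner product, so the geometry of the Hilbert
  space is developed for functions that are square integrable there, and periodicity need not be
  carried along.\<close>

definition L2cell :: "('d::finite \<Rightarrow> real^'d) \<Rightarrow> 'd cfun set" where
  "L2cell a = {f \<in> borel_measurable (cell_measure a).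
     integrable (cell_measure a) (\<lambda>x. (norm (f x))\<^sup>2)}"

lemma fscale_apply [simp]: "fscale c f x = c * f x"
  by (simp add: fscale_def)

lemma sum_cfun_apply [simp]: "(\<Sum>i\<in>A. (f i :: 'd::finite cfun)) x = (\<Sum>i\<in>A. f i x)"
  by (induction A rule: infinite_finite_induct) auto

lemma countable_zspan: "countable (zspan (a :: 'd::finite \<Rightarrow> real^'d))"
  unfolding zspan_def by (intro countable_image countableI_type)

lemma wigner_seitz_borel [measurable]: "wigner_seitz a \<in> sets borel"
proof -
  have "wigner_seitz a = (\<Inter>R\<in>insert 0 (zspan a). {x. R = 0 \<or> dist x 0 < dist x R})"
    by (auto simp: wigner_seitz_def)
  also have "\<dots> \<in> sets borel"
    by (intro sets.countable_INT' countable_insert countable_zspan) auto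
  finally show ?thesis .
qed

lemma wigner_seitz_lebesgue [measurable]: "wigner_seitz a \<in> sets lebesgue"
  by (metis wigner_seitz_borel sets_completionI_sets sets_lborel)

lemma ip_eq: "ip a f g = (LINT x|cell_measure a. cnj (f x) * g x)"
  unfolding ip_def set_lebesgue_integral_def
  by (subst integral_restrict_space) (auto)

lemma L2norm_sq: "(L2norm a f)\<^sup>2 = (LINT x|cell_measure a. (norm (f x))\<^sup>2)"
proof -
  have "(LINT x:wigner_seitz a|lebesgue. (norm (f x))\<^sup>2) = (LINT x|cell_measure a. (norm (f x))\<^sup>2)"
    unfolding set_lebesgue_integral_def by (subst integral_restrict_space) auto
  then show ?thesis unfolding L2norm_def by simp
qed

lemma L2norm_nonneg [simp]: "0 \<le> L2norm a f"
  unfolding L2norm_def set_lebesgue_integral_def by (simp add: integral_nonneg_AE)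

lemma ip_self: "ip a f f = of_real ((L2norm a f)\<^sup>2)"
proof -
  have "cnj (f x) * f x = of_real ((norm (f x))\<^sup>2)" for x
    by (metis complex_norm_square mult.commute)
  then show ?thesis unfolding ip_eq L2norm_sq by (simp only: integral_complex_of_real)
qed

lemma ip_commute: "ip a f g = cnj (ip a g f)"
  unfolding ip_eq by (simp add: Bochner_Integration.integral_cnj[symmetric] mult.commute)

lemma ip_scale_right [simp]: "ip a f (fscale c g) = c * ip a f g"
  unfolding ip_eq by (simp add: mult.left_commute)

lemma ip_scale_left [simp]: "ip a (fscale c f) g = cnj c * ip a f g"
  by (simp add: ip_commute[of a _ g])

lemma ip_zero_right [simp]: "ip a f 0 = 0"
  unfolding ip_eq by simp

lemma ip_zero_left [simp]: "ip a 0 f = 0"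
  unfolding ip_eq by simp

lemma borel_measurable_cnj [measurable]: "cnj \<in> borel_measurable borel"
  by (intro borel_measurable_continuous_onI continuous_intros)

lemma integrable_cnj_mult:
  assumes "f \<in> L2cell a" "g \<in> L2cell a"
  shows "integrable (cell_measure a) (\<lambda>x. cnj (f x) * g x)"
proof (rule Bochner_Integration.integrable_bound)
  show "integrable (cell_measure a) (\<lambda>x. (norm (f x))\<^sup>2 + (norm (g x))\<^sup>2)"
    using assms by (auto simp: L2cell_def)
  show "(\<lambda>x. cnj (f x) * g x) \<in> borel_measurable (cell_measure a)"
  proof -
    have [measurable]: "f \<in> borel_measurable (cell_measure a)"
      "g \<in> borel_measurable (cell_measure a)"
      using assms by (auto simp: L2cell_def)
    show ?thesis by measurable
  qed
  have "norm (cnj (f x) * g x) \<le> norm ((norm (f x))\<^sup>2 + (norm (g x))\<^sup>2)" for x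
  proof -
    have "0 \<le> norm (f x) * norm (g x)" by simp
    then have "norm (f x) * norm (g x) \<le> (norm (f x))\<^sup>2 + (norm (g x))\<^sup>2"
      using sum_squares_bound[of "norm (f x)" "norm (g x)"] by linarith
    then show ?thesis by (simp add: norm_mult)
  qed
  then show "AE x in cell_measure a. norm (cnj (f x) * g x) \<le> norm ((norm (f x))\<^sup>2 + (norm (g x))\<^sup>2)"
    by simp
qed

lemma L2cell_scale [intro]: "f \<in> L2cell a \<Longrightarrow> fscale c f \<in> L2cell a"
  unfolding L2cell_def by (auto simp: fscale_def norm_mult power_mult_distrib)

lemma L2cell_zero [simp, intro]: "0 \<in> L2cell a"
  unfolding L2cell_def by (auto simp: zero_fun_def)

lemma norm_add_power2_le:
  fixes x y :: "'a::real_normed_vector"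
  shows "(norm (x + y))\<^sup>2 \<le> 2 * (norm x)\<^sup>2 + 2 * (norm y)\<^sup>2"
proof -
  have "(norm (x + y))\<^sup>2 \<le> (norm x + norm y)\<^sup>2"
    by (intro power_mono norm_triangle_ineq) simp
  also have "\<dots> \<le> 2 * (norm x)\<^sup>2 + 2 * (norm y)\<^sup>2"
    using sum_squares_bound[of "norm x" "norm y"] by (simp add: power2_sum)
  finally show ?thesis .
qed

lemma L2cell_add [intro]:
  assumes "f \<in> L2cell a" "g \<in> L2cell a"
  shows "f + g \<in> L2cell a"
proof -
  let ?M = "cell_measure a"
  have [measurable]: "f \<in> borel_measurable ?M" "g \<in> borel_measurable ?M"
    using assms by (auto simp: L2cell_def)
  have "integrable ?M (\<lambda>x. (norm (f x + g x))\<^sup>2)"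
  proof (rule Bochner_Integration.integrable_bound)
    show "integrable ?M (\<lambda>x. 2 * ((norm (f x))\<^sup>2 + (norm (g x))\<^sup>2))"
      using assms by (auto simp: L2cell_def)
    have "(norm (f x + g x))\<^sup>2 \<le> 2 * ((norm (f x))\<^sup>2 + (norm (g x))\<^sup>2)" for x
      using norm_add_power2_le[of "f x" "g x"] by simp
    then show "AE x in ?M. norm ((norm (f x + g x))\<^sup>2) \<le> norm (2 * ((norm (f x))\<^sup>2 + (norm (g x))\<^sup>2))"
      by simp
  qed (measurable)
  then show ?thesis unfolding L2cell_def by (auto simp: plus_fun_def)
qed

lemma L2cell_sum [intro]: "(\<And>i. i \<in> A \<Longrightarrow> f i \<in> L2cell a) \<Longrightarrow> (\<Sum>i\<in>A. f i) \<in> L2cell a"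
  by (induction A rule: infinite_finite_induct) auto

lemma cfun_diff_conv: "f - g = f + fscale (-1) g"
  by (auto simp: fun_eq_iff)

lemma L2cell_diff [intro]: "f \<in> L2cell a \<Longrightarrow> g \<in> L2cell a \<Longrightarrow> f - g \<in> L2cell a"
  unfolding cfun_diff_conv by (intro L2cell_add L2cell_scale)

lemma ip_add_right:
  assumes "f \<in> L2cell a" "g \<in> L2cell a" "h \<in> L2cell a"
  shows "ip a f (g + h) = ip a f g + ip a f h"
  unfolding ip_eq using assms by (simp add: distrib_left integrable_cnj_mult)

lemma ip_add_left:
  assumes "f \<in> L2cell a" "g \<in> L2cell a" "h \<in> L2cell a"
  shows "ip a (f + g) h = ip a f h + ip a g h"
  using assms by (simp add: ip_commute[of a _ h] ip_add_right)

lemma ip_diff_right: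
  assumes "f \<in> L2cell a" "g \<in> L2cell a" "h \<in> L2cell a"
  shows "ip a f (g - h) = ip a f g - ip a f h"
  unfolding cfun_diff_conv ip_add_right[OF assms(1,2) L2cell_scale[OF assms(3)]] ip_scale_right by simp

lemma ip_diff_left:
  assumes "f \<in> L2cell a" "g \<in> L2cell a" "h \<in> L2cell a"
  shows "ip a (f - g) h = ip a f h - ip a g h"
  unfolding cfun_diff_conv ip_add_left[OF assms(1) L2cell_scale[OF assms(2)] assms(3)] ip_scale_left by simp

lemma ip_sum_right:
  assumes "f \<in> L2cell a" "\<And>i. i \<in> A \<Longrightarrow> g i \<in> L2cell a"
  shows "ip a f (\<Sum>i\<in>A. g i) = (\<Sum>i\<in>A. ip a f (g i))"
  using assms by (induction A rule: infinite_finite_induct) (auto simp: ip_add_right L2cell_sum)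

lemma ip_sum_left:
  assumes "f \<in> L2cell a" "\<And>i. i \<in> A \<Longrightarrow> g i \<in> L2cell a"
  shows "ip a (\<Sum>i\<in>A. g i) f = (\<Sum>i\<in>A. ip a (g i) f)"
  using assms by (induction A rule: infinite_finite_induct) (auto simp: ip_add_left L2cell_sum)

lemma L2norm_scale: "L2norm a (fscale c f) = norm c * L2norm a f"
proof -
  have "(L2norm a (fscale c f))\<^sup>2 = (norm c * L2norm a f)\<^sup>2"
    unfolding L2norm_sq power_mult_distrib by (simp add: norm_mult power_mult_distrib)
  then show ?thesis by (simp add: power2_eq_iff_nonneg)
qed

text \<open>On functions the norm is only a seminorm. The square of the norm of \<open>g - t z
  f\<close>, with \<open>z\<close> the inner product, is a quadratic polynomial in \<open>t\<close>;
  if \<open>f\<close> has norm zero it is affine, and its positivity for large \<open>t\<close> forces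
  \<open>z = 0\<close>.\<close>

lemma ip_Cauchy_Schwarz:
  assumes "f \<in> L2cell a" "g \<in> L2cell a"
  shows "norm (ip a f g) \<le> L2norm a f * L2norm a g"
proof -
  let ?F = "(L2norm a f)\<^sup>2" and ?G = "(L2norm a g)\<^sup>2" and ?z = "ip a f g"
  have key: "0 \<le> ?G - 2 * t * (norm ?z)\<^sup>2 + t\<^sup>2 * (norm ?z)\<^sup>2 * ?F" for t :: real
  proof -
    let ?h = "g - fscale (of_real t * ?z) f"
    have "ip a ?h ?h = ip a g g - (of_real t * ?z) * ip a g f - cnj (of_real t * ?z) * ip a f g
        + of_real (t\<^sup>2) * (?z * cnj ?z) * ip a f f"
      using assms by (simp add: ip_diff_left ip_diff_right L2cell_scale L2cell_diff algebra_simps power2_eq_square)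
    also have "ip a g f = cnj ?z" by (rule ip_commute)
    also have "ip a g g - (of_real t * ?z) * cnj ?z - cnj (of_real t * ?z) * ?z + of_real (t\<^sup>2) * (?z * cnj ?z) * ip a f f
      = of_real (?G - 2 * t * (norm ?z)\<^sup>2 + t\<^sup>2 * (norm ?z)\<^sup>2 * ?F)"
      by (simp add: ip_self complex_norm_square[symmetric] algebra_simps)
    finally have "(L2norm a ?h)\<^sup>2 = ?G - 2 * t * (norm ?z)\<^sup>2 + t\<^sup>2 * (norm ?z)\<^sup>2 * ?F"
      unfolding ip_self of_real_eq_iff .
    then show ?thesis by (metis zero_le_power2)
  qed
  have "(norm ?z)\<^sup>2 \<le> (L2norm a f * L2norm a g)\<^sup>2"
  proof (cases "?F = 0")
    case True
    then have *: "0 \<le> ?G - 2 * t * (norm ?z)\<^sup>2" for t using key[of t] by simp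
    have "(norm ?z)\<^sup>2 = 0"
    proof (rule ccontr)
      assume "(norm ?z)\<^sup>2 \<noteq> 0"
      then have "0 \<le> ?G - 2 * (?G + 1)"
        using *[of "(?G + 1) / (norm ?z)\<^sup>2"] by simp
      moreover have "0 \<le> ?G" by simp
      ultimately show False by argo
    qed
    then show ?thesis by simp
  next
    case False
    then have F: "?F > 0" by simp
    have "(1 / ?F)\<^sup>2 * (norm ?z)\<^sup>2 * ?F = (norm ?z)\<^sup>2 / ?F"
      using False by (simp add: field_simps power2_eq_square)
    then have "0 \<le> ?G - (norm ?z)\<^sup>2 / ?F" using key[of "1 / ?F"] by simp
    then show ?thesis using F by (simp add: pos_divide_le_eq power_mult_distrib mult.commute)
  qed
  then show ?thesis by (rule power2_le_imp_le) simp
qed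

lemma L2norm_triangle:
  assumes "f \<in> L2cell a" "g \<in> L2cell a"
  shows "L2norm a (f + g) \<le> L2norm a f + L2norm a g"
proof (rule power2_le_imp_le)
  have "of_real ((L2norm a (f + g))\<^sup>2) = ip a (f + g) (f + g)" by (simp add: ip_self)
  also have "\<dots> = ip a f f + ip a g g + (ip a f g + cnj (ip a f g))"
    using assms by (simp add: ip_add_left ip_add_right L2cell_add ip_commute[of a g f])
  also have "\<dots> = of_real ((L2norm a f)\<^sup>2 + (L2norm a g)\<^sup>2 + 2 * Re (ip a f g))"
    by (simp add: ip_self complex_add_cnj)
  finally have "(L2norm a (f + g))\<^sup>2 = (L2norm a f)\<^sup>2 + (L2norm a g)\<^sup>2 + 2 * Re (ip a f g)"
    unfolding of_real_eq_iff .
  also have "Re (ip a f g) \<le> L2norm a f * L2norm a g"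
    using ip_Cauchy_Schwarz[OF assms] complex_Re_le_cmod order_trans by blast
  finally show "(L2norm a (f + g))\<^sup>2 \<le> (L2norm a f + L2norm a g)\<^sup>2"
    by (simp add: power2_sum)
qed simp

section \<open>Geometry of the lattice and its Wigner-Seitz cell\<close>

lemma lattice_bases_inner:
  "lattice_bases a b \<Longrightarrow> a i \<bullet> b j = (if i = j then 2 * pi else 0)"
  by (simp add: lattice_bases_def)

text \<open>The difference of the two sides is orthogonal to every \<open>a i\<close>, and these
  span the whole space.\<close>

lemma dual_basis_expansion:
  assumes "lattice_bases a b"
  shows "x = (\<Sum>i\<in>UNIV. ((x \<bullet> a i) / (2 * pi)) *\<^sub>R b i)"
proof -
  define y where "y = x - (\<Sum>i\<in>UNIV. ((x \<bullet> a i) / (2 * pi)) *\<^sub>R b i)"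
  have "UNIV \<subseteq> span (range a)"
    using assms by (intro card_ge_dim_independent) (auto simp: lattice_bases_def card_image)
  then have "y \<in> span (range a)" by blast
  moreover have "y \<bullet> a j = 0" for j
  proof -
    have "(\<Sum>i\<in>UNIV. ((x \<bullet> a i) / (2 * pi)) *\<^sub>R b i) \<bullet> a j
        = (\<Sum>i\<in>UNIV. ((x \<bullet> a i) / (2 * pi)) * (a j \<bullet> b i))"
      by (simp add: inner_sum_left inner_commute[of "b _"])
    also have "\<dots> = (\<Sum>i\<in>UNIV. if i = j then x \<bullet> a j else 0)"
      by (intro sum.cong) (auto simp: lattice_bases_inner[OF assms])
    finally show ?thesis unfolding y_def by (simp add: inner_diff_left)
  qed
  then have "\<And>z. z \<in> range a \<Longrightarrow> orthogonal y z" by (auto simp: orthogonal_def)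
  ultimately have "orthogonal y y" by (rule orthogonal_to_span)
  then show ?thesis by (simp add: orthogonal_def y_def)
qed

text \<open>Transfers every fact about the lattice to the reciprocal lattice.\<close>

lemma lattice_bases_dual:
  assumes "lattice_bases a b"
  shows "lattice_bases b a"
proof -
  have "inj b"
  proof (rule injI)
    fix i j assume "b i = b j"
    then have "a i \<bullet> b i = a i \<bullet> b j" by simp
    then show "i = j" using assms by (auto simp: lattice_bases_inner split: if_splits)
  qed
  moreover have "UNIV \<subseteq> span (range b)"
  proof
    fix x
    have "(\<Sum>i\<in>UNIV. ((x \<bullet> a i) / (2 * pi)) *\<^sub>R b i) \<in> span (range b)"
      by (intro span_sum span_scale span_base) auto
    then show "x \<in> span (range b)" using dual_basis_expansion[OF assms, of x] by simp
  qed
  then have "independent (range b)"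
    by (rule card_le_dim_spanning[OF subset_UNIV]) (auto simp: card_image[OF \<open>inj b\<close>])
  ultimately show ?thesis using assms by (auto simp: lattice_bases_def inner_commute)
qed

lemma zspan_iff:
  assumes "lattice_bases a b"
  shows "x \<in> zspan a \<longleftrightarrow> (\<forall>i. (x \<bullet> b i) / (2 * pi) \<in> \<int>)"
proof
  assume "x \<in> zspan a"
  then obtain z :: "_ \<Rightarrow> int" where x: "x = (\<Sum>i\<in>UNIV. of_int (z i) *\<^sub>R a i)"
    by (auto simp: zspan_def)
  have "x \<bullet> b j = (\<Sum>i\<in>UNIV. if i = j then of_int (z j) * (2 * pi) else 0)" for j
    unfolding x inner_sum_left by (intro sum.cong) (auto simp: lattice_bases_inner[OF assms])
  then show "\<forall>i. (x \<bullet> b i) / (2 * pi) \<in> \<int>" by simp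
next
  assume "\<forall>i. (x \<bullet> b i) / (2 * pi) \<in> \<int>"
  then have "\<forall>i. \<exists>z. (x \<bullet> b i) / (2 * pi) = of_int z" by (auto simp: Ints_def)
  then obtain z where "\<And>i. (x \<bullet> b i) / (2 * pi) = of_int (z i)" by metis
  then have "x = (\<Sum>i\<in>UNIV. of_int (z i) *\<^sub>R a i)"
    using dual_basis_expansion[OF lattice_bases_dual[OF assms], of x] by simp
  then show "x \<in> zspan a" by (auto simp: zspan_def)
qed

lemma zspanI: "x = (\<Sum>i\<in>UNIV. of_int (z i) *\<^sub>R a i) \<Longrightarrow> x \<in> zspan a"
  by (auto simp: zspan_def)

lemma zspan_zero [simp]: "0 \<in> zspan a"
proof -
  have "0 = (\<Sum>i\<in>UNIV. of_int ((\<lambda>_. 0 :: int) i) *\<^sub>R a i)" by simp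
  then show ?thesis by (rule zspanI)
qed

lemma zspan_add: "x \<in> zspan a \<Longrightarrow> y \<in> zspan a \<Longrightarrow> x + y \<in> zspan a"
proof -
  assume "x \<in> zspan a" "y \<in> zspan a"
  then obtain z w :: "_ \<Rightarrow> int" where "x = (\<Sum>i\<in>UNIV. of_int (z i) *\<^sub>R a i)"
    "y = (\<Sum>i\<in>UNIV. of_int (w i) *\<^sub>R a i)"
    by (auto simp: zspan_def)
  then have "x + y = (\<Sum>i\<in>UNIV. of_int ((\<lambda>i. z i + w i) i) *\<^sub>R a i)"
    by (simp add: scaleR_add_left sum.distrib)
  then show ?thesis by (rule zspanI)
qed

lemma zspan_uminus: "x \<in> zspan a \<Longrightarrow> - x \<in> zspan a"
proof -
  assume "x \<in> zspan a"
  then obtain z :: "_ \<Rightarrow> int" where "x = (\<Sum>i\<in>UNIV. of_int (z i) *\<^sub>R a i)"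
    by (auto simp: zspan_def)
  then have "- x = (\<Sum>i\<in>UNIV. of_int ((\<lambda>i. - z i) i) *\<^sub>R a i)"
    by (simp add: sum_negf)
  then show ?thesis by (rule zspanI)
qed

lemma zspan_diff: "x \<in> zspan a \<Longrightarrow> y \<in> zspan a \<Longrightarrow> x - y \<in> zspan a"
  using zspan_add[of x a "- y"] zspan_uminus by auto

lemma zspan_base: "a i \<in> zspan a"
proof -
  have "(\<Sum>j\<in>UNIV. of_int (if j = i then 1 else 0 :: int) *\<^sub>R a j) = (\<Sum>j\<in>UNIV. if j = i then a i else 0)"
    by (intro sum.cong) auto
  then have "a i = (\<Sum>j\<in>UNIV. of_int ((\<lambda>j. if j = i then 1 else 0 :: int) j) *\<^sub>R a j)"
    by simp
  then show ?thesis by (rule zspanI)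
qed

lemma zspan_scale_nat: "x \<in> zspan a \<Longrightarrow> of_nat n *\<^sub>R x \<in> zspan a"
  by (induction n) (auto simp: scaleR_add_left intro: zspan_add)

lemma finite_zspan_bounded:
  assumes "lattice_bases a b"
  shows "finite {R \<in> zspan a. norm R \<le> c}"
proof -
  define N where "N = \<lceil>c * (\<Sum>i\<in>UNIV. norm (b i)) / (2 * pi)\<rceil>"
  have "{R \<in> zspan a. norm R \<le> c} \<subseteq>
      (\<lambda>z. \<Sum>i\<in>UNIV. of_int (z i) *\<^sub>R a i) ` (PiE UNIV (\<lambda>_. {- N..N}))"
  proof
    fix R assume R: "R \<in> {R \<in> zspan a. norm R \<le> c}"
    then obtain z :: "_ \<Rightarrow> int" where z: "R = (\<Sum>i\<in>UNIV. of_int (z i) *\<^sub>R a i)"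
      by (auto simp: zspan_def)
    have "z j \<in> {- N..N}" for j
    proof -
      have "R \<bullet> b j = (\<Sum>i\<in>UNIV. if i = j then of_int (z j) * (2 * pi) else 0)"
        unfolding z inner_sum_left by (intro sum.cong) (auto simp: lattice_bases_inner[OF assms])
      then have "\<bar>of_int (z j)\<bar> = \<bar>R \<bullet> b j\<bar> / (2 * pi)" by (simp add: abs_mult)
      also have "\<bar>R \<bullet> b j\<bar> \<le> norm R * norm (b j)" by (rule Cauchy_Schwarz_ineq2)
      also have "\<dots> \<le> c * (\<Sum>i\<in>UNIV. norm (b i))"
        using R order_trans[OF norm_ge_zero, of R c] by (intro mult_mono member_le_sum) auto
      finally have "\<bar>of_int (z j)\<bar> \<le> c * (\<Sum>i\<in>UNIV. norm (b i)) / (2 * pi)"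
        by (simp add: divide_right_mono)
      then have "of_int \<bar>z j\<bar> \<le> (of_int N :: real)"
        unfolding N_def by (simp) linarith
      then have "\<bar>z j\<bar> \<le> N" by (simp only: of_int_le_iff)
      then show ?thesis by auto
    qed
    then show "R \<in> (\<lambda>z. \<Sum>i\<in>UNIV. of_int (z i) *\<^sub>R a i) ` (PiE UNIV (\<lambda>_. {- N..N}))"
      unfolding z by auto
  qed
  then show ?thesis by (rule finite_subset) (intro finite_imageI finite_PiE; simp)
qed

text \<open>Rounding down the coordinates with respect to \<open>a\<close> changes each of them by
  less than one.\<close>

lemma zspan_covering_radius:
  assumes "lattice_bases a b"
  shows "\<exists>R\<in>zspan a. norm (x - R) \<le> (\<Sum>i\<in>UNIV. norm (a i))"
proof -
  let ?c = "\<lambda>i. (x \<bullet> b i) / (2 * pi)"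
  let ?R = "\<Sum>i\<in>UNIV. of_int \<lfloor>?c i\<rfloor> *\<^sub>R a i"
  have "x - ?R = (\<Sum>i\<in>UNIV. ?c i *\<^sub>R a i) - ?R"
    using dual_basis_expansion[OF lattice_bases_dual[OF assms], of x] by simp
  also have "\<dots> = (\<Sum>i\<in>UNIV. frac (?c i) *\<^sub>R a i)"
    by (simp add: sum_subtractf[symmetric] scaleR_diff_left[symmetric] frac_def)
  also have "norm \<dots> \<le> (\<Sum>i\<in>UNIV. norm (frac (?c i) *\<^sub>R a i))" by (rule norm_sum)
  also have "\<dots> \<le> (\<Sum>i\<in>UNIV. norm (a i))"
    by (intro sum_mono) (simp add: frac_ge_0 frac_lt_1 less_imp_le mult_left_le_one_le)
  finally have "norm (x - ?R) \<le> (\<Sum>i\<in>UNIV. norm (a i))" .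
  moreover have "?R \<in> zspan a" by (rule zspanI[OF refl])
  ultimately show ?thesis by blast
qed

lemma zspan_inner_zspan:
  assumes "lattice_bases a b" "R \<in> zspan a" "G \<in> zspan b"
  shows "(G \<bullet> R) / (2 * pi) \<in> \<int>"
proof -
  obtain z :: "_ \<Rightarrow> int" where z: "G = (\<Sum>i\<in>UNIV. of_int (z i) *\<^sub>R b i)"
    using assms(3) by (auto simp: zspan_def)
  have "(G \<bullet> R) / (2 * pi) = (\<Sum>i\<in>UNIV. of_int (z i) * ((R \<bullet> b i) / (2 * pi)))"
    unfolding z by (simp add: inner_sum_left inner_commute[of "b _"] sum_divide_distrib)
  also have "\<dots> \<in> \<int>" using zspan_iff[OF assms(1)] assms(2) by (intro Ints_sum Ints_mult) auto
  finally show ?thesis .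
qed

lemma exp_zspan_inner_zspan:
  assumes "lattice_bases a b" "R \<in> zspan a" "G \<in> zspan b"
  shows "exp (\<i> * complex_of_real (G \<bullet> R)) = 1"
proof -
  obtain n :: int where "G \<bullet> R / (2 * pi) = of_int n"
    using zspan_inner_zspan[OF assms] by (auto simp: Ints_def)
  then have "G \<bullet> R = 2 * of_int n * pi" by (simp add: field_simps)
  then have "\<i> * complex_of_real (G \<bullet> R) = 2 * of_int n * of_real pi * \<i>" by simp
  then have "exp (\<i> * complex_of_real (G \<bullet> R)) = exp (2 * of_int n * of_real pi * \<i>)" by (rule arg_cong)
  also have "\<dots> = 1"
    using exp_eq_1[of "2 * of_int n * of_real pi * \<i>"] by simp
  finally show ?thesis .
qed

text \<open>Otherwise each of the two points would be strictly closer to the origin than the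
  other.\<close>

lemma wigner_seitz_translates_disjoint:
  assumes "x \<in> wigner_seitz a" "y \<in> wigner_seitz a" "x - y \<in> zspan a"
  shows "x = y"
proof (rule ccontr)
  assume "x \<noteq> y"
  then have "x - y \<in> zspan a - {0}" "- (x - y) \<in> zspan a - {0}"
    using assms zspan_uminus[OF assms(3)] by auto
  then have "dist x 0 < dist x (x - y)" "dist y 0 < dist y (- (x - y))"
    using assms unfolding wigner_seitz_def by blast+
  moreover have "dist x (x - y) = norm y" "dist y (- (x - y)) = norm x" by (simp_all add: dist_norm)
  ultimately show False by simp
qed

text \<open>Comparing the distance to the origin with the distances to \<open>a i\<close> and
  \<open>- a i\<close> bounds the inner product with \<open>a i\<close>, that is, the coordinates in
  the dual basis.\<close>

lemma wigner_seitz_bounded: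
  assumes "lattice_bases a b"
  shows "bounded (wigner_seitz a)"
proof -
  have "norm x \<le> (\<Sum>i\<in>UNIV. (norm (a i))\<^sup>2 / 2 / (2 * pi) * norm (b i))"
    if x: "x \<in> wigner_seitz a" for x
  proof -
    have "a i \<noteq> 0" for i using lattice_bases_inner[OF assms, of i i] by auto
    then have "a i \<in> zspan a - {0}" "- a i \<in> zspan a - {0}" for i
      using zspan_uminus[OF zspan_base] by (auto simp: zspan_base)
    then have "norm x < norm (x - a i)" "norm x < norm (x + a i)" for i
      using x by (force simp: wigner_seitz_def dist_norm)+
    then have "x \<bullet> x < (x - a i) \<bullet> (x - a i)" "x \<bullet> x < (x + a i) \<bullet> (x + a i)" for i
      by (auto simp: norm_lt)
    then have ai: "\<bar>x \<bullet> a i\<bar> \<le> (norm (a i))\<^sup>2 / 2" for i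
      unfolding power2_norm_eq_inner
      by (smt (verit) inner_add_left inner_add_right inner_commute inner_diff_left inner_diff_right field_sum_of_halves)
    have "norm x \<le> (\<Sum>i\<in>UNIV. norm (((x \<bullet> a i) / (2 * pi)) *\<^sub>R b i))"
      using dual_basis_expansion[OF assms, of x] norm_sum by metis
    also have "\<dots> \<le> (\<Sum>i\<in>UNIV. (norm (a i))\<^sup>2 / 2 / (2 * pi) * norm (b i))"
    proof (intro sum_mono)
      fix i
      have "\<bar>x \<bullet> a i\<bar> / (2 * pi) \<le> (norm (a i))\<^sup>2 / 2 / (2 * pi)"
        by (intro divide_right_mono ai) simp
      then have "\<bar>x \<bullet> a i\<bar> / (2 * pi) * norm (b i) \<le> (norm (a i))\<^sup>2 / 2 / (2 * pi) * norm (b i)"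
        by (rule mult_right_mono) simp
      then show "norm (((x \<bullet> a i) / (2 * pi)) *\<^sub>R b i) \<le> (norm (a i))\<^sup>2 / 2 / (2 * pi) * norm (b i)"
        by simp
    qed
    finally show ?thesis .
  qed
  then show ?thesis by (auto simp: bounded_iff)
qed

text \<open>As the lattice is locally finite, \<open>x\<close> has a closest lattice point
  \<open>R\<close>. Then \<open>x - R\<close> satisfies the inequalities that define the cell,
  possibly with equality; but equality puts \<open>x\<close> at the same distance from two lattice
  points, hence on one of countably many hyperplanes.\<close>

lemma AE_wigner_seitz_cover:
  assumes "lattice_bases a b"
  shows "AE x in lebesgue. \<exists>R\<in>zspan a. x - R \<in> wigner_seitz a"
proof -
  define H where "H R R' = {x. R' \<bullet> x = R' \<bullet> R' / 2 + R \<bullet> R'}" for R R' :: "real^'a"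
  have "negligible (\<Union>(R, R')\<in>zspan a \<times> (zspan a - {0}). H R R')"
  proof (rule negligible_countable_Union)
    show "countable ((\<lambda>(R, R'). H R R') ` (zspan a \<times> (zspan a - {0})))"
      by (intro countable_image countable_SIGMA countable_Diff countable_zspan)
    fix S assume "S \<in> (\<lambda>(R, R'). H R R') ` (zspan a \<times> (zspan a - {0}))"
    then show "negligible S" unfolding H_def by (auto intro!: negligible_hyperplane)
  qed
  moreover have "\<exists>R\<in>zspan a. x - R \<in> wigner_seitz a"
    if nH: "x \<notin> (\<Union>(R, R')\<in>zspan a \<times> (zspan a - {0}). H R R')" for x
  proof -
    let ?F = "{R \<in> zspan a. norm R \<le> 2 * norm x}"
    have "finite ?F" by (rule finite_zspan_bounded[OF assms])
    moreover have "?F \<noteq> {}" by (auto intro!: exI[of _ 0])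
    ultimately have "Min ((\<lambda>S. norm (x - S)) ` ?F) \<in> (\<lambda>S. norm (x - S)) ` ?F"
      by (intro Min_in) auto
    then obtain R where R: "R \<in> ?F" and "Min ((\<lambda>S. norm (x - S)) ` ?F) = norm (x - R)" by (elim imageE)
    then have min: "norm (x - R) \<le> norm (x - S)" if "S \<in> ?F" for S
      using Min_le[of "(\<lambda>S. norm (x - S)) ` ?F" "norm (x - S)"] \<open>finite ?F\<close> that by simp
    have min': "norm (x - R) \<le> norm (x - S)" if "S \<in> zspan a" for S
    proof (cases "norm S \<le> 2 * norm x")
      case False
      have "norm (x - R) \<le> norm x" using min[of 0] by simp
      also have "\<dots> \<le> norm (x - S)" using False norm_triangle_ineq2[of S x] by (simp add: norm_minus_commute)
      finally show ?thesis .
    qed (use min that in auto)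
    have "dist (x - R) 0 < dist (x - R) R'" if R': "R' \<in> zspan a - {0}" for R'
    proof -
      have "x \<notin> H R R'" using nH R R' by auto
      moreover have "R' \<bullet> x = R' \<bullet> R' / 2 + R \<bullet> R'" if "(x - R) \<bullet> (x - R) = (x - R - R') \<bullet> (x - R - R')"
      proof -
        have "(x - R - R') \<bullet> (x - R - R') = (x - R) \<bullet> (x - R) - 2 * (R' \<bullet> (x - R)) + R' \<bullet> R'"
          by (simp add: inner_diff_left[of "x - R" R'] inner_diff_right[of _ "x - R" R'] inner_commute[of "x - R" R'])
        moreover have "R' \<bullet> (x - R) = R' \<bullet> x - R \<bullet> R'"
          by (simp add: inner_diff_right inner_commute)
        ultimately show ?thesis using that by simp
      qed
      ultimately have "norm (x - R) \<noteq> norm (x - R - R')"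
        by (auto simp: H_def norm_eq)
      moreover have "norm (x - R) \<le> norm (x - R - R')"
        using min'[of "R + R'"] R R' by (simp add: zspan_add diff_diff_add)
      ultimately show ?thesis by (simp add: dist_norm)
    qed
    then show ?thesis using R by (auto simp: wigner_seitz_def)
  qed
  ultimately show ?thesis
    unfolding negligible_iff_null_sets by (elim AE_I') blast
qed

lemma wigner_seitz_lmeasurable:
  assumes "lattice_bases a b"
  shows "wigner_seitz a \<in> lmeasurable"
  using wigner_seitz_bounded[OF assms] wigner_seitz_lebesgue by (rule bounded_set_imp_lmeasurable)

text \<open>Countably many translates of the cell cover almost all of the space.\<close>

lemma measure_wigner_seitz_pos:
  assumes "lattice_bases a b"
  shows "measure lebesgue (wigner_seitz a) > 0"
proof (rule ccontr)
  assume "\<not> ?thesis"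
  then have "measure lebesgue (wigner_seitz a) = 0" by (simp add: order.antisym not_less)
  then have "negligible (wigner_seitz a)"
    using wigner_seitz_lmeasurable[OF assms] by (simp add: negligible_iff_measure)
  then have "negligible (\<Union>R\<in>zspan a. (+) R ` wigner_seitz a)"
    by (intro negligible_countable_Union countable_image countable_zspan) (auto intro: negligible_translation)
  moreover have "negligible (- (\<Union>R\<in>zspan a. (+) R ` wigner_seitz a))"
  proof -
    have "{x. \<not> (\<exists>R\<in>zspan a. x - R \<in> wigner_seitz a)} \<in> null_sets lebesgue"
      using AE_wigner_seitz_cover[OF assms] by (simp add: AE_iff_null_sets completion.AE_iff_null_sets)
    moreover have "- (\<Union>R\<in>zspan a. (+) R ` wigner_seitz a) \<subseteq> {x. \<not> (\<exists>R\<in>zspan a. x - R \<in> wigner_seitz a)}"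
      by (auto simp: image_iff) (metis add.commute diff_add_cancel)
    ultimately show ?thesis by (meson negligible_iff_null_sets negligible_subset)
  qed
  ultimately have "negligible (UNIV :: (real^'a) set)"
    by (metis Compl_partition negligible_Un)
  then show False using open_not_negligible[of "UNIV :: (real^'a) set"] by simp
qed

section \<open>Plane waves\<close>

lemma lborel_integral_translate:
  fixes f :: "'a::euclidean_space \<Rightarrow> 'b::{banach, second_countable_topology}"
  assumes "f \<in> borel_measurable borel"
  shows "(LINT x|lborel. f (x + c)) = (LINT x|lborel. f x)"
proof -
  have "(LINT x|lborel. f x) = (LINT x|distr lborel borel ((+) c). f x)"
    by (simp add: lborel_distr_plus)
  also have "\<dots> = (LINT x|lborel. f (c + x))"
    using assms by (intro integral_distr) auto
  finally show ?thesis by (simp add: add.commute)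
qed

text \<open>A periodic function has the same integral over the cell and over its translate by
  \<open>t\<close>. Both tile the space up to null sets: inserting the partition of unity by the
  lattice translates of the first and shifting each term by its lattice vector turns it into the one
  of the second. The cell being bounded, only finitely many lattice vectors contribute, so that no
  infinite sum has to be exchanged with the integral.\<close>

lemma integral_translated_cell:
  fixes f :: "real^'d::finite \<Rightarrow> complex"
  assumes bases: "lattice_bases a b"
    and f [measurable]: "f \<in> borel_measurable borel"
    and per: "\<And>x R. R \<in> zspan a \<Longrightarrow> f (x + R) = f x"
    and bound: "\<And>x. norm (f x) \<le> C"
  shows "(LINT x|lborel. indicator (wigner_seitz a) x * f (x + t))
       = (LINT x|lborel. indicator (wigner_seitz a) x * f x)"
proof -
  let ?W = "wigner_seitz a"
  define I where "I x = (indicator ?W x :: complex)" for x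
  have [measurable]: "I \<in> borel_measurable borel" unfolding I_def by simp
  obtain \<rho> where \<rho>: "\<And>x. x \<in> ?W \<Longrightarrow> norm x \<le> \<rho>"
    using wigner_seitz_bounded[OF bases] by (auto simp: bounded_iff)
  \<comment> \<open>They include all lattice vectors \<open>R\<close> with \<open>x - R\<close> in the cell for some \<open>x\<close> in one of the two
    translates of the cell, by \<open>t\<close> and by \<open>- t\<close>, that occur below.\<close>
  define S where "S = {R \<in> zspan a. norm R \<le> 2 * \<rho> + norm t}"
  have S: "finite S" unfolding S_def by (rule finite_zspan_bounded[OF bases])
  have S_minus: "(\<Sum>R\<in>S. h (- R)) = (\<Sum>R\<in>S. h R)" for h :: "_ \<Rightarrow> complex"
    by (rule sum.reindex_bij_witness[of _ uminus uminus]) (auto simp: S_def zspan_uminus)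
  have cover: "AE x in lborel. \<forall>y. norm (x + y) \<le> \<rho> \<longrightarrow> norm y \<le> norm t \<longrightarrow> (\<Sum>R\<in>S. I (x - R)) = 1"
  proof -
    have "AE x in lborel. \<exists>R\<in>zspan a. x - R \<in> ?W"
      using AE_wigner_seitz_cover[OF bases] by (simp add: AE_completion_iff)
    then show ?thesis
    proof eventually_elim
      case (elim x)
      then obtain R where R: "R \<in> zspan a" "x - R \<in> ?W" by blast
      show ?case
      proof (intro allI impI)
        fix y assume "norm (x + y) \<le> \<rho>" "norm y \<le> norm t"
        moreover have "norm R \<le> norm (x - R) + norm (x + y) + norm y"
          using norm_triangle_ineq4[of "x + y - y" "x - R"] norm_triangle_ineq4[of "x + y" y] by simp
        ultimately have "R \<in> S" using R \<rho>[of "x - R"] by (simp add: S_def)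
        have "I (x - R') = (if R' = R then 1 else 0)" if "R' \<in> S" for R'
        proof (cases "x - R' \<in> ?W")
          case True
          have "x - R' - (x - R) \<in> zspan a"
            using R that zspan_diff[of R a R'] by (simp add: S_def)
          then have "x - R' = x - R"
            by (rule wigner_seitz_translates_disjoint[OF True R(2)])
          then show ?thesis using True by (simp add: I_def)
        next
          case False
          then show ?thesis using R by (auto simp: I_def)
        qed
        then have "(\<Sum>R'\<in>S. I (x - R')) = (\<Sum>R'\<in>S. if R' = R then 1 else 0)" by (intro sum.cong) auto
        then show "(\<Sum>R\<in>S. I (x - R)) = 1" using \<open>R \<in> S\<close> S by simp
      qed
    qed
  qed
  have I_le: "norm (I x) \<le> 1" for x by (simp add: I_def indicator_def)
  have I_int: "integrable lborel (\<lambda>x. I (x + s))" for s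
  proof -
    have "integrable lborel I"
    proof -
      have "emeasure lborel ?W < \<infinity>"
        using wigner_seitz_bounded[OF bases] by (rule emeasure_bounded_finite)
      then have "integrable lborel (indicat_real ?W)" by (intro integrable_real_indicator) auto
      then have "integrable lborel (\<lambda>x. complex_of_real (indicat_real ?W x))" by (rule integrable_of_real)
      moreover have "I = (\<lambda>x. complex_of_real (indicat_real ?W x))" by (auto simp: I_def indicator_def)
      ultimately show ?thesis by simp
    qed
    then have "integrable (distr lborel borel ((+) s)) I" by (simp add: lborel_distr_plus)
    then show ?thesis by (subst (asm) integrable_distr_eq) (auto simp: add.commute)
  qed
  have int: "integrable lborel (\<lambda>x. I (x + s) * (I (x + r) * f (x + q)))" for s r q
  proof (rule Bochner_Integration.integrable_bound)
    show "integrable lborel (\<lambda>x. C * norm (I (x + s)))" using I_int by auto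
    have "norm (I (x + s) * (I (x + r) * f (x + q))) \<le> norm (I (x + s)) * (1 * C)" for x
      unfolding norm_mult by (intro mult_mono I_le bound order_refl) (auto intro: order_trans[OF norm_ge_zero bound])
    then show "AE x in lborel. norm (I (x + s) * (I (x + r) * f (x + q))) \<le> norm (C * norm (I (x + s)))"
      using order_trans[OF norm_ge_zero bound] by (simp add: mult.commute)
  qed measurable
  have "(LINT x|lborel. I (x + t) * f (x + t)) = (LINT x|lborel. (\<Sum>R\<in>S. I (x - R)) * (I (x + t) * f (x + t)))"
  proof (rule integral_cong_AE)
    show "AE x in lborel. I (x + t) * f (x + t) = (\<Sum>R\<in>S. I (x - R)) * (I (x + t) * f (x + t))"
      using cover
    proof eventually_elim
      case (elim x)
      then show ?case
        using \<rho>[of "x + t"] by (cases "x + t \<in> ?W") (auto simp: I_def)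
    qed
  qed measurable
  also have "(\<lambda>x. (\<Sum>R\<in>S. I (x - R)) * (I (x + t) * f (x + t))) = (\<lambda>x. \<Sum>R\<in>S. I (x + - R) * (I (x + t) * f (x + t)))"
    by (simp add: sum_distrib_right)
  also have "(LINT x|lborel. \<dots> x) = (\<Sum>R\<in>S. LINT x|lborel. I (x + - R) * (I (x + t) * f (x + t)))"
    by (rule Bochner_Integration.integral_sum) (rule int)
  also have "\<dots> = (\<Sum>R\<in>S. LINT x|lborel. I (x - t - R) * (I x * f x))"
  proof (rule sum.cong[OF refl])
    fix R assume "R \<in> S"
    have "(\<lambda>x. I (x - t - R) * (I x * f x)) \<in> borel_measurable borel" by measurable
    from lborel_integral_translate[OF this, of t]
    show "(LINT x|lborel. I (x + - R) * (I (x + t) * f (x + t))) = (LINT x|lborel. I (x - t - R) * (I x * f x))"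
      by simp
  qed
  also have "\<dots> = (\<Sum>R\<in>S. LINT x|lborel. I (x - t) * (I (x + R) * f x))"
  proof (rule sum.cong[OF refl])
    fix R assume R: "R \<in> S"
    have "(\<lambda>x. I (x - t - R) * (I x * f x)) \<in> borel_measurable borel" by measurable
    from lborel_integral_translate[OF this, of R]
    show "(LINT x|lborel. I (x - t - R) * (I x * f x)) = (LINT x|lborel. I (x - t) * (I (x + R) * f x))"
      using per[of R] R by (simp add: S_def algebra_simps)
  qed
  also have "\<dots> = (\<Sum>R\<in>S. LINT x|lborel. I (x - t) * (I (x - R) * f x))"
    using S_minus[of "\<lambda>R. LINT x|lborel. I (x - t) * (I (x + R) * f x)"] by simp
  also have "\<dots> = (LINT x|lborel. (\<Sum>R\<in>S. I (x - t) * (I (x - R) * f x)))"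
    using int[of "- t" "- R" 0 for R] by (intro Bochner_Integration.integral_sum[symmetric]) simp
  also have "\<dots> = (LINT x|lborel. I (x - t) * f x)"
  proof (rule integral_cong_AE)
    show "AE x in lborel. (\<Sum>R\<in>S. I (x - t) * (I (x - R) * f x)) = I (x - t) * f x"
      using cover
    proof eventually_elim
      case (elim x)
      have "(\<Sum>R\<in>S. I (x - t) * (I (x - R) * f x)) = (\<Sum>R\<in>S. I (x - R)) * (I (x - t) * f x)"
        unfolding sum_distrib_right by (intro sum.cong) auto
      then show ?case
        using \<rho>[of "x - t"] elim[rule_format, of "- t"] by (cases "x - t \<in> ?W") (auto simp: I_def)
    qed
  qed measurable
  finally have *: "(LINT x|lborel. I (x + t) * f (x + t)) = (LINT x|lborel. I (x - t) * f x)" .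
  have "(LINT x|lborel. I (x + t) * f (x + t)) = (LINT x|lborel. I x * f x)"
    by (rule lborel_integral_translate[of "\<lambda>x. I x * f x"]) measurable
  moreover have "(\<lambda>x. I (x - t) * f x) \<in> borel_measurable borel" by measurable
  from lborel_integral_translate[OF this, of t]
  have "(LINT x|lborel. I x * f (x + t)) = (LINT x|lborel. I (x - t) * f x)" by simp
  ultimately show ?thesis using * by (simp add: I_def)
qed

lemma pw_continuous: "continuous_on S (pw a G)"
  unfolding pw_def by (intro continuous_intros)

lemma pw_borel [measurable]: "pw a G \<in> borel_measurable borel"
  by (intro borel_measurable_continuous_onI pw_continuous)

lemma pw_norm: "norm (pw a G x) = 1 / sqrt (measure lebesgue (wigner_seitz a))"
  unfolding pw_def by (simp add: norm_mult norm_divide)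

lemma finite_measure_cell:
  assumes "lattice_bases a b"
  shows "finite_measure (cell_measure a)"
  by (rule finite_measure_lebesgue_on[OF wigner_seitz_lmeasurable[OF assms]])

lemma L2cell_bounded:
  assumes "lattice_bases a b" and [measurable]: "f \<in> borel_measurable (cell_measure a)"
    and "\<And>x. x \<in> wigner_seitz a \<Longrightarrow> norm (f x) \<le> C"
  shows "f \<in> L2cell a"
proof -
  interpret finite_measure "cell_measure a" by (rule finite_measure_cell[OF assms(1)])
  have "integrable (cell_measure a) (\<lambda>x. (norm (f x))\<^sup>2)"
  proof (rule integrable_const_bound)
    show "AE x in cell_measure a. norm ((norm (f x))\<^sup>2) \<le> C\<^sup>2"
      using assms(3) by (intro AE_I2) (auto intro!: power_mono)
  qed measurable
  then show ?thesis using assms(2) by (simp add: L2cell_def)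
qed

lemma pw_L2cell:
  assumes "lattice_bases a b"
  shows "pw a G \<in> L2cell a"
proof (rule L2cell_bounded[OF assms, where C = "1 / sqrt (measure lebesgue (wigner_seitz a))"])
  have "pw a G \<in> borel_measurable lebesgue"
    using pw_borel by (intro measurable_completion) simp
  then show "pw a G \<in> borel_measurable (cell_measure a)"
    by (rule measurable_restrict_space1)
qed (simp add: pw_norm)

text \<open>By periodicity, translating the cell by \<open>t\<close> does not change the integral of
  the wave with frequency \<open>D\<close>, but multiplies it by \<open>exp (\<i> D \<bullet>
  t)\<close>. This factor is \<open>-1\<close> for \<open>t = \<pi> D / (D \<bullet>
  D)\<close>.\<close>

lemma ip_pw_pw:
  assumes bases: "lattice_bases a b" and G: "G \<in> zspan b" "G' \<in> zspan b"
  shows "ip a (pw a G) (pw a G') = (if G = G' then 1 else 0)"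
proof -
  let ?W = "wigner_seitz a" and ?v = "measure lebesgue (wigner_seitz a)"
  define D where "D = G' - G"
  define f where "f x = exp (\<i> * complex_of_real (D \<bullet> x))" for x :: "real^'a"
  have f_borel [measurable]: "f \<in> borel_measurable borel"
    unfolding f_def by (intro borel_measurable_continuous_onI continuous_intros)
  have v: "?v > 0" by (rule measure_wigner_seitz_pos[OF bases])
  have "cnj (pw a G x) * pw a G' x = of_real (1 / ?v) * f x" for x
  proof -
    have "complex_of_real (1 / sqrt ?v) * complex_of_real (1 / sqrt ?v) = complex_of_real (1 / ?v)"
      using v by (simp flip: of_real_mult)
    moreover have "exp (- (\<i> * complex_of_real (G \<bullet> x))) * exp (\<i> * complex_of_real (G' \<bullet> x)) = f x"
      unfolding f_def D_def by (simp add: exp_add[symmetric] inner_diff_left algebra_simps)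
    ultimately show ?thesis unfolding pw_def by (simp add: exp_cnj mult_ac)
  qed
  then have "ip a (pw a G) (pw a G') = of_real (1 / ?v) * (LINT x:?W|lebesgue. f x)"
    by (simp add: ip_def)
  also have "(LINT x:?W|lebesgue. f x) = (LINT x|lborel. indicator ?W x * f x)"
    unfolding set_lebesgue_integral_def
    by (subst integral_completion) (auto simp: scaleR_conv_of_real indicator_def intro!: Bochner_Integration.integral_cong)
  also have "\<dots> = (if G = G' then of_real ?v else 0)"
  proof (cases "G = G'")
    case True
    then have "f = (\<lambda>_. 1)" by (simp add: f_def D_def fun_eq_iff)
    moreover have "(LINT x|lborel. (indicator ?W x :: complex)) = of_real (measure lborel ?W)"
    proof -
      have "(LINT x|lborel. (indicator ?W x :: complex)) = (LINT x|lborel. complex_of_real (indicat_real ?W x))"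
        by (intro Bochner_Integration.integral_cong) (auto simp: indicator_def)
      then show ?thesis by simp
    qed
    ultimately show ?thesis using True by (simp add: measure_completion)
  next
    case False
    then have D: "D \<in> zspan b" "D \<noteq> 0" using G by (auto simp: D_def zspan_diff)
    define t where "t = (pi / (D \<bullet> D)) *\<^sub>R D"
    have per: "f (x + R) = f x" if "R \<in> zspan a" for x R
      using exp_zspan_inner_zspan[OF bases that D(1)]
      by (simp add: f_def inner_add_right exp_add distrib_left)
    have f1: "norm (f x) \<le> 1" for x by (simp add: f_def)
    have "(LINT x|lborel. indicator ?W x * f (x + t)) = (LINT x|lborel. indicator ?W x * f x)"
      by (rule integral_translated_cell[OF bases f_borel per f1])
    moreover have "D \<bullet> t = pi" using D by (simp add: t_def)
    then have "f (x + t) = - f x" for x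
      unfolding f_def by (simp add: inner_add_right exp_add distrib_left)
    ultimately have "- (LINT x|lborel. indicator ?W x * f x) = (LINT x|lborel. indicator ?W x * f x)"
      by simp
    then have "(LINT x|lborel. indicator ?W x * f x) = 0"
      by simp
    then show ?thesis using False by simp
  qed
  finally show ?thesis using v by auto
qed

section \<open>Completeness of the plane waves\<close>

lemma L2norm_cong: "(\<And>x. x \<in> wigner_seitz a \<Longrightarrow> f x = g x) \<Longrightarrow> L2norm a f = L2norm a g"
  unfolding L2norm_def set_lebesgue_integral_def
  by (intro arg_cong[where f = sqrt] Bochner_Integration.integral_cong) (auto simp: indicator_def)

definition trig_polys :: "('d::finite \<Rightarrow> real^'d) \<Rightarrow> ('d \<Rightarrow> real^'d) \<Rightarrow> 'd cfun set" where
  "trig_polys a b = cspan (pw a ` zspan b)"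

lemma exp_in_trig_polys:
  assumes "lattice_bases a b" "G \<in> zspan b"
  shows "(\<lambda>x. exp (\<i> * of_real (G \<bullet> x))) \<in> trig_polys a b"
proof -
  have "(\<lambda>x. exp (\<i> * of_real (G \<bullet> x))) = fscale (of_real (sqrt (measure lebesgue (wigner_seitz a)))) (pw a G)"
    using measure_wigner_seitz_pos[OF assms(1)] by (auto simp: fun_eq_iff pw_def simp flip: of_real_mult)
  then show ?thesis
    unfolding trig_polys_def using assms(2) by (simp add: cfun.span_scale cfun.span_base)
qed

lemma trig_polys_const:
  assumes "lattice_bases a b"
  shows "(\<lambda>x. c) \<in> trig_polys a b"
proof -
  have "(\<lambda>x. c) = fscale c (\<lambda>x. exp (\<i> * of_real (0 \<bullet> x)))" by (simp add: fun_eq_iff)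
  then show ?thesis
    using exp_in_trig_polys[OF assms zspan_zero] unfolding trig_polys_def by (metis cfun.span_scale)
qed

lemma pw_mult_pw: "pw a G x * pw a G' x
    = of_real (1 / sqrt (measure lebesgue (wigner_seitz a))) * pw a (G + G') x"
  by (simp add: pw_def inner_add_left distrib_left exp_add)

lemma trig_polys_mult:
  assumes f: "f \<in> trig_polys a b" and g: "g \<in> trig_polys a b"
  shows "(\<lambda>x. f x * g x) \<in> trig_polys a b"
  using f unfolding trig_polys_def
proof (induction rule: cfun.span_induct_alt)
  case base
  have "(\<lambda>x. 0 x * g x) = 0" by (simp add: fun_eq_iff)
  then show ?case by (simp add: cfun.span_zero)
next
  case (step c p f)
  then obtain G where G: "G \<in> zspan b" "p = pw a G" by auto
  have "(\<lambda>x. p x * g x) \<in> cspan (pw a ` zspan b)"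
    using g unfolding trig_polys_def
  proof (induction rule: cfun.span_induct_alt)
    case base
    have "(\<lambda>x. p x * 0 x) = 0" by (simp add: fun_eq_iff)
    then show ?case by (simp add: cfun.span_zero)
  next
    case (step e q h)
    then obtain G' where G': "G' \<in> zspan b" "q = pw a G'" by auto
    have "(\<lambda>x. p x * (fscale e q + h) x)
        = fscale (e * of_real (1 / sqrt (measure lebesgue (wigner_seitz a)))) (pw a (G + G')) + (\<lambda>x. p x * h x)"
      using G G' by (simp add: fun_eq_iff distrib_left pw_mult_pw mult.left_commute[of _ e])
    also have "\<dots> \<in> cspan (pw a ` zspan b)"
      using step G G' by (intro cfun.span_add[OF cfun.span_scale]) (auto intro: cfun.span_base imageI zspan_add)
    finally show ?case .
  qed
  moreover have "(\<lambda>x. (fscale c p + f) x * g x) = fscale c (\<lambda>x. p x * g x) + (\<lambda>x. f x * g x)"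
    by (simp add: fun_eq_iff distrib_right)
  ultimately show ?case using step by (simp add: cfun.span_add cfun.span_scale)
qed

text \<open>The quotient map to the torus, realised inside \<open>\<complex>\<^sup>d\<close>, where
  the Stone-Weierstrass theorem is available for polynomials.\<close>

definition torus_map :: "('d::finite \<Rightarrow> real^'d) \<Rightarrow> real^'d \<Rightarrow> complex^'d" where
  "torus_map b x = (\<chi> j. exp (\<i> * of_real (b j \<bullet> x)))"

lemma torus_map_continuous: "continuous_on S (torus_map b)"
  unfolding torus_map_def by (intro continuous_intros)

text \<open>Injectivity on the cell is all that the approximation needs: a function on the cell
  becomes a function on its image, and no condition at the boundary has to be matched.\<close>

lemma torus_map_inj:
  assumes "lattice_bases a b"
  shows "inj_on (torus_map b) (wigner_seitz a)"
proof (rule inj_onI)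
  fix x y assume x: "x \<in> wigner_seitz a" and y: "y \<in> wigner_seitz a" and eq: "torus_map b x = torus_map b y"
  have "((x - y) \<bullet> b j) / (2 * pi) \<in> \<int>" for j
  proof -
    have "exp (\<i> * of_real (b j \<bullet> x)) = exp (\<i> * of_real (b j \<bullet> y))"
      using eq by (simp add: torus_map_def vec_eq_iff)
    then obtain n :: int where "\<i> * of_real (b j \<bullet> x) = \<i> * of_real (b j \<bullet> y) + (of_int (2 * n) * pi) * \<i>"
      unfolding exp_eq by blast
    then have "\<i> * of_real (b j \<bullet> x) = \<i> * (of_real (b j \<bullet> y + of_int (2 * n) * pi))"
      by (simp add: algebra_simps)
    then have "b j \<bullet> x = b j \<bullet> y + of_int (2 * n) * pi"
      by (metis mult_cancel_left of_real_eq_iff complex_i_not_zero)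
    then have "((x - y) \<bullet> b j) / (2 * pi) = of_int n"
      by (simp add: inner_diff_right inner_commute[of _ "b j"])
    then show ?thesis by simp
  qed
  then have "x - y \<in> zspan a" using zspan_iff[OF assms] by blast
  then show "x = y" by (rule wigner_seitz_translates_disjoint[OF x y])
qed

text \<open>The real coordinates of the torus map are sines and cosines.\<close>

lemma real_linear_torus_map_in_trig_polys:
  assumes bases: "lattice_bases a b" and f: "bounded_linear (f :: complex^'d::finite \<Rightarrow> real)"
  shows "(\<lambda>x. of_real (f (torus_map b x))) \<in> trig_polys a b"
proof -
  let ?e = "\<lambda>G x. exp (\<i> * complex_of_real (G \<bullet> x))"
  interpret bounded_linear f by fact
  have z: "z = (\<Sum>j\<in>UNIV. Re (z $ j) *\<^sub>R axis j 1 + Im (z $ j) *\<^sub>R axis j \<i>)" for z :: "complex^'d"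
  proof -
    have "(\<Sum>j\<in>UNIV. Re (z $ j) *\<^sub>R axis j 1 $ i + Im (z $ j) *\<^sub>R axis j \<i> $ i) = (\<Sum>j\<in>UNIV. if j = i then z $ i else 0)" for i
      by (intro sum.cong refl) (auto simp: axis_def complex_eq_iff)
    then show ?thesis by (simp add: vec_eq_iff)
  qed
  have fz: "f z = (\<Sum>j\<in>UNIV. Re (z $ j) * f (axis j 1) + Im (z $ j) * f (axis j \<i>))" for z
    by (subst z) (simp add: sum add scale)
  have Re: "complex_of_real (Re (?e G x)) = (?e G x + ?e (- G) x) / 2" for G x :: "real^'d"
    by (simp add: complex_eq_iff Re_exp Im_exp)
  have Im: "complex_of_real (Im (?e G x)) = (?e G x - ?e (- G) x) / (2 * \<i>)" for G x :: "real^'d"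
    by (simp add: complex_eq_iff Re_exp Im_exp Re_divide Im_divide)
  have "(\<lambda>x. of_real (f (torus_map b x))) =
     (\<Sum>j\<in>UNIV. fscale (complex_of_real (f (axis j 1)) / 2) (?e (b j) + ?e (- b j))
        + fscale (complex_of_real (f (axis j \<i>)) / (2 * \<i>)) (?e (b j) - ?e (- b j)))"
    unfolding fun_eq_iff fz[of "torus_map b x" for x] sum_cfun_apply of_real_sum
  proof (intro allI sum.cong refl)
    fix x j
    let ?\<alpha> = "complex_of_real (f (axis j 1))" and ?\<beta> = "complex_of_real (f (axis j \<i>))"
    have "complex_of_real (Re (torus_map b x $ j) * f (axis j 1) + Im (torus_map b x $ j) * f (axis j \<i>))
        = (?e (b j) x + ?e (- b j) x) / 2 * ?\<alpha> + (?e (b j) x - ?e (- b j) x) / (2 * \<i>) * ?\<beta>"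
      unfolding torus_map_def vec_lambda_beta by (simp only: of_real_add of_real_mult Re Im)
    also have "\<dots> = ?\<alpha> / 2 * (?e (b j) x + ?e (- b j) x) + ?\<beta> / (2 * \<i>) * (?e (b j) x - ?e (- b j) x)"
      by (simp only: times_divide_eq_left times_divide_eq_right mult.commute)
    finally show "complex_of_real (Re (torus_map b x $ j) * f (axis j 1) + Im (torus_map b x $ j) * f (axis j \<i>))
        = (fscale (?\<alpha> / 2) (?e (b j) + ?e (- b j)) + fscale (?\<beta> / (2 * \<i>)) (?e (b j) - ?e (- b j))) x"
      by (simp only: plus_fun_apply minus_apply fscale_apply)
  qed
  also have "\<dots> \<in> trig_polys a b"
  proof -
    have e: "?e (b j) \<in> cspan (pw a ` zspan b)" "?e (- b j) \<in> cspan (pw a ` zspan b)" for j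
      using exp_in_trig_polys[OF bases] zspan_base zspan_uminus unfolding trig_polys_def by blast+
    show ?thesis unfolding trig_polys_def
      by (intro cfun.span_sum cfun.span_add cfun.span_scale cfun.span_diff e)
  qed
  finally show ?thesis .
qed

lemma real_polynomial_torus_map_in_trig_polys:
  assumes bases: "lattice_bases a b" and "real_polynomial_function (p :: complex^'d::finite \<Rightarrow> real)"
  shows "(\<lambda>x. of_real (p (torus_map b x))) \<in> trig_polys a b"
  using assms(2)
proof induction
  case (linear f)
  then show ?case by (rule real_linear_torus_map_in_trig_polys[OF bases])
next
  case (const c)
  then show ?case by (rule trig_polys_const[OF bases])
next
  case (add f g)
  have "(\<lambda>x. complex_of_real (f (torus_map b x) + g (torus_map b x)))
      = (\<lambda>x. of_real (f (torus_map b x))) + (\<lambda>x. of_real (g (torus_map b x)))"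
    by (simp add: fun_eq_iff)
  then show ?case using add unfolding trig_polys_def by (simp add: cfun.span_add)
next
  case (mult f g)
  then show ?case using trig_polys_mult[of "\<lambda>x. of_real (f (torus_map b x))" a b "\<lambda>x. of_real (g (torus_map b x))"]
    by simp
qed

definition trig_approximable :: "('d::finite \<Rightarrow> real^'d) \<Rightarrow> ('d \<Rightarrow> real^'d) \<Rightarrow> 'd cfun \<Rightarrow> bool" where
  "trig_approximable a b f \<longleftrightarrow> (\<forall>e>0. \<exists>p\<in>trig_polys a b. L2norm a (f - p) < e)"

lemma trig_polys_L2cell:
  assumes "lattice_bases a b" "f \<in> trig_polys a b"
  shows "f \<in> L2cell a"
  using assms(2) unfolding trig_polys_def
proof (induction rule: cfun.span_induct_alt)
  case base
  show ?case by (rule L2cell_zero)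
next
  case (step c x y)
  then have "x \<in> L2cell a" using pw_L2cell[OF assms(1)] by blast
  then show ?case using step by (intro L2cell_add L2cell_scale)
qed

lemma trig_approximable_limit:
  assumes bases: "lattice_bases a b" and f: "f \<in> L2cell a"
    and g: "\<And>e. e > 0 \<Longrightarrow> \<exists>g\<in>L2cell a. trig_approximable a b g \<and> L2norm a (f - g) < e"
  shows "trig_approximable a b f"
  unfolding trig_approximable_def
proof (intro allI impI)
  fix e :: real assume "e > 0"
  then obtain g where g: "g \<in> L2cell a" "trig_approximable a b g" "L2norm a (f - g) < e / 2"
    using g[of "e / 2"] by auto
  then obtain p where p: "p \<in> trig_polys a b" "L2norm a (g - p) < e / 2"
    using \<open>e > 0\<close> unfolding trig_approximable_def by (meson half_gt_zero)
  have "L2norm a (f - p) = L2norm a ((f - g) + (g - p))" by simp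
  also have "\<dots> \<le> L2norm a (f - g) + L2norm a (g - p)"
    using f g p trig_polys_L2cell[OF bases] by (intro L2norm_triangle L2cell_diff) auto
  finally show "\<exists>p\<in>trig_polys a b. L2norm a (f - p) < e" using g p by force
qed

lemma trig_approximable_add:
  assumes bases: "lattice_bases a b" and "f \<in> L2cell a" "g \<in> L2cell a"
    and "trig_approximable a b f" "trig_approximable a b g"
  shows "trig_approximable a b (f + g)"
  unfolding trig_approximable_def
proof (intro allI impI)
  fix e :: real assume "e > 0"
  then obtain p q where p: "p \<in> trig_polys a b" "L2norm a (f - p) < e / 2"
     and q: "q \<in> trig_polys a b" "L2norm a (g - q) < e / 2"
    using assms(4,5) unfolding trig_approximable_def by (meson half_gt_zero)
  have "L2norm a (f + g - (p + q)) = L2norm a ((f - p) + (g - q))" by (simp add: algebra_simps)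
  also have "\<dots> \<le> L2norm a (f - p) + L2norm a (g - q)"
    using assms p q trig_polys_L2cell[OF bases] by (intro L2norm_triangle L2cell_diff) auto
  finally have "L2norm a (f + g - (p + q)) < e" using p q by simp
  moreover have "p + q \<in> trig_polys a b" using p q unfolding trig_polys_def by (simp add: cfun.span_add)
  ultimately show "\<exists>p\<in>trig_polys a b. L2norm a (f + g - p) < e" by blast
qed

lemma trig_approximable_scale:
  assumes "trig_approximable a b f"
  shows "trig_approximable a b (fscale c f)"
  unfolding trig_approximable_def
proof (intro allI impI)
  fix e :: real assume "e > 0"
  then obtain p where p: "p \<in> trig_polys a b" "L2norm a (f - p) < e / (norm c + 1)"
    using assms unfolding trig_approximable_def
    by (metis add_nonneg_pos divide_pos_pos norm_ge_zero zero_less_one)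
  have "L2norm a (fscale c f - fscale c p) = norm c * L2norm a (f - p)"
    by (simp add: cfun.scale_right_diff_distrib[symmetric] L2norm_scale)
  also have "\<dots> \<le> (norm c + 1) * L2norm a (f - p)" by (intro mult_right_mono) auto
  also have "\<dots> < e" using p(2) by (simp add: pos_less_divide_eq add_nonneg_pos mult.commute)
  finally show "\<exists>p\<in>trig_polys a b. L2norm a (fscale c f - p) < e"
    using p(1) unfolding trig_polys_def by (meson cfun.span_scale)
qed

lemma trig_approximable_sum:
  assumes bases: "lattice_bases a b" and "finite A"
    and "\<And>i. i \<in> A \<Longrightarrow> f i \<in> L2cell a \<and> trig_approximable a b (f i)"
  shows "trig_approximable a b (\<Sum>i\<in>A. f i)"
  using assms(2,3)
proof (induction)
  case empty
  have "0 \<in> trig_polys a b" "L2norm a (0 - 0) = 0"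
    by (auto simp: trig_polys_def cfun.span_zero L2norm_def)
  then show ?case unfolding trig_approximable_def sum.empty by metis
next
  case (insert x F)
  then have "trig_approximable a b (f x + (\<Sum>i\<in>F. f i))"
    by (intro trig_approximable_add[OF bases] L2cell_sum) blast+
  then show ?case unfolding sum.insert[OF insert(1,2)] .
qed

lemma indicator_L2cell:
  assumes "lattice_bases a b" "E \<in> sets lebesgue"
  shows "indicator E \<in> L2cell a"
proof (rule L2cell_bounded[OF assms(1)])
  show "indicator E \<in> borel_measurable (cell_measure a)"
    using assms(2) by (intro measurable_restrict_space1 borel_measurable_indicator)
  show "norm (indicator E x :: complex) \<le> 1" for x by (simp add: indicator_def)
qed

text \<open>With \<open>T\<close> the torus map, the continuous functions \<open>max 0 (1 - n dist z
  (T K))\<close> of \<open>z = T x\<close> converge to the indicator function of \<open>K\<close> at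
  every point of the cell, because \<open>T\<close> is injective there and \<open>T K\<close> is
  closed. On the compact image of the closed cell they are uniform limits of polynomials, and a
  polynomial of \<open>T x\<close> is a trigonometric polynomial.\<close>

lemma trig_approximable_compact:
  assumes bases: "lattice_bases a b" and K: "compact K" "K \<subseteq> wigner_seitz a"
  shows "trig_approximable a b (indicator K)"
proof (cases "K = {}")
  case True
  then have "(indicator K :: real^'a \<Rightarrow> complex) = 0" by (simp add: fun_eq_iff)
  then show ?thesis using trig_approximable_sum[OF bases, of "{}"] by simp
next
  case False
  let ?M = "cell_measure a" and ?v = "measure lebesgue (wigner_seitz a)"
  interpret finite_measure ?M by (rule finite_measure_cell[OF bases])
  define T where "T = torus_map b"
  define psi where "psi n z = max 0 (1 - of_nat n * infdist z (T ` K))" for n :: nat and z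
  have psi_cont: "continuous_on S (psi n)" for S n
    unfolding psi_def by (intro continuous_intros)
  have T_cont: "continuous_on S T" for S unfolding T_def by (rule torus_map_continuous)
  define g where "g n = (\<lambda>x. complex_of_real (psi n (T x)))" for n
  have g_cont: "continuous_on UNIV (g n)" for n
    unfolding g_def
    by (intro continuous_intros continuous_on_compose2[OF psi_cont[of UNIV] T_cont[of UNIV]]) auto
  have [measurable]: "g n \<in> borel_measurable ?M" for n
    using borel_measurable_continuous_onI[OF g_cont]
    by (intro measurable_restrict_space1 measurable_completion) simp
  have [measurable]: "(indicator K :: _ \<Rightarrow> complex) \<in> borel_measurable ?M"
    using K(1) by (intro measurable_restrict_space1 borel_measurable_indicator) (auto intro: fmeasurableD[OF lmeasurable_compact])
  have psi01: "0 \<le> psi n z" "psi n z \<le> 1" for n z by (auto simp: psi_def infdist_nonneg)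
  have g_L2: "g n \<in> L2cell a" for n
  proof (rule L2cell_bounded[OF bases, where C = 1])
    show "norm (g n x) \<le> 1" for x using psi01[of n "T x"] by (simp add: g_def)
  qed measurable
  have K_L2: "indicator K \<in> L2cell a"
    using K(1) by (intro indicator_L2cell[OF bases]) (auto intro: fmeasurableD[OF lmeasurable_compact])
  have lim: "(\<lambda>n. g n x) \<longlonglongrightarrow> indicator K x" if x: "x \<in> wigner_seitz a" for x
  proof (cases "x \<in> K")
    case True
    then have "psi n (T x) = 1" for n by (simp add: psi_def)
    then show ?thesis using True by (simp add: g_def)
  next
    case nK: False
    have "T x \<notin> T ` K"
      using torus_map_inj[OF bases] x nK K(2) unfolding T_def inj_on_def by blast
    moreover have "closed (T ` K)" using K(1) T_cont by (intro compact_imp_closed compact_continuous_image)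
    ultimately have d: "infdist (T x) (T ` K) > 0"
      using in_closed_iff_infdist_zero[of "T ` K" "T x"] False infdist_nonneg[of "T x" "T ` K"] by auto
    obtain N :: nat where N: "1 / infdist (T x) (T ` K) < of_nat N" using reals_Archimedean2 by blast
    have "psi n (T x) = 0" if "n \<ge> N" for n
    proof -
      have "1 / infdist (T x) (T ` K) \<le> of_nat n" using N that by (smt (verit) of_nat_le_iff)
      then show ?thesis using d by (simp add: psi_def pos_divide_le_eq)
    qed
    then have "eventually (\<lambda>n. g n x = 0) sequentially"
      unfolding g_def eventually_sequentially by auto
    then show ?thesis using nK by (simp add: tendsto_eventually)
  qed
  have "(\<lambda>n. LINT x|?M. (norm (indicator K x - g n x))\<^sup>2) \<longlonglongrightarrow> (LINT x|?M. 0)"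
  proof (rule integral_dominated_convergence[where w = "\<lambda>_. 4"])
    show "AE x in ?M. (\<lambda>n. (norm (indicator K x - g n x))\<^sup>2) \<longlonglongrightarrow> 0"
    proof (rule AE_I2)
      fix x assume "x \<in> space ?M"
      then have "(\<lambda>n. (norm (indicator K x - g n x))\<^sup>2) \<longlonglongrightarrow> (norm (indicator K x - indicator K x :: complex))\<^sup>2"
        by (intro tendsto_intros lim) simp
      then show "(\<lambda>n. (norm (indicator K x - g n x))\<^sup>2) \<longlonglongrightarrow> 0" by simp
    qed
    show "AE x in ?M. norm ((norm (indicator K x - g n x))\<^sup>2) \<le> 4" for n
    proof (rule AE_I2)
      fix x
      have "norm (indicator K x - g n x) \<le> 1 + 1"
        by (intro order_trans[OF norm_triangle_ineq4] add_mono) (auto simp: g_def psi01 indicator_def)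
      then have "(norm (indicator K x - g n x))\<^sup>2 \<le> 2\<^sup>2" by (intro power_mono) auto
      then show "norm ((norm (indicator K x - g n x))\<^sup>2) \<le> 4" by simp
    qed
  qed auto
  then have lim2: "(\<lambda>n. (L2norm a (indicator K - g n))\<^sup>2) \<longlonglongrightarrow> 0" by (simp add: L2norm_sq)
  show ?thesis
  proof (rule trig_approximable_limit[OF bases K_L2])
    fix e :: real assume e: "e > 0"
    then have "eventually (\<lambda>n. (L2norm a (indicator K - g n))\<^sup>2 < e\<^sup>2) sequentially"
      using order_tendstoD(2)[OF lim2, of "e\<^sup>2"] by simp
    then obtain n where "(L2norm a (indicator K - g n))\<^sup>2 < e\<^sup>2"
      unfolding eventually_sequentially by blast
    then have n: "L2norm a (indicator K - g n) < e" by (rule power2_less_imp_less) (use e in simp)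
    have "trig_approximable a b (g n)"
      unfolding trig_approximable_def
    proof (intro allI impI)
      fix e :: real assume e: "e > 0"
      \<comment> \<open>The summand \<open>1\<close> only keeps the denominator positive; the uniform error \<open>d\<close> turns into
        \<open>d * sqrt ?v\<close> in the norm of \<open>L\<^sup>2\<close>.\<close>
      define d where "d = e / (2 * (sqrt ?v + 1))"
      have d: "d > 0" using e by (simp add: d_def add_nonneg_pos)
      have "bounded (closure (wigner_seitz a))" using wigner_seitz_bounded[OF bases] by (rule bounded_closure)
      then have "compact (T ` closure (wigner_seitz a))"
        by (intro compact_continuous_image T_cont) (simp add: compact_eq_bounded_closed)
      from Stone_Weierstrass_real_polynomial_function[OF this psi_cont d]
      obtain q where q: "real_polynomial_function q"
        and qd: "\<And>z. z \<in> T ` closure (wigner_seitz a) \<Longrightarrow> \<bar>psi n z - q z\<bar> < d" by metis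
      define p where "p = (\<lambda>x. complex_of_real (q (T x)))"
      have p: "p \<in> trig_polys a b"
        unfolding p_def T_def by (rule real_polynomial_torus_map_in_trig_polys[OF bases q])
      have "norm ((g n - p) x) \<le> d" if "x \<in> wigner_seitz a" for x
      proof -
        have "(g n - p) x = complex_of_real (psi n (T x) - q (T x))" by (simp add: g_def p_def)
        then have "norm ((g n - p) x) = \<bar>psi n (T x) - q (T x)\<bar>" by (simp only: norm_of_real)
        then show ?thesis using qd[of "T x"] that closure_subset by fastforce
      qed
      moreover have L2: "g n - p \<in> L2cell a" using g_L2 trig_polys_L2cell[OF bases p] by (intro L2cell_diff)
      ultimately have "(L2norm a (g n - p))\<^sup>2 \<le> (LINT x|?M. d\<^sup>2)"
        unfolding L2norm_sq
        by (intro integral_mono) (auto simp: L2cell_def fun_diff_def intro!: power_mono)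
      also have "\<dots> = (d * sqrt ?v)\<^sup>2" by (simp add: measure_restrict_space power_mult_distrib)
      finally have "L2norm a (g n - p) \<le> d * sqrt ?v" by (rule power2_le_imp_le) (use d in simp)
      also have "\<dots> \<le> d * (sqrt ?v + 1)" using d by (intro mult_left_mono) auto
      also have "\<dots> = e / 2"
      proof -
        have "sqrt ?v + 1 \<noteq> 0" by (smt (verit) real_sqrt_ge_zero measure_nonneg)
        then show ?thesis unfolding d_def by (simp add: divide_simps)
      qed
      also have "\<dots> < e" using e by simp
      finally show "\<exists>p\<in>trig_polys a b. L2norm a (g n - p) < e" using p by blast
    qed
    then show "\<exists>g\<in>L2cell a. trig_approximable a b g \<and> L2norm a (indicator K - g) < e"
      using n g_L2 by blast
  qed
qed

text \<open>Lebesgue measure is inner regular.\<close>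

lemma trig_approximable_indicator:
  assumes bases: "lattice_bases a b" and E: "E \<in> sets lebesgue" "E \<subseteq> wigner_seitz a"
  shows "trig_approximable a b (indicator E)"
proof (rule trig_approximable_limit[OF bases indicator_L2cell[OF bases E(1)]])
  fix e :: real assume e: "e > 0"
  obtain K where K: "closed K" "K \<subseteq> E" "E - K \<in> lmeasurable" "emeasure lebesgue (E - K) < ennreal (e\<^sup>2)"
    using sets_lebesgue_inner_closed[OF E(1), of "e\<^sup>2"] e by auto
  have comp: "compact K"
    using K E bounded_subset[OF wigner_seitz_bounded[OF bases]] by (simp add: compact_eq_bounded_closed)
  have "(L2norm a (indicator E - indicator K))\<^sup>2 = (LINT x:wigner_seitz a|lebesgue. (norm ((indicator E - indicator K) x :: complex))\<^sup>2)"
    unfolding L2norm_def set_lebesgue_integral_def by simp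
  also have "\<dots> = (LINT x|lebesgue. indicator (E - K) x)"
    unfolding set_lebesgue_integral_def using K E
    by (intro Bochner_Integration.integral_cong) (auto simp: indicator_def)
  also have "\<dots> = measure lebesgue (E - K)" using K by simp
  also have "\<dots> < e\<^sup>2"
    using K(3,4) by (simp add: emeasure_eq_measure2 ennreal_less_iff)
  finally have "L2norm a (indicator E - indicator K) < e"
    by (rule power2_less_imp_less) (use e in simp)
  moreover have "trig_approximable a b (indicator K)"
    using comp K E by (intro trig_approximable_compact[OF bases]) auto
  moreover have "indicator K \<in> L2cell a"
    using comp by (intro indicator_L2cell[OF bases]) (auto intro: fmeasurableD[OF lmeasurable_compact])
  ultimately show "\<exists>g\<in>L2cell a. trig_approximable a b g \<and> L2norm a (indicator E - g) < e" by blast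
qed

text \<open>Square-integrable functions are limits of simple functions, by dominated convergence
  with the bound \<open>9 (norm f)\<^sup>2\<close>.\<close>

theorem trig_polys_dense:
  assumes bases: "lattice_bases a b" and f: "f \<in> L2cell a"
  shows "trig_approximable a b f"
proof (rule trig_approximable_limit[OF bases f])
  let ?M = "cell_measure a"
  fix e :: real assume e: "e > 0"
  have [measurable]: "f \<in> borel_measurable ?M" using f by (simp add: L2cell_def)
  obtain s where s: "\<And>i. simple_function ?M (s i)"
      and s_lim: "\<And>x. x \<in> space ?M \<Longrightarrow> (\<lambda>i. s i x) \<longlonglongrightarrow> f x"
      and s_bound: "\<And>i x. x \<in> space ?M \<Longrightarrow> norm (s i x) \<le> 2 * norm (f x)"
    using borel_measurable_implies_sequence_metric[of f ?M 0] by (auto simp: dist_norm) metis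
  have [measurable]: "s i \<in> borel_measurable ?M" for i using s by (rule borel_measurable_simple_function)
  have "(\<lambda>i. LINT x|?M. (norm (f x - s i x))\<^sup>2) \<longlonglongrightarrow> (LINT x|?M. 0)"
  proof (rule integral_dominated_convergence[where w = "\<lambda>x. 9 * (norm (f x))\<^sup>2"])
    show "integrable ?M (\<lambda>x. 9 * (norm (f x))\<^sup>2)" using f by (simp add: L2cell_def)
    show "AE x in ?M. (\<lambda>i. (norm (f x - s i x))\<^sup>2) \<longlonglongrightarrow> 0"
    proof (rule AE_I2)
      fix x assume "x \<in> space ?M"
      then have "(\<lambda>i. (norm (f x - s i x))\<^sup>2) \<longlonglongrightarrow> (norm (f x - f x))\<^sup>2"
        by (intro tendsto_intros s_lim)
      then show "(\<lambda>i. (norm (f x - s i x))\<^sup>2) \<longlonglongrightarrow> 0" by simp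
    qed
    show "AE x in ?M. norm ((norm (f x - s i x))\<^sup>2) \<le> 9 * (norm (f x))\<^sup>2" for i
    proof (rule AE_I2)
      fix x assume "x \<in> space ?M"
      then have "norm (f x - s i x) \<le> 3 * norm (f x)"
        using norm_triangle_ineq4[of "f x" "s i x"] s_bound[of x i] by simp
      then have "(norm (f x - s i x))\<^sup>2 \<le> (3 * norm (f x))\<^sup>2" by (intro power_mono) auto
      then show "norm ((norm (f x - s i x))\<^sup>2) \<le> 9 * (norm (f x))\<^sup>2" by (simp add: power_mult_distrib)
    qed
  qed measurable
  then have "(\<lambda>i. (L2norm a (f - s i))\<^sup>2) \<longlonglongrightarrow> 0" by (simp add: L2norm_sq)
  from order_tendstoD(2)[OF this, of "e\<^sup>2"] e
  obtain i where "(L2norm a (f - s i))\<^sup>2 < e\<^sup>2"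
    by (auto simp: eventually_sequentially)
  then have i: "L2norm a (f - s i) < e" by (rule power2_less_imp_less) (use e in simp)
  define E where "E y = s i -` {y} \<inter> wigner_seitz a" for y
  define g where "g = (\<Sum>y\<in>s i ` wigner_seitz a. fscale y (indicator (E y)))"
  have fin: "finite (s i ` wigner_seitz a)" using s[of i] by (simp add: simple_function_def)
  have E: "E y \<in> sets lebesgue" for y
  proof -
    have "E y \<in> sets ?M" using simple_functionD(2)[OF s[of i], of "{y}"] by (simp add: E_def)
    then show ?thesis by (simp add: sets_restrict_space_iff)
  qed
  have "g x = s i x" if "x \<in> wigner_seitz a" for x
  proof -
    have "g x = (\<Sum>y\<in>s i ` wigner_seitz a. if y = s i x then y else 0)"
      unfolding g_def sum_cfun_apply using that by (intro sum.cong) (auto simp: E_def indicator_def)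
    then show ?thesis using fin that by simp
  qed
  then have "L2norm a (f - g) = L2norm a (f - s i)" by (intro L2norm_cong) simp
  moreover have "trig_approximable a b g" "g \<in> L2cell a"
    unfolding g_def using E
    by (auto intro!: trig_approximable_sum[OF bases fin] trig_approximable_scale L2cell_sum L2cell_scale
        trig_approximable_indicator[OF bases] indicator_L2cell[OF bases] simp: E_def)
  ultimately show "\<exists>g\<in>L2cell a. trig_approximable a b g \<and> L2norm a (f - g) < e" using i by auto
qed

section \<open>Orthonormal families and Parseval's identity\<close>

text \<open>The index type is arbitrary, since the notion serves for plane waves (indexed by
  frequencies), for eigenfunctions (indexed by numbers) and, with the identity as indexing, for
  sets.\<close>

definition orthonormal_family :: "('d::finite \<Rightarrow> real^'d) \<Rightarrow> ('i \<Rightarrow> 'd cfun) \<Rightarrow> 'i set \<Rightarrow> bool" where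
  "orthonormal_family a v I \<longleftrightarrow>
     (\<forall>i\<in>I. v i \<in> L2cell a) \<and> (\<forall>i\<in>I. \<forall>j\<in>I. ip a (v i) (v j) = (if i = j then 1 else 0))"

lemma orthonormal_familyD:
  assumes "orthonormal_family a v I" "i \<in> I"
  shows "v i \<in> L2cell a" "j \<in> I \<Longrightarrow> ip a (v i) (v j) = (if i = j then 1 else 0)"
  using assms by (auto simp: orthonormal_family_def)

lemma orthonormal_family_subset:
  "orthonormal_family a v I \<Longrightarrow> J \<subseteq> I \<Longrightarrow> orthonormal_family a v J"
  unfolding orthonormal_family_def by blast

lemma orthonormal_pw: "lattice_bases a b \<Longrightarrow> orthonormal_family a (pw a) (zspan b)"
  unfolding orthonormal_family_def by (intro conjI ballI pw_L2cell ip_pw_pw)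

lemma lincomb_L2cell:
  "orthonormal_family a v I \<Longrightarrow> (\<Sum>i\<in>I. fscale (c i) (v i)) \<in> L2cell a"
  by (intro L2cell_sum L2cell_scale) (simp add: orthonormal_family_def)

lemma ip_lincomb_right:
  assumes "orthonormal_family a v I" "f \<in> L2cell a"
  shows "ip a f (\<Sum>i\<in>I. fscale (c i) (v i)) = (\<Sum>i\<in>I. c i * ip a f (v i))"
proof -
  have "ip a f (\<Sum>i\<in>I. fscale (c i) (v i)) = (\<Sum>i\<in>I. ip a f (fscale (c i) (v i)))"
    by (intro ip_sum_right L2cell_scale orthonormal_familyD(1)[OF assms(1)] assms(2))
  then show ?thesis by (simp only: ip_scale_right)
qed

lemma ip_lincomb_left:
  assumes "orthonormal_family a v I" "f \<in> L2cell a"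
  shows "ip a (\<Sum>i\<in>I. fscale (c i) (v i)) f = (\<Sum>i\<in>I. cnj (c i) * ip a (v i) f)"
proof -
  have "ip a (\<Sum>i\<in>I. fscale (c i) (v i)) f = (\<Sum>i\<in>I. ip a (fscale (c i) (v i)) f)"
    by (intro ip_sum_left L2cell_scale orthonormal_familyD(1)[OF assms(1)] assms(2))
  then show ?thesis by (simp only: ip_scale_left)
qed

lemma ip_basis_lincomb:
  assumes "orthonormal_family a v I" "finite I" "j \<in> I"
  shows "ip a (v j) (\<Sum>i\<in>I. fscale (c i) (v i)) = c j"
proof -
  have "ip a (v j) (\<Sum>i\<in>I. fscale (c i) (v i)) = (\<Sum>i\<in>I. c i * ip a (v j) (v i))"
    by (intro ip_lincomb_right assms orthonormal_familyD(1)[OF assms(1)])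
  also have "\<dots> = (\<Sum>i\<in>I. if i = j then c i else 0)"
    using assms by (intro sum.cong) (auto simp: orthonormal_family_def)
  finally show ?thesis using assms by simp
qed

lemma ip_lincomb_lincomb:
  assumes "orthonormal_family a v I" "finite I"
  shows "ip a (\<Sum>i\<in>I. fscale (c i) (v i)) (\<Sum>i\<in>I. fscale (d i) (v i)) = (\<Sum>i\<in>I. cnj (c i) * d i)"
proof -
  have "(\<Sum>i\<in>I. cnj (c i) * ip a (v i) (\<Sum>i\<in>I. fscale (d i) (v i))) = (\<Sum>i\<in>I. cnj (c i) * d i)"
    by (intro sum.cong refl arg_cong2[where f = "(*)"] ip_basis_lincomb[OF assms])
  then show ?thesis
    unfolding ip_lincomb_left[OF assms(1) lincomb_L2cell[OF assms(1)]] .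
qed

lemma L2norm_lincomb:
  assumes "orthonormal_family a v I" "finite I"
  shows "(L2norm a (\<Sum>i\<in>I. fscale (c i) (v i)))\<^sup>2 = (\<Sum>i\<in>I. (norm (c i))\<^sup>2)"
proof -
  have "complex_of_real ((L2norm a (\<Sum>i\<in>I. fscale (c i) (v i)))\<^sup>2) = of_real (\<Sum>i\<in>I. (norm (c i))\<^sup>2)"
    unfolding ip_self[symmetric] ip_lincomb_lincomb[OF assms] of_real_sum
    by (intro sum.cong refl) (simp only: complex_norm_square mult.commute)
  then show ?thesis by (simp only: of_real_eq_iff)
qed

lemma lincomb_norm_pos:
  assumes "orthonormal_family a v I" "finite I" "\<exists>i\<in>I. c i \<noteq> 0"
  shows "0 < (L2norm a (\<Sum>i\<in>I. fscale (c i) (v i)))\<^sup>2"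
proof -
  obtain i where i: "i \<in> I" "c i \<noteq> 0" using assms(3) by blast
  then have "0 < (norm (c i))\<^sup>2" by simp
  also have "\<dots> \<le> (\<Sum>i\<in>I. (norm (c i))\<^sup>2)" using i(1) assms(2) by (intro member_le_sum) auto
  finally show ?thesis unfolding L2norm_lincomb[OF assms(1,2)] .
qed

lemma L2norm_residual:
  assumes v: "orthonormal_family a v I" "finite I" and f: "f \<in> L2cell a"
  shows "(L2norm a (f - (\<Sum>i\<in>I. fscale (c i) (v i))))\<^sup>2 =
     (L2norm a f)\<^sup>2 - (\<Sum>i\<in>I. (norm (ip a (v i) f))\<^sup>2) + (\<Sum>i\<in>I. (norm (ip a (v i) f - c i))\<^sup>2)"
proof -
  define s where "s = (\<Sum>i\<in>I. fscale (c i) (v i))"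
  define z where "z i = ip a (v i) f" for i
  have s: "s \<in> L2cell a" unfolding s_def by (rule lincomb_L2cell[OF v(1)])
  have "ip a (f - s) (f - s) = ip a f f - ip a f s - ip a s f + ip a s s"
    unfolding ip_diff_left[OF f s L2cell_diff[OF f s]] ip_diff_right[OF f f s] ip_diff_right[OF s f s]
    by simp
  also have "ip a s s = (\<Sum>i\<in>I. cnj (c i) * c i)"
    unfolding s_def by (rule ip_lincomb_lincomb[OF v])
  also have "ip a s f = (\<Sum>i\<in>I. cnj (c i) * z i)"
    unfolding s_def z_def by (rule ip_lincomb_left[OF v(1) f])
  also have "ip a f s = (\<Sum>i\<in>I. c i * cnj (z i))"
    unfolding s_def z_def ip_lincomb_right[OF v(1) f] by (simp only: ip_commute[of a f])
  also have "ip a f f - (\<Sum>i\<in>I. c i * cnj (z i)) - (\<Sum>i\<in>I. cnj (c i) * z i) + (\<Sum>i\<in>I. cnj (c i) * c i)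
      = ip a f f - (\<Sum>i\<in>I. z i * cnj (z i)) + (\<Sum>i\<in>I. (z i - c i) * cnj (z i - c i))"
    by (simp add: algebra_simps sum.distrib sum_subtractf)
  also have "\<dots> = of_real ((L2norm a f)\<^sup>2 - (\<Sum>i\<in>I. (norm (z i))\<^sup>2) + (\<Sum>i\<in>I. (norm (z i - c i))\<^sup>2))"
    by (simp only: ip_self complex_norm_square[symmetric] of_real_sum of_real_add of_real_diff)
  finally have "(L2norm a (f - s))\<^sup>2 = (L2norm a f)\<^sup>2 - (\<Sum>i\<in>I. (norm (z i))\<^sup>2) + (\<Sum>i\<in>I. (norm (z i - c i))\<^sup>2)"
    unfolding ip_self of_real_eq_iff .
  then show ?thesis unfolding s_def z_def .
qed

lemma orthonormal_best_approximation:
  assumes v: "orthonormal_family a v I" "finite I" and f: "f \<in> L2cell a"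
  shows "L2norm a (f - (\<Sum>i\<in>I. fscale (ip a (v i) f) (v i))) \<le> L2norm a (f - (\<Sum>i\<in>I. fscale (c i) (v i)))"
proof (rule power2_le_imp_le)
  show "(L2norm a (f - (\<Sum>i\<in>I. fscale (ip a (v i) f) (v i))))\<^sup>2 \<le> (L2norm a (f - (\<Sum>i\<in>I. fscale (c i) (v i))))\<^sup>2"
    unfolding L2norm_residual[OF assms] by (simp add: sum_nonneg)
qed simp

lemma orthonormal_expansion:
  assumes v: "orthonormal_family a v I" "finite I" and f: "f \<in> cspan (v ` I)"
  shows "f = (\<Sum>i\<in>I. fscale (ip a (v i) f) (v i))"
proof -
  have "\<exists>c. f = (\<Sum>i\<in>I. fscale (c i) (v i))"
    using f
  proof (induction rule: cfun.span_induct_alt)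
    case base
    have "0 = (\<Sum>i\<in>I. fscale ((\<lambda>_. 0) i) (v i))" 
      by (intro sum.neutral[symmetric] ballI cfun.scale_zero_left)
    then show ?case by (rule exI[of _ "\<lambda>_. 0"])
  next
    case (step e x y)
    then obtain j c where j: "j \<in> I" "x = v j" and y: "y = (\<Sum>i\<in>I. fscale (c i) (v i))" by blast
    have "fscale e x = (\<Sum>i\<in>I. if i = j then fscale e (v j) else 0)"
      using j v(2) by (simp only: sum.delta if_True)
    also have "\<dots> = (\<Sum>i\<in>I. fscale (if i = j then e else 0) (v i))"
      by (intro sum.cong refl) (simp only: cfun.scale_zero_left split: if_split, blast)
    finally have "fscale e x + y = (\<Sum>i\<in>I. fscale ((\<lambda>i. (if i = j then e else 0) + c i) i) (v i))"
      unfolding y by (simp only: cfun.scale_left_distrib sum.distrib)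
    then show ?case by (rule exI[of _ "\<lambda>i. (if i = j then e else 0) + c i"])
  qed
  then obtain c where c: "f = (\<Sum>i\<in>I. fscale (c i) (v i))" by blast
  have "ip a (v j) f = c j" if "j \<in> I" for j unfolding c by (rule ip_basis_lincomb[OF v that])
  then show ?thesis by (subst c) (intro sum.cong refl, simp only:)
qed

lemma orthonormal_inj:
  assumes "orthonormal_family a v I"
  shows "inj_on v I"
  using assms unfolding orthonormal_family_def inj_on_def by (metis zero_neq_one)

lemma orthonormal_independent:
  assumes v: "orthonormal_family a v I"
  shows "cfun.independent (v ` I)"
  unfolding cfun.dependent_def
proof clarify
  fix i assume i: "i \<in> I" "v i \<in> cspan (v ` I - {v i})"
  have "f \<in> L2cell a \<and> ip a (v i) f = 0" if "f \<in> cspan (v ` I - {v i})" for f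
    using that
  proof (induction rule: cfun.span_induct_alt)
    case base
    show ?case by (intro conjI L2cell_zero ip_zero_right)
  next
    case (step e x y)
    then obtain j where j: "j \<in> I" "x = v j" "i \<noteq> j" by blast
    then have "x \<in> L2cell a" "ip a (v i) x = 0" using v i by (auto simp: orthonormal_family_def)
    moreover have "v i \<in> L2cell a" using v i by (auto simp: orthonormal_family_def)
    ultimately show ?case
      using step by (simp only: ip_add_right L2cell_scale L2cell_add ip_scale_right
          mult_zero_right add_0 simp_thms)
  qed
  from this[OF i(2)] show False using v i(1) by (auto simp: orthonormal_family_def)
qed

lemma fourier_eq_ip: "fourier a f G = ip a (pw a G) f"
  unfolding fourier_def ip_def by (simp only: mult.commute)

text \<open>A Fourier sum over at least the frequencies of an approximating trigonometric polynomial
  is at least as close to \<open>f\<close> as that polynomial.\<close>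

lemma fourier_partial_sums:
  assumes bases: "lattice_bases a b" and f: "f \<in> L2cell a" and e: "e > 0"
  shows "\<exists>A. finite A \<and> A \<subseteq> zspan b \<and> (\<forall>B. finite B \<longrightarrow> A \<subseteq> B \<longrightarrow> B \<subseteq> zspan b \<longrightarrow>
           L2norm a (f - (\<Sum>G\<in>B. fscale (fourier a f G) (pw a G))) < e)"
proof -
  obtain p where p: "p \<in> cspan (pw a ` zspan b)" "L2norm a (f - p) < e"
    using trig_polys_dense[OF bases f] e unfolding trig_approximable_def trig_polys_def by blast
  then obtain S r where S: "finite S" "S \<subseteq> pw a ` zspan b" "p = (\<Sum>g\<in>S. fscale (r g) g)"
    unfolding cfun.span_explicit by blast
  then obtain A where A: "finite A" "A \<subseteq> zspan b" "S = pw a ` A"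
    by (meson finite_subset_image)
  show ?thesis
  proof (intro exI conjI allI impI)
    fix B assume B: "finite B" "A \<subseteq> B" "B \<subseteq> zspan b"
    have v: "orthonormal_family a (pw a) B"
      using orthonormal_family_subset[OF orthonormal_pw[OF bases] B(3)] .
    have "p \<in> cspan (pw a ` B)"
      unfolding S(3) using A B
      by (intro cfun.span_sum cfun.span_scale cfun.span_base) blast
    note p_exp = orthonormal_expansion[OF v B(1) this]
    have "L2norm a (f - (\<Sum>G\<in>B. fscale (fourier a f G) (pw a G)))
        \<le> L2norm a (f - (\<Sum>G\<in>B. fscale (ip a (pw a G) p) (pw a G)))"
      unfolding fourier_eq_ip by (rule orthonormal_best_approximation[OF v B(1) f])
    also have "\<dots> < e" using p(2) unfolding p_exp[symmetric] .
    finally show "L2norm a (f - (\<Sum>G\<in>B. fscale (fourier a f G) (pw a G))) < e" .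
  qed (use A in auto)
qed

text \<open>The error of a partial sum is the inner product of \<open>g\<close> with the remainder
  of the Fourier series of \<open>f\<close>.\<close>

theorem parseval_ip:
  assumes bases: "lattice_bases a b" and f: "f \<in> L2cell a" and g: "g \<in> L2cell a"
  shows "((\<lambda>G. cnj (fourier a f G) * fourier a g G) has_sum ip a f g) (zspan b)"
  unfolding has_sum_def tendsto_iff
proof (intro allI impI)
  fix e :: real assume e: "e > 0"
  have g_pos: "L2norm a g + 1 > 0" by (simp add: add_nonneg_pos)
  obtain A where A: "finite A" "A \<subseteq> zspan b"
    and *: "\<And>B. finite B \<Longrightarrow> A \<subseteq> B \<Longrightarrow> B \<subseteq> zspan b \<Longrightarrow>
           L2norm a (f - (\<Sum>G\<in>B. fscale (fourier a f G) (pw a G))) < e / (L2norm a g + 1)"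
    using fourier_partial_sums[OF bases f, of "e / (L2norm a g + 1)", OF divide_pos_pos[OF e g_pos]] by blast
  have "dist (\<Sum>G\<in>B. cnj (fourier a f G) * fourier a g G) (ip a f g) < e"
    if B: "finite B" "A \<subseteq> B" "B \<subseteq> zspan b" for B
  proof -
    let ?s = "\<Sum>G\<in>B. fscale (fourier a f G) (pw a G)"
    have v: "orthonormal_family a (pw a) B"
      using orthonormal_family_subset[OF orthonormal_pw[OF bases] B(3)] .
    have s: "?s \<in> L2cell a" by (rule lincomb_L2cell[OF v])
    have "ip a ?s g = (\<Sum>G\<in>B. cnj (fourier a f G) * fourier a g G)"
      unfolding ip_lincomb_left[OF v g] by (simp only: fourier_eq_ip)
    then have "dist (\<Sum>G\<in>B. cnj (fourier a f G) * fourier a g G) (ip a f g) = norm (ip a (f - ?s) g)"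
      unfolding ip_diff_left[OF f s g] dist_norm by (simp only: norm_minus_commute)
    also have "\<dots> \<le> L2norm a (f - ?s) * L2norm a g"
      by (intro ip_Cauchy_Schwarz L2cell_diff f s g)
    also have "\<dots> \<le> L2norm a (f - ?s) * (L2norm a g + 1)"
      by (intro mult_left_mono) simp_all
    also have "\<dots> < e"
      using *[OF B] by (simp add: pos_less_divide_eq add_nonneg_pos)
    finally show ?thesis .
  qed
  then show "\<forall>\<^sub>F B in finite_subsets_at_top (zspan b). dist (\<Sum>G\<in>B. cnj (fourier a f G) * fourier a g G) (ip a f g) < e"
    unfolding eventually_finite_subsets_at_top using A by blast
qed

corollary parseval:
  assumes bases: "lattice_bases a b" and f: "f \<in> L2cell a"
  shows "((\<lambda>G. (norm (fourier a f G))\<^sup>2) has_sum (L2norm a f)\<^sup>2) (zspan b)"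
proof -
  have "((\<lambda>G. Re (cnj (fourier a f G) * fourier a f G)) has_sum Re (ip a f f)) (zspan b)"
    by (rule has_sum_Re[OF parseval_ip[OF bases f f]])
  moreover have "Re (cnj z * z) = (norm z)\<^sup>2" for z
    by (simp add: cmod_def power2_eq_square)
  moreover have "Re (ip a f f) = (L2norm a f)\<^sup>2" unfolding ip_self by (rule Re_complex_of_real)
  ultimately show ?thesis by simp
qed

lemma L2per_subset_L2cell:
  assumes bases: "lattice_bases a b" and f: "f \<in> L2per a"
  shows "f \<in> L2cell a"
proof -
  have "bounded (closure (wigner_seitz a))" using wigner_seitz_bounded[OF bases] by (rule bounded_closure)
  then have "compact (closure (wigner_seitz a))" by (simp add: compact_eq_bounded_closed)
  then have "set_integrable lebesgue (closure (wigner_seitz a)) (\<lambda>x. (norm (f x))\<^sup>2)"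
    using f by (simp add: L2per_def)
  then have "set_integrable lebesgue (wigner_seitz a) (\<lambda>x. (norm (f x))\<^sup>2)"
    by (rule set_integrable_subset) (simp_all add: closure_subset)
  then have "integrable (cell_measure a) (\<lambda>x. (norm (f x))\<^sup>2)"
    unfolding set_integrable_def by (subst integrable_restrict_space) simp_all
  moreover have "f \<in> borel_measurable (cell_measure a)"
    using f by (intro measurable_restrict_space1) (simp add: L2per_def)
  ultimately show ?thesis by (simp add: L2cell_def)
qed

lemma trig_polys_L2per:
  assumes bases: "lattice_bases a b" and f: "f \<in> trig_polys a b"
  shows "f \<in> L2per a"
proof -
  have f: "continuous_on UNIV f \<and> (\<forall>R\<in>zspan a. \<forall>x. f (x + R) = f x)"
    using f unfolding trig_polys_def
  proof (induction rule: cfun.span_induct_alt)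
    case base
    show ?case by (simp add: zero_fun_def)
  next
    case (step c p h)
    then obtain G where G: "G \<in> zspan b" "p = pw a G" by blast
    have "continuous_on UNIV (\<lambda>x. c * p x + h x)"
      unfolding G(2) using step by (intro continuous_intros pw_continuous) simp
    moreover have "p (x + R) = p x" if "R \<in> zspan a" for x R
      unfolding G(2) pw_def using exp_zspan_inner_zspan[OF bases that G(1)]
      by (simp add: inner_add_right exp_add distrib_left)
    ultimately show ?case using step by (simp add: plus_fun_def fscale_def)
  qed
  have "f \<in> borel_measurable lebesgue"
    using f by (intro measurable_completion) (simp add: borel_measurable_continuous_onI)
  moreover have "set_integrable lebesgue K (\<lambda>x. (norm (f x))\<^sup>2)" if "compact K" for K
  proof -
    have "continuous_on UNIV (\<lambda>x. (norm (f x))\<^sup>2)" using f by (intro continuous_intros) simp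
    then have "integrable lborel (\<lambda>x. indicator K x *\<^sub>R (norm (f x))\<^sup>2)"
      by (intro borel_integrable_compact that) (rule continuous_on_subset[OF _ subset_UNIV])
    then show ?thesis
      unfolding set_integrable_def by (subst integrable_completion) (simp_all add: borel_measurable_integrable)
  qed
  ultimately show ?thesis using f by (simp add: L2per_def periodic_def)
qed

section \<open>The variational principle for the exact fibers\<close>

text \<open>Gaussian elimination: a nonzero coefficient of the equation \<open>p\<close> eliminates
  one equation together with one unknown.\<close>

lemma homogeneous_system_nontrivial_solution:
  fixes A :: "'i \<Rightarrow> 'j \<Rightarrow> 'a::field"
  assumes "finite I" "finite J" "card I < card J"
  shows "\<exists>x. (\<exists>j\<in>J. x j \<noteq> 0) \<and> (\<forall>i\<in>I. (\<Sum>j\<in>J. A i j * x j) = 0)"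
  using assms
proof (induction I arbitrary: J A)
  case empty
  then have "J \<noteq> {}" by auto
  then show ?case by (intro exI[of _ "\<lambda>_. 1"]) auto
next
  case (insert p I)
  show ?case
  proof (cases "\<forall>j\<in>J. A p j = 0")
    case True
    obtain x where "\<exists>j\<in>J. x j \<noteq> 0" "\<forall>i\<in>I. (\<Sum>j\<in>J. A i j * x j) = 0"
      using insert.IH[of J A] insert.prems insert.hyps by auto
    then show ?thesis using True by (intro exI[of _ x]) auto
  next
    case False
    then obtain q where q: "q \<in> J" "A p q \<noteq> 0" by auto
    have "card I < card (J - {q})" using insert.prems insert.hyps q by simp
    then obtain y where y: "\<exists>j\<in>J - {q}. y j \<noteq> 0"
        "\<forall>i\<in>I. (\<Sum>j\<in>J - {q}. (A i j - A i q * A p j / A p q) * y j) = 0"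
      using insert.IH[of "J - {q}" "\<lambda>i j. A i j - A i q * A p j / A p q"] insert.prems by auto
    define x where "x j = (if j = q then - (\<Sum>j\<in>J - {q}. A p j * y j) / A p q else y j)" for j
    have split: "(\<Sum>j\<in>J. A i j * x j) = A i q * x q + (\<Sum>j\<in>J - {q}. A i j * y j)" for i
    proof -
      have "(\<Sum>j\<in>J - {q}. A i j * x j) = (\<Sum>j\<in>J - {q}. A i j * y j)"
        by (intro sum.cong) (auto simp: x_def)
      then show ?thesis using insert.prems q by (subst sum.remove[of J q]) auto
    qed
    have "(\<Sum>j\<in>J. A i j * x j) = 0" if "i \<in> insert p I" for i
    proof (cases "i = p")
      case True
      then have "(\<Sum>j\<in>J. A i j * x j) = A p q * x q + (\<Sum>j\<in>J - {q}. A p j * y j)"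
        using split[of p] by simp
      then show ?thesis using q by (simp add: x_def)
    next
      case False
      then have "0 = (\<Sum>j\<in>J - {q}. A i j * y j - (A i q / A p q) * (A p j * y j))"
        using y(2) that by (simp add: algebra_simps)
      also have "\<dots> = (\<Sum>j\<in>J - {q}. A i j * y j) - (A i q / A p q) * (\<Sum>j\<in>J - {q}. A p j * y j)"
        by (simp add: sum_subtractf sum_distrib_left)
      also have "\<dots> = (\<Sum>j\<in>J. A i j * x j)"
        unfolding split by (simp add: x_def)
      finally show ?thesis by simp
    qed
    moreover have "\<exists>j\<in>J. x j \<noteq> 0" using y(1) by (auto simp: x_def)
    ultimately show ?thesis by blast
  qed
qed

lemma ip_sum_fscale_right:
  assumes "f \<in> L2cell a" "\<And>i. i \<in> I \<Longrightarrow> v i \<in> L2cell a"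
  shows "ip a f (\<Sum>i\<in>I. fscale (c i) (v i)) = (\<Sum>i\<in>I. c i * ip a f (v i))"
proof -
  have "ip a f (\<Sum>i\<in>I. fscale (c i) (v i)) = (\<Sum>i\<in>I. ip a f (fscale (c i) (v i)))"
    by (intro ip_sum_right L2cell_scale assms)
  then show ?thesis by (simp only: ip_scale_right)
qed

text \<open>The dimension count behind all comparisons of eigenvalues below.\<close>

lemma orthogonal_combination:
  assumes "finite I" "finite J" "card I < card J"
    and "\<And>i. i \<in> I \<Longrightarrow> w i \<in> L2cell a" "\<And>j. j \<in> J \<Longrightarrow> v j \<in> L2cell a"
  shows "\<exists>x. (\<exists>j\<in>J. x j \<noteq> 0) \<and> (\<forall>i\<in>I. ip a (w i) (\<Sum>j\<in>J. fscale (x j) (v j)) = 0)"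
proof -
  obtain x where x: "\<exists>j\<in>J. x j \<noteq> 0" "\<forall>i\<in>I. (\<Sum>j\<in>J. ip a (w i) (v j) * x j) = 0"
    using homogeneous_system_nontrivial_solution[OF assms(1-3), of "\<lambda>i j. ip a (w i) (v j)"] by blast
  have "ip a (w i) (\<Sum>j\<in>J. fscale (x j) (v j)) = 0" if "i \<in> I" for i
  proof -
    have "ip a (w i) (\<Sum>j\<in>J. fscale (x j) (v j)) = (\<Sum>j\<in>J. x j * ip a (w i) (v j))"
      by (intro ip_sum_fscale_right assms that)
    also have "\<dots> = (\<Sum>j\<in>J. ip a (w i) (v j) * x j)" by (simp only: mult.commute)
    finally show ?thesis using x(2) that by simp
  qed
  with x(1) show ?thesis by blast
qed

definition pot :: "(real^'d::finite \<Rightarrow> real) \<Rightarrow> 'd cfun \<Rightarrow> 'd cfun" where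
  "pot V f = (\<lambda>x. of_real (V x) * f x)"

definition bounded_potential :: "(real^'d::finite \<Rightarrow> real) \<Rightarrow> real \<Rightarrow> bool" where
  "bounded_potential V B \<longleftrightarrow> 0 \<le> B \<and> (\<lambda>x. complex_of_real (V x)) \<in> borel_measurable lebesgue
     \<and> (AE x in lebesgue. \<bar>V x\<bar> \<le> B)"

lemma bounded_potential_Linfper:
  assumes "(\<lambda>x. complex_of_real (V x)) \<in> Linfper a"
  obtains B where "bounded_potential V B"
proof -
  obtain B where B: "AE x in lebesgue. \<bar>V x\<bar> \<le> B" and m: "(\<lambda>x. complex_of_real (V x)) \<in> borel_measurable lebesgue"
    using assms by (auto simp: Linfper_def)
  have "AE x in lebesgue. \<bar>V x\<bar> \<le> max B 0" using B by eventually_elim simp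
  with m have "bounded_potential V (max B 0)" by (simp add: bounded_potential_def)
  then show ?thesis by (rule that)
qed

lemma pot_bounds:
  assumes V: "bounded_potential V B" and f: "f \<in> L2cell a"
  shows "pot V f \<in> L2cell a" "L2norm a (pot V f) \<le> B * L2norm a f"
proof -
  let ?M = "cell_measure a"
  have [measurable]: "f \<in> borel_measurable ?M" using f by (simp add: L2cell_def)
  have [measurable]: "(\<lambda>x. complex_of_real (V x)) \<in> borel_measurable ?M"
    using V by (intro measurable_restrict_space1) (simp add: bounded_potential_def)
  have m: "pot V f \<in> borel_measurable ?M" unfolding pot_def by measurable
  have int: "integrable ?M (\<lambda>x. B\<^sup>2 * (norm (f x))\<^sup>2)" using f by (simp add: L2cell_def)
  have "AE x in lebesgue. \<bar>V x\<bar> \<le> B" using V by (simp add: bounded_potential_def)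
  then have AE: "AE x in ?M. (norm (pot V f x))\<^sup>2 \<le> B\<^sup>2 * (norm (f x))\<^sup>2"
    by (subst AE_restrict_space_iff)
       (auto elim!: eventually_mono intro!: mult_right_mono
         simp: pot_def norm_mult power_mult_distrib abs_le_square_iff[symmetric])
  have pint: "integrable ?M (\<lambda>x. (norm (pot V f x))\<^sup>2)"
  proof (rule Bochner_Integration.integrable_bound[OF int])
    show "(\<lambda>x. (norm (pot V f x))\<^sup>2) \<in> borel_measurable ?M" using m by measurable
    show "AE x in ?M. norm ((norm (pot V f x))\<^sup>2) \<le> norm (B\<^sup>2 * (norm (f x))\<^sup>2)"
      using AE by eventually_elim simp
  qed
  then show "pot V f \<in> L2cell a" using m by (simp add: L2cell_def)
  have "(L2norm a (pot V f))\<^sup>2 \<le> (LINT x|?M. B\<^sup>2 * (norm (f x))\<^sup>2)"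
    unfolding L2norm_sq by (rule integral_mono_AE[OF pint int AE])
  also have "\<dots> = (B * L2norm a f)\<^sup>2" by (simp add: L2norm_sq power_mult_distrib)
  finally have sq: "(L2norm a (pot V f))\<^sup>2 \<le> (B * L2norm a f)\<^sup>2" .
  have "0 \<le> B" using V by (simp add: bounded_potential_def)
  then have "0 \<le> B * L2norm a f" by (intro mult_nonneg_nonneg L2norm_nonneg)
  with sq show "L2norm a (pot V f) \<le> B * L2norm a f" by (rule power2_le_imp_le)
qed

lemma ip_pot_commute: "ip a (pot V f) g = ip a f (pot V g)"
  unfolding ip_def pot_def by (simp add: mult_ac)

lemma ip_pot_bound:
  assumes V: "bounded_potential V B" and f: "f \<in> L2cell a" and g: "g \<in> L2cell a"
  shows "norm (ip a f (pot V g)) \<le> B * L2norm a f * L2norm a g"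
proof -
  have "norm (ip a f (pot V g)) \<le> L2norm a f * L2norm a (pot V g)"
    by (intro ip_Cauchy_Schwarz f pot_bounds[OF V g])
  also have "\<dots> \<le> L2norm a f * (B * L2norm a g)"
    by (intro mult_left_mono pot_bounds[OF V g]) simp
  finally show ?thesis by (simp add: mult_ac)
qed

lemma pot_sum: "pot V (\<Sum>i\<in>I. fscale (c i) (v i)) = (\<Sum>i\<in>I. fscale (c i) (pot V (v i)))"
  unfolding pot_def fun_eq_iff sum_cfun_apply fscale_apply by (simp add: sum_distrib_left mult.left_commute)

definition kinetic :: "real^'d::finite \<Rightarrow> real^'d \<Rightarrow> real" where
  "kinetic k G = (norm (k + G))\<^sup>2 / 2"

lemma kinetic_nonneg [simp]: "0 \<le> kinetic k G"
  by (simp add: kinetic_def)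

lemma fiber_eigenbasisD:
  assumes bases: "lattice_bases a b" and eb: "fiber_eigenbasis a b V k eps u"
  shows "1 \<le> j \<Longrightarrow> u j \<in> L2cell a"
    and "I \<subseteq> {1..} \<Longrightarrow> orthonormal_family a u I"
    and "1 \<le> j \<Longrightarrow> G \<in> zspan b \<Longrightarrow>
      of_real (eps j) * fourier a (u j) G = of_real (kinetic k G) * fourier a (u j) G + fourier a (pot V (u j)) G"
    and "1 \<le> i \<Longrightarrow> i \<le> j \<Longrightarrow> eps i \<le> eps j"
proof -
  have u: "u j \<in> L2cell a" if "1 \<le> j" for j
    using eb that by (intro L2per_subset_L2cell[OF bases]) (simp add: fiber_eigenbasis_def orthonormal_basis_def)
  then show "1 \<le> j \<Longrightarrow> u j \<in> L2cell a" .
  show "orthonormal_family a u I" if I: "I \<subseteq> {1..}"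
  proof -
    have "\<forall>i\<in>I. 1 \<le> i" using I by auto
    then show ?thesis
      unfolding orthonormal_family_def using u eb
      by (simp add: fiber_eigenbasis_def orthonormal_basis_def)
  qed
  show "of_real (eps j) * fourier a (u j) G = of_real (kinetic k G) * fourier a (u j) G + fourier a (pot V (u j)) G"
    if j: "1 \<le> j" and G: "G \<in> zspan b"
  proof -
    have "fiber_op a b V k (u j) (fscale (of_real (eps j)) (u j))"
      using eb j by (simp add: fiber_eigenbasis_def)
    then have "fourier a (fscale (of_real (eps j)) (u j)) G
        = of_real (kinetic k G) * fourier a (u j) G + fourier a (pot V (u j)) G"
      unfolding fiber_op_def kinetic_def pot_def using G by blast
    then show ?thesis unfolding fourier_eq_ip ip_scale_right .
  qed
  have "mono_on {1..} eps" using eb by (simp add: fiber_eigenbasis_def)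
  then show "1 \<le> i \<Longrightarrow> i \<le> j \<Longrightarrow> eps i \<le> eps j"
    by (rule mono_onD) simp_all
qed

lemma tendsto_ip_left:
  assumes F: "\<And>N. F N \<in> L2cell a" and f: "f \<in> L2cell a" and g: "g \<in> L2cell a"
    and lim: "(\<lambda>N. L2norm a (f - F N)) \<longlonglongrightarrow> 0"
  shows "(\<lambda>N. ip a (F N) g) \<longlonglongrightarrow> ip a f g"
proof -
  have "norm (ip a (F N) g - ip a f g) \<le> L2norm a (f - F N) * L2norm a g" for N
  proof -
    have "norm (ip a (F N) g - ip a f g) = norm (ip a (f - F N) g)"
      unfolding ip_diff_left[OF f F g] by (rule norm_minus_commute)
    also have "\<dots> \<le> L2norm a (f - F N) * L2norm a g"
      by (intro ip_Cauchy_Schwarz L2cell_diff f F g)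
    finally show ?thesis .
  qed
  then have "eventually (\<lambda>N. norm (ip a (F N) g - ip a f g) \<le> L2norm a (f - F N) * L2norm a g) sequentially"
    by (intro always_eventually allI)
  moreover have "(\<lambda>N. L2norm a (f - F N) * L2norm a g) \<longlonglongrightarrow> 0"
    using tendsto_mult_left_zero[OF lim] .
  ultimately have "(\<lambda>N. ip a (F N) g - ip a f g) \<longlonglongrightarrow> 0"
    by (rule Lim_null_comparison)
  then show ?thesis by (rule Lim_null[THEN iffD2])
qed

text \<open>One half of the min-max principle, for trigonometric polynomials. The function
  \<open>h\<close> in the proof is the operator applied to \<open>\<Phi>\<close>; it pairs with
  \<open>u j\<close> like \<open>eps j\<close> times \<open>\<Phi>\<close>, because only finitely many
  Fourier coefficients of \<open>u j\<close> enter and the eigenvalue equation can be used for each of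
  them. The partial sums \<open>P N\<close> of the eigenfunction expansion satisfy the inequality by
  monotonicity of \<open>eps\<close>, and it passes to the limit.\<close>

lemma fiber_lower_bound:
  assumes bases: "lattice_bases a b" and V: "bounded_potential V B"
    and eb: "fiber_eigenbasis a b V k eps u" and n: "1 \<le> n"
    and A: "finite A" "A \<subseteq> zspan b" and Phi: "\<Phi> = (\<Sum>G\<in>A. fscale (c G) (pw a G))"
    and orth: "\<And>j. 1 \<le> j \<Longrightarrow> j < n \<Longrightarrow> ip a (u j) \<Phi> = 0"
  shows "eps n * (L2norm a \<Phi>)\<^sup>2 \<le> (\<Sum>G\<in>A. kinetic k G * (norm (c G))\<^sup>2) + Re (ip a \<Phi> (pot V \<Phi>))"
proof -
  note D = fiber_eigenbasisD[OF bases eb]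
  have pwA: "orthonormal_family a (pw a) A"
    using orthonormal_family_subset[OF orthonormal_pw[OF bases] A(2)] .
  have Phi_L2: "\<Phi> \<in> L2cell a" unfolding Phi by (rule lincomb_L2cell[OF pwA])
  note VPhi_L2 = pot_bounds(1)[OF V Phi_L2]
  define T where "T = (\<Sum>G\<in>A. fscale (of_real (kinetic k G) * c G) (pw a G))"
  have T_L2: "T \<in> L2cell a" unfolding T_def by (rule lincomb_L2cell[OF pwA])
  \<comment> \<open>\<open>T\<close> and \<open>h\<close> are the images of \<open>\<Phi>\<close> under the kinetic part and under the whole operator.\<close>
  define h where "h = T + pot V \<Phi>"
  have h_L2: "h \<in> L2cell a" unfolding h_def by (intro L2cell_add T_L2 VPhi_L2)
  define \<gamma> where "\<gamma> j = ip a (u j) \<Phi>" for j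
  have u_h: "ip a (u j) h = of_real (eps j) * \<gamma> j" if j: "1 \<le> j" for j
  proof -
    have "ip a (u j) h = ip a (u j) T + ip a (u j) (pot V \<Phi>)"
      unfolding h_def by (rule ip_add_right[OF D(1)[OF j] T_L2 VPhi_L2])
    also have "ip a (u j) T = (\<Sum>G\<in>A. of_real (kinetic k G) * c G * ip a (u j) (pw a G))"
      unfolding T_def by (rule ip_lincomb_right[OF pwA D(1)[OF j]])
    also have "ip a (u j) (pot V \<Phi>) = (\<Sum>G\<in>A. c G * ip a (pot V (u j)) (pw a G))"
      unfolding ip_pot_commute[symmetric] Phi by (rule ip_lincomb_right[OF pwA pot_bounds(1)[OF V D(1)[OF j]]])
    also have "(\<Sum>G\<in>A. of_real (kinetic k G) * c G * ip a (u j) (pw a G)) + (\<Sum>G\<in>A. c G * ip a (pot V (u j)) (pw a G))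
        = (\<Sum>G\<in>A. c G * cnj (of_real (kinetic k G) * fourier a (u j) G + fourier a (pot V (u j)) G))"
      unfolding fourier_eq_ip ip_commute[of a "u j" "pw a G" for G] ip_commute[of a "pot V (u j)" "pw a G" for G]
      by (simp add: sum.distrib algebra_simps)
    also have "\<dots> = (\<Sum>G\<in>A. c G * cnj (of_real (eps j) * fourier a (u j) G))"
      using A D(3)[OF j] by (intro sum.cong refl) (simp add: subset_iff)
    also have "\<dots> = of_real (eps j) * (\<Sum>G\<in>A. c G * ip a (u j) (pw a G))"
      unfolding fourier_eq_ip ip_commute[of a "u j" "pw a G" for G] by (simp add: sum_distrib_left mult_ac)
    also have "(\<Sum>G\<in>A. c G * ip a (u j) (pw a G)) = \<gamma> j"
      unfolding \<gamma>_def Phi by (rule ip_lincomb_right[OF pwA D(1)[OF j], symmetric])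
    finally show ?thesis .
  qed
  define P where "P N = (\<Sum>j=1..N. fscale (\<gamma> j) (u j))" for N :: nat
  have uN: "orthonormal_family a u {1..N}" for N by (rule D(2)) auto
  have P_L2: "P N \<in> L2cell a" for N unfolding P_def by (rule lincomb_L2cell[OF uN])
  have "\<Phi> \<in> trig_polys a b"
    unfolding Phi trig_polys_def using A by (intro cfun.span_sum cfun.span_scale cfun.span_base) blast
  then have "\<Phi> \<in> L2per a" by (rule trig_polys_L2per[OF bases])
  then have P_lim: "(\<lambda>N. L2norm a (\<Phi> - P N)) \<longlonglongrightarrow> 0"
    using eb unfolding P_def \<gamma>_def fiber_eigenbasis_def orthonormal_basis_def by blast
  have lim_h: "(\<lambda>N. Re (ip a (P N) h)) \<longlonglongrightarrow> Re (ip a \<Phi> h)"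
    by (intro tendsto_Re tendsto_ip_left P_L2 Phi_L2 h_L2 P_lim)
  have lim_Phi: "(\<lambda>N. eps n * Re (ip a (P N) \<Phi>)) \<longlonglongrightarrow> eps n * Re (ip a \<Phi> \<Phi>)"
    by (intro tendsto_mult_left tendsto_Re tendsto_ip_left P_L2 Phi_L2 P_lim)
  have sq: "Re (cnj z * z) = (norm z)\<^sup>2" for z by (simp add: cmod_def power2_eq_square)
  have "eps n * Re (ip a (P N) \<Phi>) \<le> Re (ip a (P N) h)" for N
  proof -
    have "ip a (P N) \<Phi> = (\<Sum>j=1..N. cnj (\<gamma> j) * \<gamma> j)"
      unfolding P_def ip_lincomb_left[OF uN Phi_L2] by (simp only: \<gamma>_def)
    then have "eps n * Re (ip a (P N) \<Phi>) = (\<Sum>j=1..N. eps n * (norm (\<gamma> j))\<^sup>2)"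
      by (simp only: Re_sum sq sum_distrib_left)
    also have "\<dots> \<le> (\<Sum>j=1..N. eps j * (norm (\<gamma> j))\<^sup>2)"
    proof (rule sum_mono)
      fix j assume j: "j \<in> {1..N}"
      show "eps n * (norm (\<gamma> j))\<^sup>2 \<le> eps j * (norm (\<gamma> j))\<^sup>2"
      proof (cases "j < n")
        case True
        then show ?thesis using orth[of j] j by (simp add: \<gamma>_def)
      next
        case False
        then show ?thesis using D(4)[of n j] n by (intro mult_right_mono) auto
      qed
    qed
    also have "\<dots> = Re (ip a (P N) h)"
    proof -
      have "Re (cnj (\<gamma> j) * ip a (u j) h) = eps j * (norm (\<gamma> j))\<^sup>2" if "1 \<le> j" for j
      proof -
        have "cnj (\<gamma> j) * ip a (u j) h = of_real (eps j) * (cnj (\<gamma> j) * \<gamma> j)" using u_h[OF that] by simp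
        then show ?thesis 
          by (simp only: Re_complex_of_real times_complex.sel(1)[of "of_real _"] Im_complex_of_real sq
              mult_zero_left diff_zero)
      qed
      then show ?thesis unfolding P_def ip_lincomb_left[OF uN h_L2] Re_sum by (intro sum.cong refl) simp
    qed
    finally show ?thesis .
  qed
  then have "eps n * Re (ip a \<Phi> \<Phi>) \<le> Re (ip a \<Phi> h)"
    by (intro LIMSEQ_le[OF lim_Phi lim_h] exI[of _ 0]) simp
  also have "ip a \<Phi> h = ip a \<Phi> T + ip a \<Phi> (pot V \<Phi>)"
    unfolding h_def by (rule ip_add_right[OF Phi_L2 T_L2 VPhi_L2])
  also have "ip a \<Phi> T = (\<Sum>G\<in>A. cnj (c G) * (of_real (kinetic k G) * c G))"
    unfolding T_def Phi by (rule ip_lincomb_lincomb[OF pwA A(1)])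
  also have "\<dots> = of_real (\<Sum>G\<in>A. kinetic k G * (norm (c G))\<^sup>2)"
  proof -
    have "cnj z * (of_real r * z) = of_real (r * (norm z)\<^sup>2)" for r z
      by (simp add: complex_norm_square mult_ac del: of_real_power)
    then show ?thesis by (simp only: of_real_sum)
  qed
  finally show ?thesis by (simp add: ip_self)
qed

section \<open>The modified operator\<close>

definition mod_kinetic :: "(real \<Rightarrow> real) \<Rightarrow> real \<Rightarrow> real^'d::finite \<Rightarrow> real^'d \<Rightarrow> real" where
  "mod_kinetic g Ec k G = Ec * g (norm (k + G) / sqrt (2 * Ec))"

lemma blow_up_eq_square: "blow_up_function m g \<Longrightarrow> 0 \<le> x \<Longrightarrow> x \<le> 1/2 \<Longrightarrow> g x = x\<^sup>2"
  unfolding blow_up_function_def by force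

lemma blow_up_ge_square: 
  assumes "blow_up_function m g" "0 \<le> x"
  shows "x\<^sup>2 \<le> g x"
proof (cases "x \<in> {1/2<..<1}")
  case True
  then show ?thesis using assms unfolding blow_up_function_def by force
next
  case False
  then have "\<bar>x\<bar> \<in> {0..1/2} \<union> {1..}" using assms(2) by auto
  then show ?thesis using assms(1) unfolding blow_up_function_def by (metis order_refl)
qed

lemma kinetic_le_mod_kinetic:
  assumes "blow_up_function m g" "Ec > 0"
  shows "kinetic k G \<le> mod_kinetic g Ec k G"
proof -
  have "kinetic k G = Ec * (norm (k + G) / sqrt (2 * Ec))\<^sup>2"
    using assms(2) by (simp add: kinetic_def power_divide)
  also have "\<dots> \<le> mod_kinetic g Ec k G"
    unfolding mod_kinetic_def using assms by (intro mult_left_mono blow_up_ge_square) auto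
  finally show ?thesis .
qed

text \<open>A kinetic energy of at most \<open>Ec / 4\<close> means that the argument of
  \<open>g\<close> is at most \<open>1/2\<close>.\<close>

lemma mod_kinetic_eq_kinetic:
  assumes "blow_up_function m g" "Ec > 0" "kinetic k G \<le> Ec / 4"
  shows "mod_kinetic g Ec k G = kinetic k G"
proof -
  have "(norm (k + G) / sqrt (2 * Ec))\<^sup>2 \<le> (1/2)\<^sup>2"
    using assms by (simp add: kinetic_def power_divide field_simps)
  then have "norm (k + G) / sqrt (2 * Ec) \<le> 1/2" by (rule power2_le_imp_le) simp
  then have "mod_kinetic g Ec k G = Ec * (norm (k + G) / sqrt (2 * Ec))\<^sup>2"
    unfolding mod_kinetic_def using assms by (subst blow_up_eq_square) auto
  then show ?thesis using assms(2) by (simp add: kinetic_def power_divide)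
qed

lemma cutoff_subset: "cutoff b Ec k \<subseteq> zspan b"
  by (auto simp: cutoff_def)

lemma finite_kinetic_le:
  assumes "lattice_bases a b"
  shows "finite {G \<in> zspan b. kinetic k G \<le> E}"
proof (rule finite_subset)
  show "{G \<in> zspan b. kinetic k G \<le> E} \<subseteq> {G \<in> zspan b. norm G \<le> sqrt (2 * E) + norm k}"
  proof safe
    fix G assume "kinetic k G \<le> E"
    then have "norm (k + G) \<le> sqrt (2 * E)" unfolding kinetic_def by (intro real_le_rsqrt) simp
    then show "norm G \<le> sqrt (2 * E) + norm k" using norm_triangle_ineq4[of "k + G" k] by simp
  qed
  show "finite {G \<in> zspan b. norm G \<le> sqrt (2 * E) + norm k}"
    by (rule finite_zspan_bounded[OF lattice_bases_dual[OF assms]])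
qed

lemma finite_cutoff:
  assumes "lattice_bases a b"
  shows "finite (cutoff b Ec k)"
  by (rule finite_subset[OF _ finite_kinetic_le[OF assms, of k Ec]]) (auto simp: cutoff_def kinetic_def)

lemma orthonormal_pw_cutoff:
  "lattice_bases a b \<Longrightarrow> orthonormal_family a (pw a) (cutoff b Ec k)"
  using orthonormal_family_subset[OF orthonormal_pw cutoff_subset] .

lemma Xspace_expansion:
  assumes "lattice_bases a b" "\<Phi> \<in> Xspace a b Ec k"
  shows "\<Phi> = (\<Sum>G\<in>cutoff b Ec k. fscale (fourier a \<Phi> G) (pw a G))"
  using orthonormal_expansion[OF orthonormal_pw_cutoff finite_cutoff] assms
  unfolding fourier_eq_ip Xspace_def by blast

lemma lincomb_in_Xspace:
  assumes "A \<subseteq> cutoff b Ec k"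
  shows "(\<Sum>G\<in>A. fscale (c G) (pw a G)) \<in> Xspace a b Ec k"
  unfolding Xspace_def using assms
  by (intro cfun.span_sum cfun.span_scale cfun.span_base) blast

lemma Xspace_L2cell:
  assumes "lattice_bases a b" "\<Phi> \<in> Xspace a b Ec k"
  shows "\<Phi> \<in> L2cell a"
  by (subst Xspace_expansion[OF assms]) (rule lincomb_L2cell[OF orthonormal_pw_cutoff[OF assms(1)]])

text \<open>Membership of one factor makes Parseval a finite sum over the cutoff.\<close>

lemma ip_Xspace_left:
  assumes "lattice_bases a b" "q \<in> Xspace a b Ec k" "f \<in> L2cell a"
  shows "ip a q f = (\<Sum>G\<in>cutoff b Ec k. cnj (fourier a q G) * fourier a f G)"
proof -
  have "ip a q f = ip a (\<Sum>G\<in>cutoff b Ec k. fscale (fourier a q G) (pw a G)) f"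
    using Xspace_expansion[OF assms(1,2)] by simp
  also have "\<dots> = (\<Sum>G\<in>cutoff b Ec k. cnj (fourier a q G) * ip a (pw a G) f)"
    by (rule ip_lincomb_left[OF orthonormal_pw_cutoff[OF assms(1)] assms(3)])
  finally show ?thesis unfolding fourier_eq_ip .
qed

lemma Mdim_eq_card:
  assumes "lattice_bases a b"
  shows "Mdim a b Ec k = card (cutoff b Ec k)"
proof -
  note v = orthonormal_pw_cutoff[OF assms, of Ec k]
  have "cdim (cspan (pw a ` cutoff b Ec k)) = card (pw a ` cutoff b Ec k)"
    by (rule cfun.dim_span_eq_card_independent[OF orthonormal_independent[OF v]])
  then show ?thesis
    unfolding Mdim_def Xspace_def card_image[OF orthonormal_inj[OF v]] .
qed

text \<open>Evaluates the definite description: testing with plane waves determines the coefficients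
  of any candidate.\<close>

lemma Xproj_eq:
  assumes bases: "lattice_bases a b" and f: "f \<in> L2cell a"
  shows "Xproj a b Ec k f = (\<Sum>G\<in>cutoff b Ec k. fscale (fourier a f G) (pw a G))" (is "_ = ?p")
  unfolding Xproj_def
proof (rule the_equality)
  note v = orthonormal_pw_cutoff[OF bases, of Ec k] and fin = finite_cutoff[OF bases, of Ec k]
  have p: "?p \<in> Xspace a b Ec k" by (intro lincomb_in_Xspace order_refl)
  have p_L2: "?p \<in> L2cell a" by (rule Xspace_L2cell[OF bases p])
  have *: "fourier a (f - p') G = fourier a f G - fourier a p' G" if "p' \<in> L2cell a" for p' G
    unfolding fourier_eq_ip by (rule ip_diff_right[OF pw_L2cell[OF bases] f that])
  have "fourier a (f - ?p) G = 0" if "G \<in> cutoff b Ec k" for G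
    unfolding *[OF p_L2] using ip_basis_lincomb[OF v fin that, of "fourier a f"] 
    by (simp only: fourier_eq_ip diff_self)
  then have "ip a q (f - ?p) = 0" if "q \<in> Xspace a b Ec k" for q
    unfolding ip_Xspace_left[OF bases that L2cell_diff[OF f p_L2]] by (intro sum.neutral ballI) (simp only: mult_zero_right)
  with p show "?p \<in> Xspace a b Ec k \<and> (\<forall>q\<in>Xspace a b Ec k. ip a q (f - ?p) = 0)" by blast
  fix p' assume p': "p' \<in> Xspace a b Ec k \<and> (\<forall>q\<in>Xspace a b Ec k. ip a q (f - p') = 0)"
  then have p'_L2: "p' \<in> L2cell a" using Xspace_L2cell[OF bases] by blast
  have "fourier a p' G = fourier a f G" if G: "G \<in> cutoff b Ec k" for G
  proof -
    have "pw a G \<in> Xspace a b Ec k" unfolding Xspace_def using G by (intro cfun.span_base) blast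
    then have "fourier a (f - p') G = 0" unfolding fourier_eq_ip using p' by blast
    then show ?thesis unfolding *[OF p'_L2] by simp
  qed
  then have "(\<Sum>G\<in>cutoff b Ec k. fscale (fourier a p' G) (pw a G)) = ?p" by (intro sum.cong refl) (simp only:)
  with Xspace_expansion[OF bases] p' show "p' = ?p" by metis
qed

lemma modified_op_eq:
  assumes bases: "lattice_bases a b" and V: "bounded_potential V B" and \<Phi>: "\<Phi> \<in> Xspace a b Ec k"
  shows "modified_op a b V g Ec k \<Phi> = (\<Sum>G\<in>cutoff b Ec k.
     fscale (of_real (mod_kinetic g Ec k G) * fourier a \<Phi> G + fourier a (pot V \<Phi>) G) (pw a G))"
proof -
  have "Xproj a b Ec k (pot V \<Phi>) = (\<Sum>G\<in>cutoff b Ec k. fscale (fourier a (pot V \<Phi>) G) (pw a G))"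
    by (intro Xproj_eq[OF bases] pot_bounds[OF V] Xspace_L2cell[OF bases \<Phi>])
  then show ?thesis
    unfolding modified_op_def pot_def mod_kinetic_def
    by (simp only: cfun.scale_left_distrib sum.distrib)
qed

lemma modified_op_in_Xspace:
  assumes bases: "lattice_bases a b" and V: "bounded_potential V B" and \<Phi>: "\<Phi> \<in> Xspace a b Ec k"
  shows "modified_op a b V g Ec k \<Phi> \<in> Xspace a b Ec k"
  unfolding modified_op_eq[OF assms] by (intro lincomb_in_Xspace order_refl)

lemma ip_modified_op:
  assumes bases: "lattice_bases a b" and V: "bounded_potential V B"
    and q: "q \<in> Xspace a b Ec k" and \<Phi>: "\<Phi> \<in> Xspace a b Ec k"
  shows "ip a q (modified_op a b V g Ec k \<Phi>) =
     (\<Sum>G\<in>cutoff b Ec k. of_real (mod_kinetic g Ec k G) * (cnj (fourier a q G) * fourier a \<Phi> G))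
     + ip a q (pot V \<Phi>)"
proof -
  let ?H = "modified_op a b V g Ec k \<Phi>"
  have "fourier a ?H G = of_real (mod_kinetic g Ec k G) * fourier a \<Phi> G + fourier a (pot V \<Phi>) G"
    if "G \<in> cutoff b Ec k" for G
    unfolding modified_op_eq[OF bases V \<Phi>] fourier_eq_ip[of a "sum _ _"]
    by (rule ip_basis_lincomb[OF orthonormal_pw_cutoff[OF bases] finite_cutoff[OF bases] that])
  then have "ip a q ?H = (\<Sum>G\<in>cutoff b Ec k. cnj (fourier a q G) *
      (of_real (mod_kinetic g Ec k G) * fourier a \<Phi> G + fourier a (pot V \<Phi>) G))"
    unfolding ip_Xspace_left[OF bases q Xspace_L2cell[OF bases modified_op_in_Xspace[OF bases V \<Phi>]]]
    by (intro sum.cong refl) (simp only:)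
  also have "\<dots> = (\<Sum>G\<in>cutoff b Ec k. of_real (mod_kinetic g Ec k G) * (cnj (fourier a q G) * fourier a \<Phi> G))
     + (\<Sum>G\<in>cutoff b Ec k. cnj (fourier a q G) * fourier a (pot V \<Phi>) G)"
    by (simp only: distrib_left sum.distrib mult.left_commute)
  also have "(\<Sum>G\<in>cutoff b Ec k. cnj (fourier a q G) * fourier a (pot V \<Phi>) G) = ip a q (pot V \<Phi>)"
    by (rule ip_Xspace_left[OF bases q pot_bounds(1)[OF V Xspace_L2cell[OF bases \<Phi>]], symmetric])
  finally show ?thesis .
qed

lemma modified_op_symmetric:
  assumes bases: "lattice_bases a b" and V: "bounded_potential V B"
    and q: "q \<in> Xspace a b Ec k" and \<Phi>: "\<Phi> \<in> Xspace a b Ec k"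
  shows "ip a q (modified_op a b V g Ec k \<Phi>) = cnj (ip a \<Phi> (modified_op a b V g Ec k q))"
proof -
  have "ip a q (pot V \<Phi>) = cnj (ip a \<Phi> (pot V q))"
    unfolding ip_pot_commute[symmetric, of a q] by (rule ip_commute)
  then show ?thesis
    unfolding ip_modified_op[OF bases V q \<Phi>] ip_modified_op[OF bases V \<Phi> q]
    by (simp add: mult_ac)
qed

lemma Re_ip_modified_op:
  assumes bases: "lattice_bases a b" and V: "bounded_potential V B" and \<Phi>: "\<Phi> \<in> Xspace a b Ec k"
  shows "Re (ip a \<Phi> (modified_op a b V g Ec k \<Phi>)) =
     (\<Sum>G\<in>cutoff b Ec k. mod_kinetic g Ec k G * (norm (fourier a \<Phi> G))\<^sup>2) + Re (ip a \<Phi> (pot V \<Phi>))"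
proof -
  have "Re (of_real r * (cnj z * z)) = r * (norm z)\<^sup>2" for r z
    by (simp add: cmod_def power2_eq_square)
  then show ?thesis unfolding ip_modified_op[OF bases V \<Phi> \<Phi>] by (simp only: plus_complex.sel Re_sum)
qed

text \<open>An orthonormal subset of largest cardinality spans \<open>S\<close>, since a
  Gram-Schmidt step would enlarge it otherwise.\<close>

lemma exists_orthonormal_basis:
  assumes S: "cfun.subspace S" "S \<subseteq> L2cell a" "S \<subseteq> cspan T" "finite T"
    and definite: "\<And>f. f \<in> S \<Longrightarrow> L2norm a f = 0 \<Longrightarrow> f = 0"
  shows "\<exists>Q. Q \<subseteq> S \<and> finite Q \<and> card Q = cdim S \<and> orthonormal_family a (\<lambda>x. x) Q"
proof -
  define P where "P Q \<longleftrightarrow> Q \<subseteq> S \<and> orthonormal_family a (\<lambda>x. x) Q" for Q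
  have P_card: "finite Q \<and> card Q \<le> card T \<and> cfun.independent Q" if "P Q" for Q
  proof -
    have "cfun.independent Q" using orthonormal_independent[of a "\<lambda>x. x" Q] that by (simp add: P_def)
    moreover have "Q \<subseteq> cspan T" using that S(3) by (auto simp: P_def)
    ultimately show ?thesis using cfun.independent_span_bound[OF S(4)] by blast
  qed
  have "P {}" by (simp add: P_def orthonormal_family_def)
  moreover have "\<forall>Q. P Q \<longrightarrow> card Q < card T + 1" using P_card by (simp add: less_Suc_eq_le)
  ultimately have "\<exists>Q. P Q \<and> (\<forall>Q'. P Q' \<longrightarrow> card Q' \<le> card Q)" by (rule ex_has_greatest_nat)
  then obtain Q where Q: "P Q" and max: "\<And>Q'. P Q' \<Longrightarrow> card Q' \<le> card Q" by blast
  have Qfin: "finite Q" using P_card[OF Q] by blast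
  have QS: "Q \<subseteq> S" and Qo: "orthonormal_family a (\<lambda>x. x) Q" using Q by (simp_all add: P_def)
  have "S \<subseteq> cspan Q"
  proof (rule ccontr)
    assume "\<not> S \<subseteq> cspan Q"
    then obtain f where f: "f \<in> S" "f \<notin> cspan Q" by blast
    define p where "p = (\<Sum>q\<in>Q. fscale (ip a q f) q)"
    define w where "w = f - p"
    have pQ: "p \<in> cspan Q" unfolding p_def by (intro cfun.span_sum cfun.span_scale cfun.span_base)
    have p_S: "p \<in> S" using pQ cfun.span_minimal[OF QS S(1)] by blast
    have w_S: "w \<in> S" unfolding w_def by (rule cfun.subspace_diff[OF S(1) f(1) p_S])
    have "w \<noteq> 0" using f(2) pQ unfolding w_def by (metis right_minus_eq)
    then have N: "L2norm a w \<noteq> 0" using definite[OF w_S] by blast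
    have L2: "f \<in> L2cell a" "p \<in> L2cell a" "w \<in> L2cell a" using f p_S w_S S(2) by blast+
    have qw: "ip a q w = 0" if "q \<in> Q" for q
    proof -
      have "ip a q w = ip a q f - ip a q p"
        unfolding w_def by (intro ip_diff_right L2 orthonormal_familyD(1)[OF Qo that])
      also have "ip a q p = ip a q f"
        unfolding p_def by (rule ip_basis_lincomb[OF Qo Qfin that])
      finally show ?thesis by simp
    qed
    define z where "z = fscale (of_real (1 / L2norm a w)) w"
    have z_S: "z \<in> S" unfolding z_def by (rule cfun.subspace_scale[OF S(1) w_S])
    have "L2norm a z = 1" unfolding z_def L2norm_scale norm_of_real using N by simp
    then have zz: "ip a z z = 1" unfolding ip_self by simp
    have qz: "ip a q z = 0" "ip a z q = 0" if "q \<in> Q" for q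
    proof -
      show "ip a q z = 0" unfolding z_def ip_scale_right qw[OF that] by simp
      then show "ip a z q = 0" by (subst ip_commute) simp
    qed
    have "z \<notin> Q" using qz zz by force
    have "orthonormal_family a (\<lambda>x. x) (insert z Q)"
      unfolding orthonormal_family_def using Qo zz qz \<open>z \<notin> Q\<close> z_S S(2)
      unfolding orthonormal_family_def by auto
    then have "P (insert z Q)" using z_S QS by (simp add: P_def)
    from max[OF this] show False using Qfin \<open>z \<notin> Q\<close> by simp
  qed
  then have "cdim S = card Q" using P_card[OF Q] QS by (intro cfun.dim_unique[of Q]) auto
  with QS Qfin Qo show ?thesis by auto
qed

text \<open>Trigonometric polynomials are determined by their Fourier coefficients, so on them the
  seminorm is a norm.\<close>

lemma Xspace_definite:
  assumes bases: "lattice_bases a b" and f: "f \<in> Xspace a b Ec k" "L2norm a f = 0"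
  shows "f = 0"
proof -
  have f_L2: "f \<in> L2cell a" by (rule Xspace_L2cell[OF bases f(1)])
  have "fourier a f G = 0" for G
  proof -
    have "norm (fourier a f G) \<le> L2norm a (pw a G) * L2norm a f"
      unfolding fourier_eq_ip by (rule ip_Cauchy_Schwarz[OF pw_L2cell[OF bases] f_L2])
    then show ?thesis using f(2) by simp
  qed
  then have "(\<Sum>G\<in>cutoff b Ec k. fscale (fourier a f G) (pw a G)) = 0"
    by (intro sum.neutral ballI) (simp only: cfun.scale_zero_left)
  then show ?thesis using Xspace_expansion[OF bases f(1)] by metis
qed

lemma modified_op_add:
  assumes bases: "lattice_bases a b" and V: "bounded_potential V B"
    and f: "f \<in> Xspace a b Ec k" and h: "h \<in> Xspace a b Ec k"
  shows "modified_op a b V g Ec k (f + h) = modified_op a b V g Ec k f + modified_op a b V g Ec k h"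
proof -
  note L2 = Xspace_L2cell[OF bases f] Xspace_L2cell[OF bases h]
  have fh: "f + h \<in> Xspace a b Ec k" using f h unfolding Xspace_def by (rule cfun.span_add)
  have pot: "pot V (f + h) = pot V f + pot V h" by (simp add: pot_def fun_eq_iff distrib_left)
  have "fourier a (f + h) G = fourier a f G + fourier a h G" for G
    unfolding fourier_eq_ip by (intro ip_add_right pw_L2cell[OF bases] L2)
  moreover have "fourier a (pot V (f + h)) G = fourier a (pot V f) G + fourier a (pot V h) G" for G
    unfolding fourier_eq_ip pot by (intro ip_add_right pw_L2cell[OF bases] pot_bounds(1)[OF V] L2)
  ultimately show ?thesis
    unfolding modified_op_eq[OF bases V f] modified_op_eq[OF bases V h] modified_op_eq[OF bases V fh]
      sum.distrib[symmetric] cfun.scale_left_distrib[symmetric]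
    by (intro sum.cong refl arg_cong2[where f = fscale]) (simp add: algebra_simps)
qed

lemma modified_op_scale:
  assumes bases: "lattice_bases a b" and V: "bounded_potential V B" and f: "f \<in> Xspace a b Ec k"
  shows "modified_op a b V g Ec k (fscale c f) = fscale c (modified_op a b V g Ec k f)"
proof -
  have cf: "fscale c f \<in> Xspace a b Ec k" using f unfolding Xspace_def by (rule cfun.span_scale)
  have pot: "pot V (fscale c f) = fscale c (pot V f)" by (simp add: pot_def fun_eq_iff)
  have "fourier a (fscale c f) G = c * fourier a f G" for f G
    unfolding fourier_eq_ip by (rule ip_scale_right)
  then show ?thesis
    unfolding modified_op_eq[OF bases V f] modified_op_eq[OF bases V cf] pot
      cfun.scale_sum_right cfun.scale_scale
    by (intro sum.cong refl arg_cong2[where f = fscale]) (simp add: algebra_simps)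
qed

lemma subspace_modified_eigenspace:
  assumes bases: "lattice_bases a b" and V: "bounded_potential V B"
  shows "cfun.subspace {\<Phi> \<in> Xspace a b Ec k. modified_op a b V g Ec k \<Phi> = fscale \<mu> \<Phi>}" (is "cfun.subspace ?E")
proof (rule cfun.subspaceI)
  have X0: "0 \<in> Xspace a b Ec k" unfolding Xspace_def by (rule cfun.span_zero)
  have "modified_op a b V g Ec k (fscale 0 0) = fscale 0 (modified_op a b V g Ec k 0)"
    by (rule modified_op_scale[OF bases V X0])
  then have "modified_op a b V g Ec k 0 = 0" unfolding cfun.scale_zero_left .
  then show "0 \<in> ?E" using X0 by (simp only: mem_Collect_eq cfun.scale_zero_right simp_thms)
  fix f h assume f: "f \<in> ?E" and h: "h \<in> ?E"
  then have "f + h \<in> Xspace a b Ec k" unfolding Xspace_def using cfun.span_add by blast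
  moreover have "modified_op a b V g Ec k (f + h) = fscale \<mu> (f + h)"
    using modified_op_add[OF bases V, of f Ec k h g] f h by (simp only: mem_Collect_eq cfun.scale_right_distrib simp_thms)
  ultimately show "f + h \<in> ?E" by blast
next
  fix c f assume f: "f \<in> ?E"
  then have "fscale c f \<in> Xspace a b Ec k" unfolding Xspace_def using cfun.span_scale by blast
  moreover have "modified_op a b V g Ec k (fscale c f) = fscale \<mu> (fscale c f)"
    using modified_op_scale[OF bases V, of f Ec k g c] f by (simp only: mem_Collect_eq cfun.scale_left_commute simp_thms)
  ultimately show "fscale c f \<in> ?E" by blast
qed

text \<open>The multiplicity of each value of \<open>e\<close> is the dimension of the eigenspace,
  so orthonormal bases of the eigenspaces can be numbered in accordance with \<open>e\<close>.
  Symmetry of the operator makes different eigenspaces orthogonal.\<close>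

lemma modified_eigenbasis_exists:
  assumes bases: "lattice_bases a b" and V: "bounded_potential V B"
    and me: "modified_eigenvalues a b V g Ec k e"
  obtains \<phi> where "orthonormal_family a \<phi> {1..Mdim a b Ec k}"
    and "\<And>j. j \<in> {1..Mdim a b Ec k} \<Longrightarrow> \<phi> j \<in> Xspace a b Ec k"
    and "\<And>j. j \<in> {1..Mdim a b Ec k} \<Longrightarrow> modified_op a b V g Ec k (\<phi> j) = fscale (of_real (e j)) (\<phi> j)"
proof -
  let ?M = "Mdim a b Ec k" and ?X = "Xspace a b Ec k" and ?H = "modified_op a b V g Ec k"
  define E where "E \<mu> = {\<Phi> \<in> ?X. ?H \<Phi> = fscale (of_real \<mu>) \<Phi>}" for \<mu> :: real
  have "\<exists>Q. Q \<subseteq> E \<mu> \<and> finite Q \<and> card Q = cdim (E \<mu>) \<and> orthonormal_family a (\<lambda>x. x) Q" for \<mu>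
  proof (rule exists_orthonormal_basis)
    show "cfun.subspace (E \<mu>)" unfolding E_def by (rule subspace_modified_eigenspace[OF bases V])
    show "E \<mu> \<subseteq> L2cell a" unfolding E_def using Xspace_L2cell[OF bases] by blast
    show "E \<mu> \<subseteq> cspan (pw a ` cutoff b Ec k)" unfolding E_def Xspace_def by blast
    show "finite (pw a ` cutoff b Ec k)" by (intro finite_imageI finite_cutoff[OF bases])
    show "f = 0" if "f \<in> E \<mu>" "L2norm a f = 0" for f
      using that Xspace_definite[OF bases] unfolding E_def by blast
  qed
  then obtain Q where Q: "\<And>\<mu>. Q \<mu> \<subseteq> E \<mu>" "\<And>\<mu>. finite (Q \<mu>)" "\<And>\<mu>. card (Q \<mu>) = cdim (E \<mu>)"
    "\<And>\<mu>. orthonormal_family a (\<lambda>x. x) (Q \<mu>)" by metis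
  have "\<exists>h. bij_betw h {j \<in> {1..?M}. e j = \<mu>} (Q \<mu>)" for \<mu>
    using me Q(2,3) by (intro finite_same_card_bij) (auto simp: modified_eigenvalues_def E_def)
  then obtain h where h: "\<And>\<mu>. bij_betw (h \<mu>) {j \<in> {1..?M}. e j = \<mu>} (Q \<mu>)" by metis
  define \<phi> where "\<phi> j = h (e j) j" for j
  have \<phi>Q: "\<phi> j \<in> Q (e j)" if "j \<in> {1..?M}" for j
    using bij_betwE[OF h[of "e j"]] that by (simp add: \<phi>_def)
  have \<phi>E: "\<phi> j \<in> ?X" "?H (\<phi> j) = fscale (of_real (e j)) (\<phi> j)" if "j \<in> {1..?M}" for j
    using \<phi>Q[OF that] Q(1)[of "e j"] unfolding E_def by blast+
  have "ip a (\<phi> i) (\<phi> j) = (if i = j then 1 else 0)" if ij: "i \<in> {1..?M}" "j \<in> {1..?M}" for i j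
  proof (cases "e i = e j")
    case True
    have "\<phi> i = \<phi> j \<longleftrightarrow> i = j"
      using bij_betw_imp_inj_on[OF h[of "e j"]] ij True unfolding \<phi>_def inj_on_def by auto
    moreover have "\<phi> i \<in> Q (e j)" "\<phi> j \<in> Q (e j)" using \<phi>Q[OF ij(1)] \<phi>Q[OF ij(2)] True by auto
    ultimately show ?thesis using Q(4)[of "e j"] unfolding orthonormal_family_def by auto
  next
    case False
    have "ip a (\<phi> i) (?H (\<phi> j)) = cnj (ip a (\<phi> j) (?H (\<phi> i)))"
      by (rule modified_op_symmetric[OF bases V \<phi>E(1)[OF ij(1)] \<phi>E(1)[OF ij(2)]])
    then have "of_real (e j) * ip a (\<phi> i) (\<phi> j) = of_real (e i) * ip a (\<phi> i) (\<phi> j)"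
      unfolding \<phi>E(2)[OF ij(1)] \<phi>E(2)[OF ij(2)] ip_scale_right
      using ip_commute[of a "\<phi> i" "\<phi> j"] by simp
    then have "ip a (\<phi> i) (\<phi> j) = 0" using False by simp
    then show ?thesis using False by auto
  qed
  then have "orthonormal_family a \<phi> {1..?M}"
    unfolding orthonormal_family_def using Xspace_L2cell[OF bases] \<phi>E(1) by blast
  then show ?thesis using \<phi>E that by blast
qed

text \<open>Otherwise some element of the space would enlarge the family to an independent set with
  more elements than \<open>T\<close>.\<close>

lemma orthonormal_family_spans:
  assumes v: "orthonormal_family a v I" "v ` I \<subseteq> cspan T" and T: "finite T" "card T \<le> card I" "finite I"
  shows "cspan T \<subseteq> cspan (v ` I)"
proof
  fix f assume f: "f \<in> cspan T"
  show "f \<in> cspan (v ` I)"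
  proof (rule ccontr)
    assume n: "f \<notin> cspan (v ` I)"
    then have "cfun.independent (insert f (v ` I))"
      by (intro cfun.independent_insertI orthonormal_independent[OF v(1)])
    moreover have "insert f (v ` I) \<subseteq> cspan T" using f v(2) by blast
    ultimately have "card (insert f (v ` I)) \<le> card T"
      using cfun.independent_span_bound[OF T(1)] by blast
    moreover have "f \<notin> v ` I" using n cfun.span_base[of f "v ` I"] by metis
    ultimately show False using T card_image[OF orthonormal_inj[OF v(1)]] by simp
  qed
qed

lemma modified_eigenbasis_energy:
  assumes bases: "lattice_bases a b" and V: "bounded_potential V B"
    and \<phi>: "orthonormal_family a \<phi> {1..Mdim a b Ec k}"
      "\<And>j. j \<in> {1..Mdim a b Ec k} \<Longrightarrow> \<phi> j \<in> Xspace a b Ec k"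
      "\<And>j. j \<in> {1..Mdim a b Ec k} \<Longrightarrow> modified_op a b V g Ec k (\<phi> j) = fscale (of_real (e j)) (\<phi> j)"
    and \<Psi>: "\<Psi> \<in> Xspace a b Ec k"
  shows "(L2norm a \<Psi>)\<^sup>2 = (\<Sum>j=1..Mdim a b Ec k. (norm (ip a (\<phi> j) \<Psi>))\<^sup>2)"
    and "Re (ip a \<Psi> (modified_op a b V g Ec k \<Psi>)) = (\<Sum>j=1..Mdim a b Ec k. e j * (norm (ip a (\<phi> j) \<Psi>))\<^sup>2)"
proof -
  let ?M = "Mdim a b Ec k" and ?H = "modified_op a b V g Ec k"
  have "card (pw a ` cutoff b Ec k) \<le> card {1..?M}"
    unfolding Mdim_eq_card[OF bases] by (simp add: card_image_le finite_cutoff[OF bases])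
  then have "Xspace a b Ec k \<subseteq> cspan (\<phi> ` {1..?M})"
    unfolding Xspace_def using \<phi>(2)
    by (intro orthonormal_family_spans[OF \<phi>(1)] finite_imageI finite_cutoff[OF bases]) (auto simp: Xspace_def)
  then have "\<Psi> \<in> cspan (\<phi> ` {1..?M})" using \<Psi> by blast
  note exp = orthonormal_expansion[OF \<phi>(1) finite_atLeastAtMost this]
  show "(L2norm a \<Psi>)\<^sup>2 = (\<Sum>j=1..?M. (norm (ip a (\<phi> j) \<Psi>))\<^sup>2)"
    using L2norm_lincomb[OF \<phi>(1) finite_atLeastAtMost, of "\<lambda>j. ip a (\<phi> j) \<Psi>"] exp by simp
  have H_L2: "?H \<Psi> \<in> L2cell a" by (rule Xspace_L2cell[OF bases modified_op_in_Xspace[OF bases V \<Psi>]])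
  have "ip a (\<phi> j) (?H \<Psi>) = of_real (e j) * ip a (\<phi> j) \<Psi>" if j: "j \<in> {1..?M}" for j
    unfolding modified_op_symmetric[OF bases V \<phi>(2)[OF j] \<Psi>] \<phi>(3)[OF j] ip_scale_right
    using ip_commute[of a "\<phi> j" \<Psi>] by simp
  then have "(\<Sum>j=1..?M. cnj (ip a (\<phi> j) \<Psi>) * ip a (\<phi> j) (?H \<Psi>))
      = (\<Sum>j=1..?M. cnj (ip a (\<phi> j) \<Psi>) * (of_real (e j) * ip a (\<phi> j) \<Psi>))"
    by (intro sum.cong refl) (simp only:)
  moreover have "ip a \<Psi> (?H \<Psi>) = (\<Sum>j=1..?M. cnj (ip a (\<phi> j) \<Psi>) * ip a (\<phi> j) (?H \<Psi>))"
    using ip_lincomb_left[OF \<phi>(1) H_L2, of "\<lambda>j. ip a (\<phi> j) \<Psi>"] exp by simp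
  moreover have "Re (cnj z * (of_real r * z)) = r * (norm z)\<^sup>2" for r z
    by (simp add: cmod_def power2_eq_square algebra_simps)
  ultimately show "Re (ip a \<Psi> (?H \<Psi>)) = (\<Sum>j=1..?M. e j * (norm (ip a (\<phi> j) \<Psi>))\<^sup>2)"
    by (simp only: Re_sum)
qed

section \<open>Bounds uniform in the quasi-momentum\<close>

text \<open>The point \<open>- k\<close> is within the covering radius of some reciprocal lattice
  vector; take this one and its first translates along one basis vector. As the radius is independent
  of \<open>k\<close>, these waves give the bounds that hold uniformly in \<open>k\<close>: for the
  exact eigenvalues from above, and for the dimension of the discretization space from below.\<close>

lemma plane_waves_near:
  assumes bases: "lattice_bases (a :: 'd::finite \<Rightarrow> real^'d) b"
  shows "\<exists>R. \<forall>k. \<exists>A\<subseteq>zspan b. finite A \<and> card A = n \<and> (\<forall>G\<in>A. norm (k + G) \<le> R)"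
proof -
  define \<beta> where "\<beta> = b undefined"
  have "\<beta> \<noteq> 0" using lattice_bases_inner[OF bases, of undefined undefined] by (auto simp: \<beta>_def)
  let ?\<rho> = "\<Sum>i\<in>UNIV. norm (b i)"
  have "\<exists>A\<subseteq>zspan b. finite A \<and> card A = n \<and> (\<forall>G\<in>A. norm (k + G) \<le> ?\<rho> + real n * norm \<beta>)" for k
  proof -
    obtain G0 where G0: "G0 \<in> zspan b" "norm (- k - G0) \<le> ?\<rho>"
      using zspan_covering_radius[OF lattice_bases_dual[OF bases]] by blast
    define A where "A = (\<lambda>m :: nat. G0 + real m *\<^sub>R \<beta>) ` {..<n}"
    have "inj_on (\<lambda>m :: nat. G0 + real m *\<^sub>R \<beta>) {..<n}" using \<open>\<beta> \<noteq> 0\<close> by (auto intro!: inj_onI)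
    then have "card A = n" unfolding A_def by (simp add: card_image)
    moreover have "A \<subseteq> zspan b"
      unfolding A_def \<beta>_def using G0(1) by (auto intro!: zspan_add zspan_scale_nat zspan_base)
    moreover have "norm (k + G) \<le> ?\<rho> + real n * norm \<beta>" if G: "G \<in> A" for G
    proof -
      obtain m where m: "m < n" "G = G0 + real m *\<^sub>R \<beta>" using G by (auto simp: A_def)
      have "norm (k + G) = norm ((k + G0) + real m *\<^sub>R \<beta>)" unfolding m(2) by (simp only: add.assoc)
      also have "\<dots> \<le> norm (k + G0) + norm (real m *\<^sub>R \<beta>)" by (rule norm_triangle_ineq)
      also have "norm (k + G0) = norm (- k - G0)" by (metis add_uminus_conv_diff minus_add_distrib norm_minus_cancel)
      also have "norm (real m *\<^sub>R \<beta>) \<le> real n * norm \<beta>" using m(1) by (simp add: mult_right_mono)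
      finally show ?thesis using G0(2) by linarith
    qed
    ultimately show ?thesis unfolding A_def by blast
  qed
  then show ?thesis by blast
qed

lemma fiber_eigenvalue_upper_bound:
  assumes bases: "lattice_bases a b" and V: "bounded_potential V B" and n: "1 \<le> n"
  shows "\<exists>\<Lambda>. \<forall>k eps u. fiber_eigenbasis a b V k eps u \<longrightarrow> eps n \<le> \<Lambda>"
proof -
  obtain R where R: "\<And>k. \<exists>A\<subseteq>zspan b. finite A \<and> card A = n \<and> (\<forall>G\<in>A. norm (k + G) \<le> R)"
    using plane_waves_near[OF bases] by blast
  have "eps n \<le> R\<^sup>2 / 2 + B" if eb: "fiber_eigenbasis a b V k eps u" for k eps u
  proof -
    obtain A where A: "A \<subseteq> zspan b" "finite A" "card A = n" "\<And>G. G \<in> A \<Longrightarrow> norm (k + G) \<le> R"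
      using R[of k] by blast
    have card: "card {1..<n} < card A" using A(3) n by simp
    have u: "u j \<in> L2cell a" if "j \<in> {1..<n}" for j
      using fiber_eigenbasisD(1)[OF bases eb] that by simp
    have "\<exists>c. (\<exists>G\<in>A. c G \<noteq> 0) \<and>
        (\<forall>j\<in>{1..<n}. ip a (u j) (\<Sum>G\<in>A. fscale (c G) (pw a G)) = 0)"
      by (rule orthogonal_combination[OF finite_atLeastLessThan A(2) card u pw_L2cell[OF bases]])
    then obtain c where c: "\<exists>G\<in>A. c G \<noteq> 0"
      and orth: "\<And>j. j \<in> {1..<n} \<Longrightarrow> ip a (u j) (\<Sum>G\<in>A. fscale (c G) (pw a G)) = 0"
      by blast
    define \<Phi> where "\<Phi> = (\<Sum>G\<in>A. fscale (c G) (pw a G))"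
    have pwA: "orthonormal_family a (pw a) A"
      using orthonormal_family_subset[OF orthonormal_pw[OF bases] A(1)] .
    have norm: "(L2norm a \<Phi>)\<^sup>2 = (\<Sum>G\<in>A. (norm (c G))\<^sup>2)"
      unfolding \<Phi>_def by (rule L2norm_lincomb[OF pwA A(2)])
    have pos: "0 < (L2norm a \<Phi>)\<^sup>2"
      unfolding \<Phi>_def by (rule lincomb_norm_pos[OF pwA A(2) c])
    have \<Phi>_L2: "\<Phi> \<in> L2cell a" unfolding \<Phi>_def by (rule lincomb_L2cell[OF pwA])
    have "eps n * (L2norm a \<Phi>)\<^sup>2 \<le> (\<Sum>G\<in>A. kinetic k G * (norm (c G))\<^sup>2) + Re (ip a \<Phi> (pot V \<Phi>))"
      using orth by (intro fiber_lower_bound[OF bases V eb n A(2,1) \<Phi>_def]) (auto simp: \<Phi>_def)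
    also have "(\<Sum>G\<in>A. kinetic k G * (norm (c G))\<^sup>2) \<le> (\<Sum>G\<in>A. R\<^sup>2 / 2 * (norm (c G))\<^sup>2)"
      unfolding kinetic_def using A(4) by (intro sum_mono mult_right_mono divide_right_mono power_mono) auto
    also have "\<dots> = R\<^sup>2 / 2 * (L2norm a \<Phi>)\<^sup>2" by (simp add: norm sum_distrib_left)
    also have "Re (ip a \<Phi> (pot V \<Phi>)) \<le> B * (L2norm a \<Phi>)\<^sup>2"
      using ip_pot_bound[OF V \<Phi>_L2 \<Phi>_L2] complex_Re_le_cmod[of "ip a \<Phi> (pot V \<Phi>)"]
      by (simp add: power2_eq_square mult.assoc)
    finally have "eps n * (L2norm a \<Phi>)\<^sup>2 \<le> (R\<^sup>2 / 2 + B) * (L2norm a \<Phi>)\<^sup>2"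
      by (simp add: distrib_right)
    then show ?thesis using pos by (rule mult_right_le_imp_le)
  qed
  then show ?thesis by blast
qed

text \<open>Parseval applied to the pairing of \<open>f\<close> with its image \<open>h\<close>
  under the operator, minus the potential energy.\<close>

lemma kinetic_energy_has_sum:
  assumes bases: "lattice_bases a b" and V: "bounded_potential V B"
    and f: "f \<in> L2cell a" and h: "h \<in> L2cell a"
    and H: "\<And>G. G \<in> zspan b \<Longrightarrow> fourier a h G = of_real (kinetic k G) * fourier a f G + fourier a (pot V f) G"
  shows "((\<lambda>G. kinetic k G * (norm (fourier a f G))\<^sup>2) has_sum (Re (ip a f h) - Re (ip a f (pot V f)))) (zspan b)"
proof -
  have "((\<lambda>G. cnj (fourier a f G) * fourier a h G - cnj (fourier a f G) * fourier a (pot V f) G)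
      has_sum (ip a f h - ip a f (pot V f))) (zspan b)"
    using has_sum_add[OF parseval_ip[OF bases f h] has_sum_cmult_right[OF parseval_ip[OF bases f pot_bounds(1)[OF V f]], of "- 1"]]
    by simp
  then have "((\<lambda>G. Re (cnj (fourier a f G) * fourier a h G - cnj (fourier a f G) * fourier a (pot V f) G))
      has_sum Re (ip a f h - ip a f (pot V f))) (zspan b)"
    by (rule has_sum_Re)
  moreover have "Re (cnj (fourier a f G) * fourier a h G - cnj (fourier a f G) * fourier a (pot V f) G)
      = kinetic k G * (norm (fourier a f G))\<^sup>2" if "G \<in> zspan b" for G
    unfolding H[OF that] by (simp add: cmod_def power2_eq_square algebra_simps)
  ultimately have "((\<lambda>G. kinetic k G * (norm (fourier a f G))\<^sup>2) has_sum Re (ip a f h - ip a f (pot V f))) (zspan b)"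
    by (simp cong: has_sum_cong)
  then show ?thesis by (simp only: minus_complex.sel)
qed

lemma fiber_eigenvalue_lower_bound:
  assumes bases: "lattice_bases a b" and V: "bounded_potential V B"
    and eb: "fiber_eigenbasis a b V k eps u" and j: "1 \<le> j"
  shows "- B \<le> eps j"
proof -
  note D = fiber_eigenbasisD[OF bases eb]
  have u: "u j \<in> L2cell a" by (rule D(1)[OF j])
  have uu: "ip a (u j) (u j) = 1"
    using D(2)[of "{j}"] j by (simp add: orthonormal_family_def)
  then have norm: "L2norm a (u j) = 1"
    unfolding ip_self by (simp add: power2_eq_1_iff del: of_real_power) (smt (verit) L2norm_nonneg)
  have "fourier a (fscale (of_real (eps j)) (u j)) G = of_real (kinetic k G) * fourier a (u j) G + fourier a (pot V (u j)) G"
    if "G \<in> zspan b" for G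
    using D(3)[OF j that] unfolding fourier_eq_ip ip_scale_right .
  from has_sum_nonneg[OF kinetic_energy_has_sum[OF bases V u L2cell_scale[OF u] this]]
  have "0 \<le> Re (ip a (u j) (fscale (of_real (eps j)) (u j))) - Re (ip a (u j) (pot V (u j)))" by simp
  also have "ip a (u j) (fscale (of_real (eps j)) (u j)) = of_real (eps j)"
    unfolding ip_scale_right uu by simp
  finally have "Re (ip a (u j) (pot V (u j))) \<le> eps j" by simp
  moreover have "- Re (ip a (u j) (pot V (u j))) \<le> B"
    using ip_pot_bound[OF V u u] abs_Re_le_cmod[of "ip a (u j) (pot V (u j))"] norm by simp
  ultimately show ?thesis by simp
qed

lemma has_sum_le_of_finite_sums:
  fixes f :: "'a \<Rightarrow> real"
  assumes "(f has_sum x) A" "\<And>F. finite F \<Longrightarrow> F \<subseteq> A \<Longrightarrow> sum f F \<le> y"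
  shows "x \<le> y"
proof -
  have "(sum f \<longlongrightarrow> x) (finite_subsets_at_top A)" using assms(1) by (simp add: has_sum_def)
  moreover have "eventually (\<lambda>F. sum f F \<le> y) (finite_subsets_at_top A)"
    unfolding eventually_finite_subsets_at_top using assms(2) by (intro exI[of _ "{}"]) auto
  ultimately show ?thesis by (rule tendsto_upperbound) simp
qed

text \<open>One exact fiber together with a bound \<open>\<Lambda>\<close> for its first
  \<open>n\<close> eigenvalues. All estimates depend on \<open>k\<close> through
  \<open>\<Lambda>\<close> only, and \<open>\<Lambda>\<close> can be chosen once for all
  \<open>k\<close>.\<close>

locale bounded_fiber =
  fixes a b :: "'d::finite \<Rightarrow> real^'d" and V :: "real^'d \<Rightarrow> real" and B :: real
    and k :: "real^'d" and eps :: "nat \<Rightarrow> real" and u :: "nat \<Rightarrow> 'd cfun"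
    and n :: nat and \<Lambda> :: real
  assumes bases: "lattice_bases a b" and V: "bounded_potential V B"
    and eb: "fiber_eigenbasis a b V k eps u" and n: "1 \<le> n"
    and eps_bound: "\<And>j. j \<in> {1..n} \<Longrightarrow> \<bar>eps j\<bar> \<le> \<Lambda>"
begin

abbreviation "Y \<equiv> cspan (u ` {1..n})"

text \<open>The restriction of the exact fiber to the span of its first \<open>n\<close>
  eigenfunctions, extended to all functions by the orthogonal projection.\<close>

definition energy_op :: "'d cfun \<Rightarrow> 'd cfun" where
  "energy_op \<Phi> = (\<Sum>j=1..n. fscale (of_real (eps j) * ip a (u j) \<Phi>) (u j))"

lemma \<Lambda>_nonneg: "0 \<le> \<Lambda>"
  using eps_bound[of n] n by auto

lemma B_nonneg: "0 \<le> B"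
  using V by (simp add: bounded_potential_def)

lemma u_orthonormal: "orthonormal_family a u {1..n}"
  by (rule fiber_eigenbasisD(2)[OF bases eb]) auto

lemma Y_expansion: "\<Phi> \<in> Y \<Longrightarrow> \<Phi> = (\<Sum>j=1..n. fscale (ip a (u j) \<Phi>) (u j))"
  by (rule orthonormal_expansion[OF u_orthonormal finite_atLeastAtMost])

lemma Y_L2cell: "\<Phi> \<in> Y \<Longrightarrow> \<Phi> \<in> L2cell a"
  using lincomb_L2cell[OF u_orthonormal, of "\<lambda>j. ip a (u j) \<Phi>"] Y_expansion[of \<Phi>] by simp

lemma energy_op_Y: "energy_op \<Phi> \<in> Y"
  unfolding energy_op_def by (intro cfun.span_sum cfun.span_scale cfun.span_base imageI)

lemma Y_norm: "\<Phi> \<in> Y \<Longrightarrow> (L2norm a \<Phi>)\<^sup>2 = (\<Sum>j=1..n. (norm (ip a (u j) \<Phi>))\<^sup>2)"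
  using L2norm_lincomb[OF u_orthonormal finite_atLeastAtMost, of "\<lambda>j. ip a (u j) \<Phi>"] Y_expansion[of \<Phi>] by simp

lemma fourier_energy_op:
  assumes \<Phi>: "\<Phi> \<in> Y" and G: "G \<in> zspan b"
  shows "fourier a (energy_op \<Phi>) G = of_real (kinetic k G) * fourier a \<Phi> G + fourier a (pot V \<Phi>) G"
proof -
  let ?x = "\<lambda>j. ip a (u j) \<Phi>"
  note D = fiber_eigenbasisD[OF bases eb]
  have u: "u j \<in> L2cell a" if "j \<in> {1..n}" for j using D(1) that by simp
  have "fourier a (energy_op \<Phi>) G = (\<Sum>j=1..n. (of_real (eps j) * ?x j) * fourier a (u j) G)"
    unfolding energy_op_def fourier_eq_ip by (intro ip_sum_fscale_right pw_L2cell[OF bases] u)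
  also have "\<dots> = (\<Sum>j=1..n. of_real (kinetic k G) * (?x j * fourier a (u j) G) + ?x j * fourier a (pot V (u j)) G)"
  proof (rule sum.cong[OF refl])
    fix j assume "j \<in> {1..n}"
    then have "of_real (eps j) * fourier a (u j) G = of_real (kinetic k G) * fourier a (u j) G + fourier a (pot V (u j)) G"
      using G by (intro D(3)) auto
    then have "?x j * (of_real (eps j) * fourier a (u j) G)
        = ?x j * (of_real (kinetic k G) * fourier a (u j) G + fourier a (pot V (u j)) G)" by (rule arg_cong)
    then show "(of_real (eps j) * ?x j) * fourier a (u j) G
        = of_real (kinetic k G) * (?x j * fourier a (u j) G) + ?x j * fourier a (pot V (u j)) G"
      by (simp add: algebra_simps)
  qed
  also have "\<dots> = of_real (kinetic k G) * (\<Sum>j=1..n. ?x j * fourier a (u j) G) + (\<Sum>j=1..n. ?x j * fourier a (pot V (u j)) G)"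
    by (simp add: sum.distrib sum_distrib_left)
  also have "(\<Sum>j=1..n. ?x j * fourier a (u j) G) = fourier a (\<Sum>j=1..n. fscale (?x j) (u j)) G"
    unfolding fourier_eq_ip by (intro ip_sum_fscale_right[symmetric] pw_L2cell[OF bases] u)
  also have "(\<Sum>j=1..n. ?x j * fourier a (pot V (u j)) G) = fourier a (\<Sum>j=1..n. fscale (?x j) (pot V (u j))) G"
    unfolding fourier_eq_ip by (intro ip_sum_fscale_right[symmetric] pw_L2cell[OF bases] pot_bounds[OF V] u)
  also have "(\<Sum>j=1..n. fscale (?x j) (pot V (u j))) = pot V (\<Sum>j=1..n. fscale (?x j) (u j))"
    by (rule pot_sum[symmetric])
  finally show ?thesis unfolding Y_expansion[OF \<Phi>, symmetric] .
qed

lemma ip_energy_op: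
  assumes \<Phi>: "\<Phi> \<in> Y"
  shows "Re (ip a \<Phi> (energy_op \<Phi>)) \<le> eps n * (L2norm a \<Phi>)\<^sup>2"
    and "eps n * (L2norm a \<Phi>)\<^sup>2 \<le> \<Lambda> * (L2norm a \<Phi>)\<^sup>2"
proof -
  let ?x = "\<lambda>j. ip a (u j) \<Phi>"
  have "ip a \<Phi> (energy_op \<Phi>) = ip a (\<Sum>j=1..n. fscale (?x j) (u j)) (energy_op \<Phi>)"
    using Y_expansion[OF \<Phi>] by simp
  also have "\<dots> = (\<Sum>j=1..n. cnj (?x j) * (of_real (eps j) * ?x j))"
    unfolding energy_op_def by (rule ip_lincomb_lincomb[OF u_orthonormal finite_atLeastAtMost])
  finally have "Re (ip a \<Phi> (energy_op \<Phi>)) = (\<Sum>j=1..n. Re (cnj (?x j) * (of_real (eps j) * ?x j)))"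
    by (simp only: Re_sum)
  also have "\<dots> = (\<Sum>j=1..n. eps j * (norm (?x j))\<^sup>2)"
    by (intro sum.cong refl) (simp add: cmod_def power2_eq_square algebra_simps)
  also have "\<dots> \<le> (\<Sum>j=1..n. eps n * (norm (?x j))\<^sup>2)"
    using fiber_eigenbasisD(4)[OF bases eb] by (intro sum_mono mult_right_mono) auto
  also have "\<dots> = eps n * (L2norm a \<Phi>)\<^sup>2" unfolding Y_norm[OF \<Phi>] by (rule sum_distrib_left[symmetric])
  finally show "Re (ip a \<Phi> (energy_op \<Phi>)) \<le> eps n * (L2norm a \<Phi>)\<^sup>2" .
  show "eps n * (L2norm a \<Phi>)\<^sup>2 \<le> \<Lambda> * (L2norm a \<Phi>)\<^sup>2"
    using eps_bound[of n] n by (intro mult_right_mono) auto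
qed

lemma energy_op_norm:
  assumes \<Phi>: "\<Phi> \<in> Y"
  shows "L2norm a (energy_op \<Phi>) \<le> \<Lambda> * L2norm a \<Phi>"
proof (rule power2_le_imp_le)
  have "(L2norm a (energy_op \<Phi>))\<^sup>2 = (\<Sum>j=1..n. (norm (of_real (eps j) * ip a (u j) \<Phi>))\<^sup>2)"
    unfolding energy_op_def by (rule L2norm_lincomb[OF u_orthonormal finite_atLeastAtMost])
  also have "\<dots> \<le> (\<Sum>j=1..n. \<Lambda>\<^sup>2 * (norm (ip a (u j) \<Phi>))\<^sup>2)"
    unfolding norm_mult norm_of_real power_mult_distrib
    using eps_bound by (intro sum_mono mult_right_mono power_mono) auto
  also have "\<dots> = (\<Lambda> * L2norm a \<Phi>)\<^sup>2"
    unfolding power_mult_distrib Y_norm[OF \<Phi>] by (rule sum_distrib_left[symmetric])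
  finally show "(L2norm a (energy_op \<Phi>))\<^sup>2 \<le> (\<Lambda> * L2norm a \<Phi>)\<^sup>2" .
  show "0 \<le> \<Lambda> * L2norm a \<Phi>" using \<Lambda>_nonneg by simp
qed

lemma total_kinetic_energy:
  assumes \<Phi>: "\<Phi> \<in> Y" and A: "finite A" "A \<subseteq> zspan b"
  shows "(\<Sum>G\<in>A. kinetic k G * (norm (fourier a \<Phi> G))\<^sup>2) \<le> (\<Lambda> + B) * (L2norm a \<Phi>)\<^sup>2"
proof -
  note L2 = Y_L2cell[OF \<Phi>]
  have "(\<Sum>G\<in>A. kinetic k G * (norm (fourier a \<Phi> G))\<^sup>2) \<le> Re (ip a \<Phi> (energy_op \<Phi>)) - Re (ip a \<Phi> (pot V \<Phi>))"
  proof (rule has_sum_mono2[OF has_sum_finite[OF A(1)]])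
    show "((\<lambda>G. kinetic k G * (norm (fourier a \<Phi> G))\<^sup>2) has_sum Re (ip a \<Phi> (energy_op \<Phi>)) - Re (ip a \<Phi> (pot V \<Phi>))) (zspan b)"
      by (intro kinetic_energy_has_sum[OF bases V] L2 Y_L2cell energy_op_Y fourier_energy_op \<Phi>)
  qed (use A in auto)
  moreover have "Re (ip a \<Phi> (energy_op \<Phi>)) \<le> \<Lambda> * (L2norm a \<Phi>)\<^sup>2"
    using ip_energy_op[OF \<Phi>] by linarith
  moreover have "- Re (ip a \<Phi> (pot V \<Phi>)) \<le> B * (L2norm a \<Phi>)\<^sup>2"
    using ip_pot_bound[OF V L2 L2] abs_Re_le_cmod[of "ip a \<Phi> (pot V \<Phi>)"]
    by (simp add: power2_eq_square mult.assoc)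
  ultimately show ?thesis unfolding distrib_right by linarith
qed

text \<open>Splitting the frequencies by kinetic energy: \<open>lowproj\<close> is the orthogonal
  projection onto the low ones, and \<open>tail_bound\<close> bounds the kinetic energy that
  normalised elements of \<open>Y\<close> have in the high ones. Finite sets of frequencies suffice
  for the latter and avoid summability conditions.\<close>

definition low :: "real \<Rightarrow> (real^'d) set" where
  "low E = {G \<in> zspan b. kinetic k G \<le> E}"

definition lowproj :: "real \<Rightarrow> 'd cfun \<Rightarrow> 'd cfun" where
  "lowproj E f = (\<Sum>G\<in>low E. fscale (fourier a f G) (pw a G))"

definition tail_bound :: "real \<Rightarrow> real \<Rightarrow> bool" where
  "tail_bound E t \<longleftrightarrow> (\<forall>\<Phi>\<in>Y. L2norm a \<Phi> = 1 \<longrightarrow> (\<forall>A. finite A \<longrightarrow> A \<subseteq> zspan b - low E \<longrightarrow>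
     (\<Sum>G\<in>A. kinetic k G * (norm (fourier a \<Phi> G))\<^sup>2) \<le> t))"

lemma tail_bound_total: "tail_bound E (\<Lambda> + B)"
  unfolding tail_bound_def
proof (intro ballI allI impI)
  fix \<Phi> A assume \<Phi>: "\<Phi> \<in> Y" "L2norm a \<Phi> = 1" and A: "finite A" "A \<subseteq> zspan b - low E"
  have "A \<subseteq> zspan b" using A(2) by blast
  from total_kinetic_energy[OF \<Phi>(1) A(1) this] \<Phi>(2)
  show "(\<Sum>G\<in>A. kinetic k G * (norm (fourier a \<Phi> G))\<^sup>2) \<le> \<Lambda> + B" by simp
qed

lemma finite_low: "finite (low E)"
  unfolding low_def by (rule finite_kinetic_le[OF bases])

lemma orthonormal_low: "orthonormal_family a (pw a) (low E)"
  by (rule orthonormal_family_subset[OF orthonormal_pw[OF bases]]) (auto simp: low_def)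

lemma lowproj_L2cell: "lowproj E f \<in> L2cell a"
  unfolding lowproj_def by (rule lincomb_L2cell[OF orthonormal_low])

lemma fourier_lowproj:
  assumes "G \<in> zspan b"
  shows "fourier a (lowproj E f) G = (if G \<in> low E then fourier a f G else 0)"
proof (cases "G \<in> low E")
  case True
  then show ?thesis
    unfolding lowproj_def fourier_eq_ip[of a "sum _ _"]
    using ip_basis_lincomb[OF orthonormal_low finite_low True] by simp
next
  case False
  have "fourier a (lowproj E f) G = (\<Sum>G'\<in>low E. fourier a f G' * ip a (pw a G) (pw a G'))"
    unfolding lowproj_def fourier_eq_ip[of a "sum _ _"]
    by (rule ip_lincomb_right[OF orthonormal_low pw_L2cell[OF bases]])
  also have "\<dots> = 0"
    using False assms by (intro sum.neutral ballI) (auto simp: ip_pw_pw[OF bases] low_def)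
  finally show ?thesis using False by simp
qed

lemma fourier_highproj:
  assumes "f \<in> L2cell a" "G \<in> zspan b"
  shows "fourier a (f - lowproj E f) G = (if G \<in> low E then 0 else fourier a f G)"
proof -
  have "fourier a (f - lowproj E f) G = fourier a f G - fourier a (lowproj E f) G"
    unfolding fourier_eq_ip by (rule ip_diff_right[OF pw_L2cell[OF bases] assms(1) lowproj_L2cell])
  then show ?thesis unfolding fourier_lowproj[OF assms(2)] by simp
qed

lemma lowproj_norm: "(L2norm a (lowproj E f))\<^sup>2 = (\<Sum>G\<in>low E. (norm (fourier a f G))\<^sup>2)"
  unfolding lowproj_def by (rule L2norm_lincomb[OF orthonormal_low finite_low])

lemma lowproj_pythagoras:
  assumes f: "f \<in> L2cell a"
  shows "(L2norm a (f - lowproj E f))\<^sup>2 = (L2norm a f)\<^sup>2 - (L2norm a (lowproj E f))\<^sup>2"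
  using L2norm_residual[OF orthonormal_low finite_low f, of "fourier a f" E]
  unfolding lowproj_norm lowproj_def[symmetric] by (simp add: fourier_eq_ip)

lemma tail_bound_scaled:
  assumes t: "tail_bound E t" and \<Phi>: "\<Phi> \<in> Y" and A: "finite A" "A \<subseteq> zspan b - low E"
  shows "(\<Sum>G\<in>A. kinetic k G * (norm (fourier a \<Phi> G))\<^sup>2) \<le> t * (L2norm a \<Phi>)\<^sup>2"
proof (cases "L2norm a \<Phi> = 0")
  case True
  have "norm (fourier a \<Phi> G) \<le> L2norm a (pw a G) * L2norm a \<Phi>" for G
    unfolding fourier_eq_ip by (rule ip_Cauchy_Schwarz[OF pw_L2cell[OF bases] Y_L2cell[OF \<Phi>]])
  then have "fourier a \<Phi> G = 0" for G using True by simp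
  then show ?thesis using True by simp
next
  case False
  let ?N = "L2norm a \<Phi>"
  define \<Psi> where "\<Psi> = fscale (of_real (1 / ?N)) \<Phi>"
  have "\<Psi> \<in> Y" unfolding \<Psi>_def by (rule cfun.span_scale[OF \<Phi>])
  moreover have "L2norm a \<Psi> = 1" unfolding \<Psi>_def L2norm_scale norm_of_real using False by simp
  ultimately have "(\<Sum>G\<in>A. kinetic k G * (norm (fourier a \<Psi> G))\<^sup>2) \<le> t" using t A by (simp add: tail_bound_def)
  moreover have "(norm (fourier a \<Psi> G))\<^sup>2 = (norm (fourier a \<Phi> G))\<^sup>2 / ?N\<^sup>2" for G
    unfolding \<Psi>_def fourier_eq_ip ip_scale_right by (simp add: norm_mult norm_divide power_divide)
  ultimately have "(\<Sum>G\<in>A. kinetic k G * (norm (fourier a \<Phi> G))\<^sup>2) / ?N\<^sup>2 \<le> t"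
    by (simp add: sum_divide_distrib)
  then show ?thesis using False by (simp add: pos_divide_le_eq)
qed

text \<open>A frequency that is not low has kinetic energy above \<open>E\<close>, so the kinetic
  tail controls the mass of the remainder.\<close>

lemma highproj_norm:
  assumes t: "tail_bound E t" and \<Phi>: "\<Phi> \<in> Y" and E: "E > 0"
  shows "(L2norm a (\<Phi> - lowproj E \<Phi>))\<^sup>2 \<le> t / E * (L2norm a \<Phi>)\<^sup>2"
proof (rule has_sum_le_of_finite_sums[OF parseval[OF bases L2cell_diff[OF Y_L2cell[OF \<Phi>] lowproj_L2cell]]])
  fix A assume A: "finite A" "A \<subseteq> zspan b"
  have "(\<Sum>G\<in>A. (norm (fourier a (\<Phi> - lowproj E \<Phi>) G))\<^sup>2) \<le> (\<Sum>G\<in>A. if G \<in> low E then 0 else kinetic k G * (norm (fourier a \<Phi> G))\<^sup>2 / E)"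
  proof (rule sum_mono)
    fix G assume "G \<in> A"
    then have G: "G \<in> zspan b" using A by auto
    have "(norm (fourier a \<Phi> G))\<^sup>2 * 1 \<le> (norm (fourier a \<Phi> G))\<^sup>2 * (kinetic k G / E)" if "G \<notin> low E"
      using that G E by (intro mult_left_mono) (auto simp: low_def)
    then show "(norm (fourier a (\<Phi> - lowproj E \<Phi>) G))\<^sup>2 \<le> (if G \<in> low E then 0 else kinetic k G * (norm (fourier a \<Phi> G))\<^sup>2 / E)"
      unfolding fourier_highproj[OF Y_L2cell[OF \<Phi>] G] by (simp add: mult.commute)
  qed
  also have "\<dots> = (\<Sum>G\<in>A - low E. kinetic k G * (norm (fourier a \<Phi> G))\<^sup>2) / E"
    unfolding sum_divide_distrib using A(1) by (intro sum.mono_neutral_cong_right) auto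
  also have "\<dots> \<le> t * (L2norm a \<Phi>)\<^sup>2 / E"
    using A E by (intro divide_right_mono tail_bound_scaled[OF t \<Phi>]) auto
  finally show "(\<Sum>G\<in>A. (norm (fourier a (\<Phi> - lowproj E \<Phi>) G))\<^sup>2) \<le> t / E * (L2norm a \<Phi>)\<^sup>2" by simp
qed

end

section \<open>Comparison of the eigenvalues\<close>

context bounded_fiber begin

text \<open>The energy of the projection \<open>p\<close> of \<open>\<Phi>\<close> differs from that
  of \<open>\<Phi>\<close> only by terms quadratic in the remainder \<open>q\<close>. With
  \<open>\<psi> = H \<Phi>\<close>, the energy of \<open>p\<close> is \<open>(\<Phi>, \<psi>) - 2 Re
  (q, \<psi>)\<close> plus the kinetic energy of \<open>q\<close> plus \<open>(q, V q)\<close>. The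
  seemingly linear term \<open>(q, \<psi>)\<close> is quadratic as well: it equals \<open>(q,
  \<psi>')\<close> with \<open>\<psi>'\<close> the remainder of \<open>\<psi>\<close>, and
  \<open>\<psi>\<close> lies in \<open>Y\<close>, so this remainder is as small as
  \<open>q\<close>.\<close>

lemma low_energy_difference:
  assumes t: "tail_bound E t" and \<Phi>: "\<Phi> \<in> Y" and N: "L2norm a \<Phi> = 1" and E: "E \<ge> 1"
  shows "(\<Sum>G\<in>low E. kinetic k G * (norm (fourier a \<Phi> G))\<^sup>2) + Re (ip a (lowproj E \<Phi>) (pot V (lowproj E \<Phi>)))
     - eps n * (L2norm a (lowproj E \<Phi>))\<^sup>2 \<le> (3 * \<Lambda> + B + 1) * t"
proof -
  define p where "p = lowproj E \<Phi>"
  define q where "q = \<Phi> - p"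
  define \<psi> where "\<psi> = energy_op \<Phi>"
  define \<psi>' where "\<psi>' = \<psi> - lowproj E \<psi>"
  have E0: "E > 0" using E by simp
  have \<psi>Y: "\<psi> \<in> Y" unfolding \<psi>_def by (rule energy_op_Y)
  have L2: "\<Phi> \<in> L2cell a" "p \<in> L2cell a" "q \<in> L2cell a" "\<psi> \<in> L2cell a" "\<psi>' \<in> L2cell a"
    unfolding q_def p_def \<psi>'_def
    by (intro L2cell_diff Y_L2cell[OF \<Phi>] Y_L2cell[OF \<psi>Y] lowproj_L2cell)+
  note VL2 = pot_bounds(1)[OF V L2(1)] pot_bounds(1)[OF V L2(2)] pot_bounds(1)[OF V L2(3)]
  have \<Phi>_eq: "\<Phi> = p + q" by (simp add: q_def)
  have t_sum: "(\<Sum>G\<in>A. kinetic k G * (norm (fourier a \<Phi> G))\<^sup>2) \<le> t" if "finite A" "A \<subseteq> zspan b - low E" for A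
    using t \<Phi> N that by (simp add: tail_bound_def)
  have t0: "0 \<le> t" using t_sum[of "{}"] by simp
  have q_t: "(L2norm a q)\<^sup>2 \<le> t"
  proof -
    have "(L2norm a q)\<^sup>2 \<le> t / E" using highproj_norm[OF t \<Phi> E0] N by (simp add: q_def p_def)
    also have "\<dots> \<le> t / 1" using t0 E by (intro divide_left_mono) auto
    finally show ?thesis by simp
  qed
  have \<psi>'_t: "(L2norm a \<psi>')\<^sup>2 \<le> \<Lambda>\<^sup>2 * t"
  proof -
    have "(L2norm a \<psi>')\<^sup>2 \<le> t / E * (L2norm a \<psi>)\<^sup>2" unfolding \<psi>'_def by (rule highproj_norm[OF t \<psi>Y E0])
    also have "\<dots> \<le> t * \<Lambda>\<^sup>2"
    proof (rule mult_mono)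
      have "t / E \<le> t / 1" using t0 E by (intro divide_left_mono) auto
      then show "t / E \<le> t" by simp
      show "(L2norm a \<psi>)\<^sup>2 \<le> \<Lambda>\<^sup>2"
        using energy_op_norm[OF \<Phi>] N unfolding \<psi>_def by (intro power_mono) auto
    qed (use t0 in auto)
    finally show ?thesis by (simp add: mult.commute)
  qed
  have q\<psi>: "\<bar>Re (ip a q \<psi>)\<bar> \<le> \<Lambda> * t"
  proof -
    have "((\<lambda>G. cnj (fourier a q G) * fourier a \<psi> G) has_sum ip a q \<psi>) (zspan b)"
      by (rule parseval_ip[OF bases L2(3,4)])
    moreover have "((\<lambda>G. cnj (fourier a q G) * fourier a \<psi>' G) has_sum ip a q \<psi>') (zspan b)"
      by (rule parseval_ip[OF bases L2(3,5)])
    moreover have "cnj (fourier a q G) * fourier a \<psi> G = cnj (fourier a q G) * fourier a \<psi>' G" if "G \<in> zspan b" for G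
      unfolding q_def p_def \<psi>'_def fourier_highproj[OF L2(1) that] fourier_highproj[OF L2(4) that] by simp
    then have "((\<lambda>G. cnj (fourier a q G) * fourier a \<psi> G) has_sum ip a q \<psi>') (zspan b)
        \<longleftrightarrow> ((\<lambda>G. cnj (fourier a q G) * fourier a \<psi>' G) has_sum ip a q \<psi>') (zspan b)"
      by (rule has_sum_cong)
    ultimately have "ip a q \<psi> = ip a q \<psi>'"
      using has_sum_unique by blast
    then have "\<bar>Re (ip a q \<psi>)\<bar> \<le> L2norm a q * L2norm a \<psi>'"
      using ip_Cauchy_Schwarz[OF L2(3,5)] abs_Re_le_cmod[of "ip a q \<psi>'"] by simp
    also have "\<dots> \<le> \<Lambda> * t"
    proof (rule power2_le_imp_le)
      have "(L2norm a q * L2norm a \<psi>')\<^sup>2 \<le> t * (\<Lambda>\<^sup>2 * t)"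
        unfolding power_mult_distrib using t0 by (intro mult_mono q_t \<psi>'_t) auto
      then show "(L2norm a q * L2norm a \<psi>')\<^sup>2 \<le> (\<Lambda> * t)\<^sup>2" by (simp add: power2_eq_square mult_ac)
    qed (use t0 \<Lambda>_nonneg in simp)
    finally show ?thesis .
  qed
  have kin: "fourier a (\<psi> - pot V \<Phi>) G = of_real (kinetic k G) * fourier a \<Phi> G" if "G \<in> zspan b" for G
  proof -
    have "fourier a (\<psi> - pot V \<Phi>) G = fourier a \<psi> G - fourier a (pot V \<Phi>) G"
      unfolding fourier_eq_ip by (rule ip_diff_right[OF pw_L2cell[OF bases] L2(4) VL2(1)])
    then show ?thesis unfolding \<psi>_def fourier_energy_op[OF \<Phi> that] by simp
  qed
  have sq: "Re (cnj z * (of_real r * z)) = r * (norm z)\<^sup>2" for r z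
    by (simp add: cmod_def power2_eq_square algebra_simps)
  have D: "Re (ip a q (\<psi> - pot V \<Phi>)) \<le> t"
  proof (rule has_sum_le_of_finite_sums[OF has_sum_Re[OF parseval_ip[OF bases L2(3) L2cell_diff[OF L2(4) VL2(1)]]]])
    fix A assume A: "finite A" "A \<subseteq> zspan b"
    have "(\<Sum>G\<in>A. Re (cnj (fourier a q G) * fourier a (\<psi> - pot V \<Phi>) G))
        = (\<Sum>G\<in>A - low E. kinetic k G * (norm (fourier a \<Phi> G))\<^sup>2)"
    proof (rule sum.mono_neutral_cong_right)
      show "\<forall>G\<in>A - (A - low E). Re (cnj (fourier a q G) * fourier a (\<psi> - pot V \<Phi>) G) = 0"
        using A unfolding q_def p_def by (auto simp: fourier_highproj[OF L2(1)])
      show "Re (cnj (fourier a q G) * fourier a (\<psi> - pot V \<Phi>) G) = kinetic k G * (norm (fourier a \<Phi> G))\<^sup>2"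
        if "G \<in> A - low E" for G
      proof -
        have G: "G \<in> zspan b" "G \<notin> low E" using A that by auto
        then have "fourier a q G = fourier a \<Phi> G"
          unfolding q_def p_def fourier_highproj[OF L2(1) G(1)] by simp
        then show ?thesis unfolding kin[OF G(1)] by (simp only: sq)
      qed
    qed (use A in auto)
    also have "\<dots> \<le> t" using A by (intro t_sum) auto
    finally show "(\<Sum>G\<in>A. Re (cnj (fourier a q G) * fourier a (\<psi> - pot V \<Phi>) G)) \<le> t" .
  qed
  have K: "(\<Sum>G\<in>low E. kinetic k G * (norm (fourier a \<Phi> G))\<^sup>2) = Re (ip a p (\<psi> - pot V \<Phi>))"
  proof -
    have "ip a p (\<psi> - pot V \<Phi>) = (\<Sum>G\<in>low E. cnj (fourier a \<Phi> G) * ip a (pw a G) (\<psi> - pot V \<Phi>))"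
      unfolding p_def lowproj_def by (rule ip_lincomb_left[OF orthonormal_low L2cell_diff[OF L2(4) VL2(1)]])
    also have "\<dots> = (\<Sum>G\<in>low E. cnj (fourier a \<Phi> G) * (of_real (kinetic k G) * fourier a \<Phi> G))"
    proof (rule sum.cong[OF refl])
      fix G assume "G \<in> low E"
      then have "G \<in> zspan b" by (simp add: low_def)
      from kin[OF this] show "cnj (fourier a \<Phi> G) * ip a (pw a G) (\<psi> - pot V \<Phi>) = cnj (fourier a \<Phi> G) * (of_real (kinetic k G) * fourier a \<Phi> G)"
        unfolding fourier_eq_ip by simp
    qed
    finally show ?thesis by (simp only: Re_sum sq)
  qed
  \<comment> \<open>It remains to expand all terms with respect to \<open>\<Phi> = p + q\<close> and to collect them.\<close>
  have e1: "Re (ip a p (\<psi> - pot V \<Phi>)) = Re (ip a p \<psi>) - Re (ip a p (pot V \<Phi>))"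
    unfolding ip_diff_right[OF L2(2,4) VL2(1)] by (simp only: minus_complex.sel)
  have e2: "Re (ip a q (\<psi> - pot V \<Phi>)) = Re (ip a q \<psi>) - Re (ip a q (pot V \<Phi>))"
    unfolding ip_diff_right[OF L2(3,4) VL2(1)] by (simp only: minus_complex.sel)
  have e3: "ip a \<Phi> \<psi> = ip a p \<psi> + ip a q \<psi>"
    by (subst \<Phi>_eq) (rule ip_add_left[OF L2(2,3,4)])
  have V\<Phi>: "pot V \<Phi> = pot V p + pot V q"
    by (subst \<Phi>_eq) (simp add: pot_def fun_eq_iff distrib_left)
  have e4: "ip a p (pot V \<Phi>) = ip a p (pot V p) + ip a p (pot V q)"
    unfolding V\<Phi> by (rule ip_add_right[OF L2(2) VL2(2,3)])
  have e5: "ip a q (pot V \<Phi>) = ip a q (pot V p) + ip a q (pot V q)"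
    unfolding V\<Phi> by (rule ip_add_right[OF L2(3) VL2(2,3)])
  have e6: "Re (ip a q (pot V p)) = Re (ip a p (pot V q))"
    unfolding ip_pot_commute[symmetric, of a q V p] ip_commute[of a "pot V q" p] by simp
  have b1: "Re (ip a q (pot V q)) \<le> B * t"
  proof -
    have "Re (ip a q (pot V q)) \<le> B * (L2norm a q)\<^sup>2"
      using ip_pot_bound[OF V L2(3,3)] complex_Re_le_cmod[of "ip a q (pot V q)"]
      by (simp add: power2_eq_square mult.assoc)
    also have "\<dots> \<le> B * t" using q_t B_nonneg by (rule mult_left_mono)
    finally show ?thesis .
  qed
  have b2: "Re (ip a \<Phi> \<psi>) \<le> eps n" using ip_energy_op(1)[OF \<Phi>] N by (simp add: \<psi>_def)
  have b3: "eps n * (L2norm a q)\<^sup>2 \<le> \<Lambda> * t"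
    using eps_bound[of n] n q_t \<Lambda>_nonneg by (intro mult_mono) auto
  have p_norm: "(L2norm a p)\<^sup>2 = 1 - (L2norm a q)\<^sup>2"
    using lowproj_pythagoras[OF L2(1), of E] N unfolding p_def q_def by simp
  have "eps n * (L2norm a p)\<^sup>2 = eps n - eps n * (L2norm a q)\<^sup>2" unfolding p_norm by (simp add: right_diff_distrib)
  moreover have "Re (ip a \<Phi> \<psi>) = Re (ip a p \<psi>) + Re (ip a q \<psi>)" using e3 by simp
  moreover have "Re (ip a p (pot V \<Phi>)) = Re (ip a p (pot V p)) + Re (ip a p (pot V q))" using e4 by simp
  moreover have "Re (ip a q (pot V \<Phi>)) = Re (ip a q (pot V p)) + Re (ip a q (pot V q))" using e5 by simp
  moreover have "(3 * \<Lambda> + B + 1) * t = 3 * (\<Lambda> * t) + B * t + t" by (simp add: algebra_simps)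
  ultimately show ?thesis
    using K e1 e2 e6 b1 b2 b3 D q\<psi> unfolding p_def[symmetric] by linarith
qed

text \<open>Among the combinations of the first \<open>n\<close> modified eigenfunctions there is
  one orthogonal to the first \<open>n - 1\<close> exact ones. Its exact energy is at least \<open>eps
  n\<close>, its modified energy is at most \<open>e n\<close>, and the modified kinetic energy
  dominates the exact one.\<close>

lemma modified_eigenvalue_lower:
  assumes bu: "blow_up_function m g" and Ec: "Ec > 0"
    and me: "modified_eigenvalues a b V g Ec k e" and nM: "n \<le> Mdim a b Ec k"
  shows "eps n \<le> e n"
proof -
  let ?M = "Mdim a b Ec k" and ?H = "modified_op a b V g Ec k"
  obtain \<phi> where \<phi>: "orthonormal_family a \<phi> {1..?M}"
      "\<And>j. j \<in> {1..?M} \<Longrightarrow> \<phi> j \<in> Xspace a b Ec k"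
      "\<And>j. j \<in> {1..?M} \<Longrightarrow> ?H (\<phi> j) = fscale (of_real (e j)) (\<phi> j)"
    using modified_eigenbasis_exists[OF bases V me] by blast
  have \<phi>n: "orthonormal_family a \<phi> {1..n}" by (rule orthonormal_family_subset[OF \<phi>(1)]) (use nM in auto)
  have card: "card {1..<n} < card {1..n}" using n by simp
  have uL2: "u j \<in> L2cell a" if "j \<in> {1..<n}" for j
    using fiber_eigenbasisD(1)[OF bases eb] that by simp
  have "\<exists>x. (\<exists>j\<in>{1..n}. x j \<noteq> 0) \<and>
      (\<forall>i\<in>{1..<n}. ip a (u i) (\<Sum>j=1..n. fscale (x j) (\<phi> j)) = 0)"
    by (rule orthogonal_combination[OF finite_atLeastLessThan finite_atLeastAtMost card uL2 orthonormal_familyD(1)[OF \<phi>n]])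
  then obtain x where x: "\<exists>j\<in>{1..n}. x j \<noteq> 0"
    and orth: "\<And>i. i \<in> {1..<n} \<Longrightarrow> ip a (u i) (\<Sum>j=1..n. fscale (x j) (\<phi> j)) = 0"
    by blast
  define \<Psi> where "\<Psi> = (\<Sum>j=1..n. fscale (x j) (\<phi> j))"
  have \<Psi>X: "\<Psi> \<in> Xspace a b Ec k"
    unfolding \<Psi>_def Xspace_def
  proof (intro cfun.span_sum cfun.span_scale)
    fix j assume "j \<in> {1..n}"
    then show "\<phi> j \<in> cspan (pw a ` cutoff b Ec k)" using \<phi>(2)[of j] nM by (simp add: Xspace_def)
  qed
  have pos: "0 < (L2norm a \<Psi>)\<^sup>2"
    unfolding \<Psi>_def by (rule lincomb_norm_pos[OF \<phi>n finite_atLeastAtMost x])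
  have "eps n * (L2norm a \<Psi>)\<^sup>2 \<le>
      (\<Sum>G\<in>cutoff b Ec k. kinetic k G * (norm (fourier a \<Psi> G))\<^sup>2) + Re (ip a \<Psi> (pot V \<Psi>))"
    using orth by (intro fiber_lower_bound[OF bases V eb n finite_cutoff[OF bases] cutoff_subset Xspace_expansion[OF bases \<Psi>X]])
      (simp add: \<Psi>_def del: sum_cfun_apply)
  also have "\<dots> \<le> (\<Sum>G\<in>cutoff b Ec k. mod_kinetic g Ec k G * (norm (fourier a \<Psi> G))\<^sup>2) + Re (ip a \<Psi> (pot V \<Psi>))"
    by (intro add_right_mono sum_mono mult_right_mono kinetic_le_mod_kinetic[OF bu Ec]) simp
  also have "\<dots> = Re (ip a \<Psi> (?H \<Psi>))" by (rule Re_ip_modified_op[OF bases V \<Psi>X, symmetric])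
  also have "\<dots> = (\<Sum>j=1..?M. e j * (norm (ip a (\<phi> j) \<Psi>))\<^sup>2)"
    by (rule modified_eigenbasis_energy(2)[OF bases V \<phi> \<Psi>X])
  also have "\<dots> \<le> (\<Sum>j=1..?M. e n * (norm (ip a (\<phi> j) \<Psi>))\<^sup>2)"
  proof (rule sum_mono)
    fix j assume j: "j \<in> {1..?M}"
    show "e j * (norm (ip a (\<phi> j) \<Psi>))\<^sup>2 \<le> e n * (norm (ip a (\<phi> j) \<Psi>))\<^sup>2"
    proof (cases "j \<le> n")
      case True
      have "mono_on {1..?M} e" using me by (simp add: modified_eigenvalues_def)
      then have "e j \<le> e n" by (rule mono_onD) (use True j nM n in auto)
      then show ?thesis by (rule mult_right_mono) simp
    next
      case False
      have "ip a (\<phi> j) \<Psi> = (\<Sum>i=1..n. x i * ip a (\<phi> j) (\<phi> i))"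
        unfolding \<Psi>_def by (rule ip_lincomb_right[OF \<phi>n orthonormal_familyD(1)[OF \<phi>(1) j]])
      also have "\<dots> = 0"
        using False j nM \<phi>(1) by (intro sum.neutral ballI) (auto simp: orthonormal_family_def)
      finally show ?thesis by simp
    qed
  qed
  also have "\<dots> = e n * (L2norm a \<Psi>)\<^sup>2"
    using modified_eigenbasis_energy(1)[OF bases V \<phi> \<Psi>X] by (simp only: sum_distrib_left)
  finally show ?thesis using pos by (rule mult_right_le_imp_le)
qed

text \<open>The test space is the projection of \<open>Y\<close> to the frequencies of kinetic
  energy at most \<open>Ec / 4\<close>, where the modified energy has no blow-up and coincides with
  the exact one. It contains an element orthogonal to the first \<open>n - 1\<close> modified
  eigenfunctions. The bound \<open>2 * (\<Lambda> + B)\<close> for \<open>Ec / 4\<close> from below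
  ensures that the projection keeps half of the squared norm.\<close>

lemma modified_eigenvalue_upper:
  assumes bu: "blow_up_function m g" and Ec: "Ec > 0"
    and me: "modified_eigenvalues a b V g Ec k e" and nM: "n \<le> Mdim a b Ec k"
    and t: "tail_bound (Ec / 4) t" and E: "Ec / 4 \<ge> 1" "Ec / 4 \<ge> 2 * (\<Lambda> + B)"
  shows "e n - eps n \<le> 2 * (3 * \<Lambda> + B + 1) * t"
proof -
  let ?M = "Mdim a b Ec k" and ?H = "modified_op a b V g Ec k" and ?E = "Ec / 4"
  obtain \<phi> where \<phi>: "orthonormal_family a \<phi> {1..?M}"
      "\<And>j. j \<in> {1..?M} \<Longrightarrow> \<phi> j \<in> Xspace a b Ec k"
      "\<And>j. j \<in> {1..?M} \<Longrightarrow> ?H (\<phi> j) = fscale (of_real (e j)) (\<phi> j)"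
    using modified_eigenbasis_exists[OF bases V me] by blast
  have low_cut: "low ?E \<subseteq> cutoff b Ec k" using Ec by (auto simp: low_def cutoff_def kinetic_def)
  have pX: "lowproj ?E f \<in> Xspace a b Ec k" for f unfolding lowproj_def by (rule lincomb_in_Xspace[OF low_cut])
  have card: "card {1..<n} < card {1..n}" using n by simp
  have \<phi>L2: "\<phi> j \<in> L2cell a" if "j \<in> {1..<n}" for j
    using orthonormal_familyD(1)[OF \<phi>(1), of j] that nM by simp
  have "\<exists>x. (\<exists>j\<in>{1..n}. x j \<noteq> 0) \<and>
      (\<forall>i\<in>{1..<n}. ip a (\<phi> i) (\<Sum>j=1..n. fscale (x j) (lowproj ?E (u j))) = 0)"
    by (rule orthogonal_combination[OF finite_atLeastLessThan finite_atLeastAtMost card \<phi>L2 lowproj_L2cell])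
  then obtain x where x: "\<exists>j\<in>{1..n}. x j \<noteq> 0"
    and orth: "\<And>i. i \<in> {1..<n} \<Longrightarrow> ip a (\<phi> i) (\<Sum>j=1..n. fscale (x j) (lowproj ?E (u j))) = 0"
    by blast
  define \<Phi>0 where "\<Phi>0 = (\<Sum>j=1..n. fscale (x j) (u j))"
  have "0 < (L2norm a \<Phi>0)\<^sup>2"
    unfolding \<Phi>0_def by (rule lincomb_norm_pos[OF u_orthonormal finite_atLeastAtMost x])
  then have N0: "L2norm a \<Phi>0 \<noteq> 0" by auto
  define c where "c = complex_of_real (1 / L2norm a \<Phi>0)"
  define \<Phi> where "\<Phi> = fscale c \<Phi>0"
  have \<Phi>0Y: "\<Phi>0 \<in> Y" unfolding \<Phi>0_def by (intro cfun.span_sum cfun.span_scale cfun.span_base imageI)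
  have \<Phi>Y: "\<Phi> \<in> Y" unfolding \<Phi>_def by (rule cfun.span_scale[OF \<Phi>0Y])
  have N: "L2norm a \<Phi> = 1" unfolding \<Phi>_def c_def L2norm_scale norm_of_real using N0 by simp
  define p where "p = lowproj ?E \<Phi>"
  have pX': "p \<in> Xspace a b Ec k" unfolding p_def by (rule pX)
  have four: "fourier a \<Phi> G = c * (\<Sum>j=1..n. x j * fourier a (u j) G)" for G
    unfolding fourier_eq_ip \<Phi>_def \<Phi>0_def ip_scale_right
    by (subst ip_lincomb_right[OF u_orthonormal pw_L2cell[OF bases]]) simp
  have orth': "ip a (\<phi> i) p = 0" if i: "i \<in> {1..<n}" for i
  proof -
    have "ip a (\<phi> i) p = (\<Sum>G\<in>low ?E. fourier a \<Phi> G * ip a (\<phi> i) (pw a G))"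
      unfolding p_def lowproj_def by (rule ip_lincomb_right[OF orthonormal_low \<phi>L2[OF i]])
    also have "\<dots> = (\<Sum>G\<in>low ?E. \<Sum>j=1..n. c * (x j * (fourier a (u j) G * ip a (\<phi> i) (pw a G))))"
      unfolding four by (simp add: sum_distrib_left sum_distrib_right mult_ac)
    also have "\<dots> = (\<Sum>j=1..n. \<Sum>G\<in>low ?E. c * (x j * (fourier a (u j) G * ip a (\<phi> i) (pw a G))))"
      by (rule sum.swap)
    also have "\<dots> = c * (\<Sum>j=1..n. x j * (\<Sum>G\<in>low ?E. fourier a (u j) G * ip a (\<phi> i) (pw a G)))"
      by (simp add: sum_distrib_left)
    also have "\<dots> = c * (\<Sum>j=1..n. x j * ip a (\<phi> i) (lowproj ?E (u j)))"
      unfolding lowproj_def ip_lincomb_right[OF orthonormal_low \<phi>L2[OF i]] ..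
    also have "(\<Sum>j=1..n. x j * ip a (\<phi> i) (lowproj ?E (u j))) = ip a (\<phi> i) (\<Sum>j=1..n. fscale (x j) (lowproj ?E (u j)))"
      by (rule ip_sum_fscale_right[OF \<phi>L2[OF i] lowproj_L2cell, symmetric])
    finally show ?thesis using orth[OF i] by simp
  qed
  have "e n * (L2norm a p)\<^sup>2 = (\<Sum>j=1..?M. e n * (norm (ip a (\<phi> j) p))\<^sup>2)"
    using modified_eigenbasis_energy(1)[OF bases V \<phi> pX'] by (simp only: sum_distrib_left)
  also have "\<dots> \<le> (\<Sum>j=1..?M. e j * (norm (ip a (\<phi> j) p))\<^sup>2)"
  proof (rule sum_mono)
    fix j assume j: "j \<in> {1..?M}"
    show "e n * (norm (ip a (\<phi> j) p))\<^sup>2 \<le> e j * (norm (ip a (\<phi> j) p))\<^sup>2"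
    proof (cases "j < n")
      case True
      then show ?thesis using orth'[of j] j by simp
    next
      case False
      have "mono_on {1..?M} e" using me by (simp add: modified_eigenvalues_def)
      then have "e n \<le> e j" by (rule mono_onD) (use False j nM n in auto)
      then show ?thesis by (rule mult_right_mono) simp
    qed
  qed
  also have "\<dots> = Re (ip a p (?H p))" by (rule modified_eigenbasis_energy(2)[OF bases V \<phi> pX', symmetric])
  also have "\<dots> = (\<Sum>G\<in>cutoff b Ec k. mod_kinetic g Ec k G * (norm (fourier a p G))\<^sup>2) + Re (ip a p (pot V p))"
    by (rule Re_ip_modified_op[OF bases V pX'])
  also have "(\<Sum>G\<in>cutoff b Ec k. mod_kinetic g Ec k G * (norm (fourier a p G))\<^sup>2)
      = (\<Sum>G\<in>low ?E. kinetic k G * (norm (fourier a \<Phi> G))\<^sup>2)"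
  proof (rule sum.mono_neutral_cong_right[OF finite_cutoff[OF bases] low_cut])
    show "\<forall>G\<in>cutoff b Ec k - low ?E. mod_kinetic g Ec k G * (norm (fourier a p G))\<^sup>2 = 0"
      using cutoff_subset[of b Ec k] by (auto simp: p_def fourier_lowproj)
    fix G assume G: "G \<in> low ?E"
    then have "G \<in> zspan b" by (simp add: low_def)
    then have "fourier a p G = fourier a \<Phi> G" unfolding p_def fourier_lowproj[OF \<open>G \<in> zspan b\<close>] using G by simp
    moreover have "mod_kinetic g Ec k G = kinetic k G"
      by (rule mod_kinetic_eq_kinetic[OF bu Ec]) (use G in \<open>simp add: low_def\<close>)
    ultimately show "mod_kinetic g Ec k G * (norm (fourier a p G))\<^sup>2 = kinetic k G * (norm (fourier a \<Phi> G))\<^sup>2"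
      by simp
  qed
  finally have "(e n - eps n) * (L2norm a p)\<^sup>2 \<le> (3 * \<Lambda> + B + 1) * t"
    using low_energy_difference[OF t \<Phi>Y N E(1)] unfolding p_def left_diff_distrib by linarith
  moreover have "(L2norm a p)\<^sup>2 \<ge> 1 / 2"
  proof -
    from highproj_norm[OF tail_bound_total \<Phi>Y, of ?E] E(1) N
    have "(L2norm a (\<Phi> - p))\<^sup>2 \<le> (\<Lambda> + B) / ?E" by (simp add: p_def)
    also have "\<dots> \<le> 1 / 2" using E by (simp add: divide_le_eq)
    finally show ?thesis using lowproj_pythagoras[OF Y_L2cell[OF \<Phi>Y], of ?E] N by (simp add: p_def)
  qed
  moreover have "0 \<le> e n - eps n" using modified_eigenvalue_lower[OF bu Ec me nM] by simp
  ultimately have "(e n - eps n) * (1 / 2) \<le> (3 * \<Lambda> + B + 1) * t"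
    by (meson mult_left_mono order_trans)
  then have "2 * ((e n - eps n) * (1 / 2)) \<le> 2 * ((3 * \<Lambda> + B + 1) * t)" by (rule mult_left_mono) simp
  moreover have "2 * ((e n - eps n) * (1 / 2)) = e n - eps n" by simp
  ultimately show ?thesis by (simp only: mult.assoc)
qed

end

section \<open>Sobolev norms and the rate of convergence\<close>

text \<open>Bounds on finite sums carry all the information that is needed from the Sobolev norm,
  and treat the two branches of its definition for \<open>s \<ge> 0\<close> alike.\<close>

lemma sobolev_sq_finite_sum_le:
  assumes bases: "lattice_bases a b" and f: "f \<in> L2cell a" and s: "0 \<le> s" and S: "0 \<le> S"
    and le: "sobolev_sq a b s f \<le> ennreal S" and A: "finite A" "A \<subseteq> zspan b"
  shows "(\<Sum>G\<in>A. (1 + (norm G)\<^sup>2) powr s * (norm (fourier a f G))\<^sup>2) \<le> S"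
proof (cases "s = 0")
  case True
  have "1 + (norm G)\<^sup>2 \<noteq> 0" for G :: "real^'a"
    by (metis add_nonneg_eq_0_iff zero_le_one zero_le_power2 zero_neq_one)
  then have "(\<Sum>G\<in>A. (1 + (norm G)\<^sup>2) powr s * (norm (fourier a f G))\<^sup>2) = (\<Sum>G\<in>A. (norm (fourier a f G))\<^sup>2)"
    using True by (intro sum.cong refl) simp
  also have "\<dots> \<le> (L2norm a f)\<^sup>2"
    by (rule has_sum_mono2[OF has_sum_finite[OF A(1)] parseval[OF bases f] A(2)]) simp
  also have "\<dots> \<le> S" using le True S by (simp add: sobolev_sq_def ennreal_le_iff)
  finally show ?thesis .
next
  case False
  let ?h = "\<lambda>G. (1 + (norm G)\<^sup>2) powr s * (norm (fourier a f G))\<^sup>2"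
  have "ennreal (\<Sum>G\<in>A. ?h G) = (\<Sum>G\<in>A. ennreal (?h G))" by (rule sum_ennreal[symmetric]) simp
  also have "\<dots> \<le> (SUP F\<in>{F. finite F \<and> F \<subseteq> zspan b}. \<Sum>G\<in>F. ennreal (?h G))"
    using A by (intro SUP_upper) simp
  also have "\<dots> = (\<Sum>\<^sub>\<infinity>G\<in>zspan b. ennreal (?h G))"
    by (rule nonneg_infsum_complete[symmetric]) simp
  also have "\<dots> \<le> ennreal S" using le s False by (simp add: sobolev_sq_def sobolev_sq_pos_def)
  finally show ?thesis using S by (simp add: ennreal_le_iff)
qed

context bounded_fiber begin

definition tail_const :: "real \<Rightarrow> real" where
  "tail_const s = (\<Lambda> + B + 1) + 2 powr s * (2 * (8 * (\<Lambda> + B + 1)) powr s + 1)"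

text \<open>For \<open>s \<ge> 1\<close>, a kinetic energy above \<open>E\<close> is at most
  \<open>E powr (1 - s)\<close> times its \<open>s\<close>-th power, which is bounded by \<open>(norm
  k)\<^sup>2 powr s\<close> plus the Sobolev weight. The dependence on \<open>k\<close> is harmless:
  since the total kinetic energy is bounded, half of the mass of \<open>\<Psi>\<close> sits at
  frequencies \<open>G\<close> in a fixed ball around \<open>- k\<close>, and there the Sobolev weight
  is itself at least a multiple of \<open>(norm k)\<^sup>2 powr s\<close>. For \<open>s < 1\<close>
  the total kinetic energy is a sufficient bound, because \<open>S\<close> and \<open>E powr (1 -
  s)\<close> are at least one.\<close>

lemma sobolev_tail_bound:
  assumes s: "0 \<le> s" and E: "1 \<le> E"
    and S: "\<And>\<Psi> A. \<Psi> \<in> Y \<Longrightarrow> L2norm a \<Psi> = 1 \<Longrightarrow> finite A \<Longrightarrow> A \<subseteq> zspan b \<Longrightarrow>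
        (\<Sum>G\<in>A. (1 + (norm G)\<^sup>2) powr s * (norm (fourier a \<Psi> G))\<^sup>2) \<le> S"
  shows "tail_bound E (tail_const s * E powr (1 - s) * S)"
  unfolding tail_bound_def
proof (intro ballI allI impI)
  fix \<Psi> A assume \<Psi>: "\<Psi> \<in> Y" and N: "L2norm a \<Psi> = 1" and A: "finite A" "A \<subseteq> zspan b - low E"
  note L2 = Y_L2cell[OF \<Psi>]
  define T where "T = \<Lambda> + B + 1"
  have T: "1 \<le> T" using \<Lambda>_nonneg B_nonneg by (simp add: T_def)
  let ?c = "\<lambda>G. (norm (fourier a \<Psi> G))\<^sup>2"
  have parseval1: "(\<Sum>G\<in>A. ?c G) \<le> 1" if "finite A" "A \<subseteq> zspan b" for A
    using has_sum_mono2[OF has_sum_finite[OF that(1)] parseval[OF bases L2] that(2)] N by simp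
  have S1: "1 \<le> S"
  proof -
    have "(L2norm a \<Psi>)\<^sup>2 \<le> S"
    proof (rule has_sum_le_of_finite_sums[OF parseval[OF bases L2]])
      fix F assume F: "finite F" "F \<subseteq> zspan b"
      have "(\<Sum>G\<in>F. ?c G) \<le> (\<Sum>G\<in>F. (1 + (norm G)\<^sup>2) powr s * ?c G)"
      proof (rule sum_mono)
        fix G :: "real^'d"
        have "1 \<le> (1 + (norm G)\<^sup>2) powr s" using s by (intro ge_one_powr_ge_zero) auto
        then have "1 * ?c G \<le> (1 + (norm G)\<^sup>2) powr s * ?c G" by (rule mult_right_mono) simp
        then show "?c G \<le> (1 + (norm G)\<^sup>2) powr s * ?c G" by simp
      qed
      also have "\<dots> \<le> S" by (rule S[OF \<Psi> N F])
      finally show "(\<Sum>G\<in>F. ?c G) \<le> S" .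
    qed
    then show ?thesis using N by simp
  qed
  have total: "(\<Sum>G\<in>A. kinetic k G * ?c G) \<le> T" if "finite A" "A \<subseteq> zspan b" for A
    using total_kinetic_energy[OF \<Psi> that] N by (simp add: T_def)
  show "(\<Sum>G\<in>A. kinetic k G * ?c G) \<le> tail_const s * E powr (1 - s) * S"
  proof (cases "s < 1")
    case True
    have "(\<Sum>G\<in>A. kinetic k G * ?c G) \<le> T" using A by (intro total) auto
    also have "\<dots> \<le> tail_const s" by (simp add: tail_const_def T_def)
    also have "\<dots> = tail_const s * 1 * 1" by simp
    also have "\<dots> \<le> tail_const s * E powr (1 - s) * S"
    proof (intro mult_mono order_refl S1)
      show "1 \<le> E powr (1 - s)" using E True by (intro ge_one_powr_ge_zero) auto
      show c0: "0 \<le> tail_const s" using T by (simp add: tail_const_def T_def)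
      show "0 \<le> tail_const s * E powr (1 - s)" using c0 by simp
    qed auto
    finally show ?thesis .
  next
    case False
    then have s1: "1 \<le> s" by simp
    have k_le: "((norm k)\<^sup>2) powr s \<le> 2 * (8 * T) powr s * S"
    proof -
      have "(L2norm a (\<Psi> - lowproj (2 * T) \<Psi>))\<^sup>2 \<le> (\<Lambda> + B) / (2 * T)"
        using highproj_norm[OF tail_bound_total \<Psi>, of "2 * T"] T N by simp
      also have "\<dots> \<le> 1 / 2" using T by (simp add: divide_le_eq) (simp add: T_def)
      finally have "(L2norm a (\<Psi> - lowproj (2 * T) \<Psi>))\<^sup>2 \<le> 1 / 2" .
      then have half: "1 / 2 \<le> (\<Sum>G\<in>low (2 * T). ?c G)"
        using lowproj_pythagoras[OF L2, of "2 * T"] N unfolding lowproj_norm by simp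
      have "((norm k)\<^sup>2) powr s * (1 / 2) \<le> ((norm k)\<^sup>2) powr s * (\<Sum>G\<in>low (2 * T). ?c G)"
        using half by (rule mult_left_mono) simp
      also have "\<dots> = (\<Sum>G\<in>low (2 * T). ((norm k)\<^sup>2) powr s * ?c G)" by (rule sum_distrib_left)
      also have "\<dots> \<le> (\<Sum>G\<in>low (2 * T). (8 * T) powr s * ((1 + (norm G)\<^sup>2) powr s * ?c G))"
      proof (rule sum_mono)
        fix G assume "G \<in> low (2 * T)"
        then have kG: "(norm (k + G))\<^sup>2 \<le> 4 * T" by (simp add: low_def kinetic_def)
        have "(norm k)\<^sup>2 \<le> 2 * (norm (k + G))\<^sup>2 + 2 * (norm G)\<^sup>2"
          using norm_add_power2_le[of "k + G" "- G"] by simp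
        also have "\<dots> \<le> 8 * T + 8 * T * (norm G)\<^sup>2"
        proof -
          have "2 * (norm G)\<^sup>2 \<le> 8 * T * (norm G)\<^sup>2" using T by (intro mult_right_mono) auto
          then show ?thesis using kG by linarith
        qed
        also have "\<dots> = 8 * T * (1 + (norm G)\<^sup>2)" by (simp add: distrib_left)
        finally have "((norm k)\<^sup>2) powr s \<le> (8 * T * (1 + (norm G)\<^sup>2)) powr s"
          using s by (intro powr_mono2) auto
        also have "\<dots> = (8 * T) powr s * (1 + (norm G)\<^sup>2) powr s"
          by (rule powr_mult)
        finally show "((norm k)\<^sup>2) powr s * ?c G \<le> (8 * T) powr s * ((1 + (norm G)\<^sup>2) powr s * ?c G)"
          unfolding mult.assoc[symmetric] by (rule mult_right_mono) simp
      qed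
      also have "\<dots> = (8 * T) powr s * (\<Sum>G\<in>low (2 * T). (1 + (norm G)\<^sup>2) powr s * ?c G)"
        by (rule sum_distrib_left[symmetric])
      also have "\<dots> \<le> (8 * T) powr s * S"
        by (intro mult_left_mono S[OF \<Psi> N finite_low]) (auto simp: low_def)
      finally show ?thesis by simp
    qed
    have point: "kinetic k G * ?c G \<le>
        E powr (1 - s) * 2 powr s * (((norm k)\<^sup>2) powr s * ?c G + (1 + (norm G)\<^sup>2) powr s * ?c G)"
      if G: "G \<in> A" for G
    proof -
      have kin: "E < kinetic k G" using G A by (auto simp: low_def)
      then have pos: "0 < kinetic k G" using E by simp
      let ?x = "(norm k)\<^sup>2" and ?y = "1 + (norm G)\<^sup>2"
      have "kinetic k G \<le> 2 * max ?x ?y"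
        using norm_add_power2_le[of k G] by (simp add: kinetic_def max_def)
      then have "kinetic k G powr s \<le> (2 * max ?x ?y) powr s" using s pos by (intro powr_mono2) auto
      also have "\<dots> = 2 powr s * max ?x ?y powr s" by (rule powr_mult)
      also have "max ?x ?y powr s \<le> ?x powr s + ?y powr s" by (simp add: max_def)
      finally have a: "kinetic k G powr s \<le> 2 powr s * (?x powr s + ?y powr s)" by simp
      have b: "kinetic k G powr (1 - s) \<le> E powr (1 - s)"
        using s1 kin E by (intro powr_mono2') auto
      have "kinetic k G = kinetic k G powr (1 - s) * kinetic k G powr s"
        using pos by (simp add: powr_add[symmetric])
      also have "\<dots> \<le> E powr (1 - s) * (2 powr s * (?x powr s + ?y powr s))"
        by (intro mult_mono a b) auto
      finally have "kinetic k G * ?c G \<le> E powr (1 - s) * (2 powr s * (?x powr s + ?y powr s)) * ?c G"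
        by (rule mult_right_mono) simp
      then show ?thesis by (simp add: algebra_simps)
    qed
    have "(\<Sum>G\<in>A. kinetic k G * ?c G) \<le> (\<Sum>G\<in>A. E powr (1 - s) * 2 powr s *
        (((norm k)\<^sup>2) powr s * ?c G + (1 + (norm G)\<^sup>2) powr s * ?c G))"
      by (rule sum_mono) (rule point)
    also have "\<dots> = E powr (1 - s) * 2 powr s *
        (((norm k)\<^sup>2) powr s * (\<Sum>G\<in>A. ?c G) + (\<Sum>G\<in>A. (1 + (norm G)\<^sup>2) powr s * ?c G))"
      by (simp only: sum_distrib_left[symmetric] sum.distrib)
    also have "\<dots> \<le> E powr (1 - s) * 2 powr s * (2 * (8 * T) powr s * S + S)"
    proof (intro mult_left_mono add_mono)
      have "((norm k)\<^sup>2) powr s * (\<Sum>G\<in>A. ?c G) \<le> ((norm k)\<^sup>2) powr s * 1"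
        using A by (intro mult_left_mono parseval1) auto
      with k_le show "((norm k)\<^sup>2) powr s * (\<Sum>G\<in>A. ?c G) \<le> 2 * (8 * T) powr s * S" by simp
      show "(\<Sum>G\<in>A. (1 + (norm G)\<^sup>2) powr s * ?c G) \<le> S" using A by (intro S[OF \<Psi> N]) auto
    qed simp
    also have "\<dots> = (2 powr s * (2 * (8 * T) powr s + 1)) * (E powr (1 - s) * S)"
      by (simp add: algebra_simps)
    also have "\<dots> \<le> tail_const s * (E powr (1 - s) * S)"
      using S1 T by (intro mult_right_mono) (auto simp: tail_const_def T_def)
    finally show ?thesis by (simp only: mult.assoc)
  qed
qed

end

theorem theorem5p1:
  fixes a b :: "'d::finite \<Rightarrow> real^'d"
    and m n :: nat
    and g :: "real \<Rightarrow> real"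
    and V :: "real^'d \<Rightarrow> real"
    and r :: real
    and eps :: "real^'d \<Rightarrow> nat \<Rightarrow> real"
    and u :: "real^'d \<Rightarrow> nat \<Rightarrow> real^'d \<Rightarrow> complex"
    and epst :: "real \<Rightarrow> real^'d \<Rightarrow> nat \<Rightarrow> real"
  assumes "lattice_bases a b"
    and "blow_up_function m g"
    and "r > 1 - real CARD('d) / 4" and "r \<ge> - 2"
    and "(\<lambda>x. complex_of_real (V x)) \<in> Linfper a \<inter> Hper a b r"
    and "\<And>k. fiber_eigenbasis a b V k (eps k) (u k)"
    and "\<And>Ec k. Ec > 0 \<Longrightarrow> modified_eigenvalues a b V g Ec k (epst Ec k)"
    and "n \<ge> 1"
  shows "\<exists>Ecs>0. \<exists>C>0. \<forall>Ec\<ge>Ecs. \<forall>k.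
    n \<le> Mdim a b Ec k \<and>
    0 \<le> epst Ec k n - eps k n \<and>
    ennreal (epst Ec k n - eps k n)
      \<le> ennreal ((C / Ec) powr (r + 1 - real CARD('d) / 4)) *
         (SUP \<Phi> \<in> {\<Phi> \<in> cspan (u k ` {1..n}). L2norm a \<Phi> = 1}. sobolev_sq a b (r + 2) \<Phi>)"
proof -
  note bases = assms(1)
  obtain B where V: "bounded_potential V B"
    using assms(5) bounded_potential_Linfper by blast
  have B: "0 \<le> B" using V by (simp add: bounded_potential_def)
  obtain \<Lambda>0 where \<Lambda>0: "\<And>k. eps k n \<le> \<Lambda>0"
    using fiber_eigenvalue_upper_bound[OF bases V assms(8)] assms(6) by blast
  define \<Lambda> where "\<Lambda> = max \<Lambda>0 B"
  have \<Lambda>: "0 \<le> \<Lambda>" using B by (simp add: \<Lambda>_def)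
  have eps_bound: "\<bar>eps k j\<bar> \<le> \<Lambda>" if "j \<in> {1..n}" for k j
  proof -
    have "eps k j \<le> eps k n" using fiber_eigenbasisD(4)[OF bases assms(6)[of k], of j n] that by simp
    moreover have "- B \<le> eps k j" using fiber_eigenvalue_lower_bound[OF bases V assms(6)[of k], of j] that by simp
    ultimately show ?thesis using \<Lambda>0[of k] by (simp add: \<Lambda>_def)
  qed
  obtain R where R: "\<And>k. \<exists>A\<subseteq>zspan b. finite A \<and> card A = n \<and> (\<forall>G\<in>A. norm (k + G) \<le> R)"
    using plane_waves_near[OF bases] by blast
  \<comment> \<open>With \<open>C = 4\<close> the factor \<open>C / Ec\<close> is the reciprocal of the splitting energy \<open>Ec / 4\<close>. The
    estimates decay like \<open>(Ec / 4) powr (- r - 1)\<close>, by \<open>(Ec / 4) powr (- d / 4)\<close> faster than required;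
    this excess absorbs the constant \<open>K\<close> as soon as \<open>Ec / 4\<close> exceeds \<open>\<bar>K\<bar> powr (4 / d)\<close>.\<close>
  define d where "d = real CARD('d)"
  have d: "d > 0" by (simp add: d_def)
  define s where "s = r + 2"
  have s: "0 \<le> s" using assms(4) by (simp add: s_def)
  define p where "p = r + 1 - d / 4"
  define K where "K = 2 * (3 * \<Lambda> + B + 1) * bounded_fiber.tail_const B \<Lambda> s"
  \<comment> \<open>The summands serve, in this order, the tail estimate, the mass kept by the projection, the
    plane waves near \<open>- k\<close> that must lie inside the cutoff, and the absorption of \<open>K\<close>.\<close>
  define E0 where "E0 = 1 + 2 * (\<Lambda> + B) + R\<^sup>2 + \<bar>K\<bar> powr (4 / d)"
  have E0: "1 \<le> E0" "2 * (\<Lambda> + B) \<le> E0" "R\<^sup>2 < E0" "\<bar>K\<bar> powr (4 / d) \<le> E0"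
    using \<Lambda> B by (simp_all add: E0_def add_nonneg_nonneg add_pos_nonneg)
  show ?thesis
  proof (rule exI[of _ "4 * E0"], intro conjI exI[of _ "4 :: real"] allI impI)
    show "0 < 4 * E0" using E0(1) by simp
    show "(0 :: real) < 4" by simp
    fix Ec :: real and k :: "real^'d" assume Ec: "4 * E0 \<le> Ec"
    have Ec0: "Ec > 0" using Ec E0(1) by simp
    have E: "1 \<le> Ec / 4" "2 * (\<Lambda> + B) \<le> Ec / 4" "\<bar>K\<bar> powr (4 / d) \<le> Ec / 4"
      using Ec E0 by simp_all
    note me = assms(7)[OF Ec0, of k]
    interpret bounded_fiber a b V B k "eps k" "u k" n \<Lambda>
      by unfold_locales (use bases V assms(6,8) eps_bound in auto)
    show nM: "n \<le> Mdim a b Ec k"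
    proof -
      obtain A where A: "A \<subseteq> zspan b" "finite A" "card A = n" "\<And>G. G \<in> A \<Longrightarrow> norm (k + G) \<le> R"
        using R[of k] by blast
      have "A \<subseteq> cutoff b Ec k"
      proof
        fix G assume G: "G \<in> A"
        have "(norm (k + G))\<^sup>2 \<le> R\<^sup>2" using A(4)[OF G] by (intro power_mono) auto
        then have "(norm (k + G))\<^sup>2 / 2 < Ec" using E0(1,3) Ec by simp
        then show "G \<in> cutoff b Ec k" using A(1) G by (auto simp: cutoff_def)
      qed
      then show ?thesis
        unfolding Mdim_eq_card[OF bases] A(3)[symmetric] by (intro card_mono finite_cutoff[OF bases])
    qed
    show ge: "0 \<le> epst Ec k n - eps k n"
      using modified_eigenvalue_lower[OF assms(2) Ec0 me nM] by simp
    let ?S = "SUP \<Phi> \<in> {\<Phi> \<in> cspan (u k ` {1..n}). L2norm a \<Phi> = 1}. sobolev_sq a b (r + 2) \<Phi>"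
    have factor: "0 < (4 / Ec) powr p" using Ec0 by simp
    have "ennreal (epst Ec k n - eps k n) \<le> ennreal ((4 / Ec) powr p) * ?S"
    proof (cases "?S = top")
      case True
      show ?thesis unfolding True using factor by (simp add: ennreal_mult_top)
    next
      case False
      define S where "S = enn2real ?S"
      have S: "?S = ennreal S" "0 \<le> S"
        unfolding S_def using False unfolding less_top by (simp_all only: ennreal_enn2real enn2real_nonneg)
      have finite_sums: "(\<Sum>G\<in>A. (1 + (norm G)\<^sup>2) powr s * (norm (fourier a \<Psi> G))\<^sup>2) \<le> S"
        if \<Psi>: "\<Psi> \<in> Y" "L2norm a \<Psi> = 1" and A: "finite A" "A \<subseteq> zspan b" for \<Psi> A
      proof (rule sobolev_sq_finite_sum_le[OF bases Y_L2cell[OF \<Psi>(1)] s S(2) _ A])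
        show "sobolev_sq a b s \<Psi> \<le> ennreal S"
          unfolding S(1)[symmetric] s_def using \<Psi> by (intro SUP_upper) simp
      qed
      have "epst Ec k n - eps k n \<le> 2 * (3 * \<Lambda> + B + 1) * (tail_const s * (Ec / 4) powr (1 - s) * S)"
        by (rule modified_eigenvalue_upper[OF assms(2) Ec0 me nM
              sobolev_tail_bound[OF s E(1) finite_sums] E(1,2)])
      also have "\<dots> = K * (Ec / 4) powr (1 - s) * S" by (simp add: K_def)
      also have "\<dots> \<le> (4 / Ec) powr p * S"
      proof (rule mult_right_mono[OF _ S(2)])
        have "K \<le> \<bar>K\<bar>" by simp
        also have "\<bar>K\<bar> = (\<bar>K\<bar> powr (4 / d)) powr (d / 4)" using d by (simp add: powr_powr)
        also have "\<dots> \<le> (Ec / 4) powr (d / 4)" using E(3) d by (intro powr_mono2) auto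
        finally have "K * (Ec / 4) powr (1 - s) \<le> (Ec / 4) powr (d / 4) * (Ec / 4) powr (1 - s)"
          by (rule mult_right_mono) simp
        also have "\<dots> = (Ec / 4) powr (d / 4 + (1 - s))" by (rule powr_add[symmetric])
        also have "d / 4 + (1 - s) = - p" by (simp add: p_def s_def)
        also have "(Ec / 4) powr (- p) = (4 / Ec) powr p"
          using Ec0 by (simp add: powr_minus powr_divide)
        finally show "K * (Ec / 4) powr (1 - s) \<le> (4 / Ec) powr p" .
      qed
      finally have "ennreal (epst Ec k n - eps k n) \<le> ennreal ((4 / Ec) powr p * S)" by (rule ennreal_leI)
      also have "\<dots> = ennreal ((4 / Ec) powr p) * ?S" unfolding S(1) by (rule ennreal_mult) (use S(2) in auto)
      finally show ?thesis .
    qed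
    then show "ennreal (epst Ec k n - eps k n)
      \<le> ennreal ((4 / Ec) powr (r + 1 - real CARD('d) / 4)) * ?S"
      by (simp only: p_def d_def)
  qed
qed

end
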